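(* Let $H=H_{n,q,N,\nu}$ be the Hopf algebra over a field $k$ defined in the context, with $H\ne k\mathbb Z_N$, and let $\omega\in k$ be a primitive $N$th root of unity. Then, as Hopf algebras, $H^*\cong H_{\frac{N}{(N,\nu)},\,\omega^\nu,\,N,\,\mu}$ for some $0\le\mu\le N-1$ such that $q=\omega^\mu$.
   Context: $(b,c)$ denotes the greatest common divisor of integers $b,c$. Let $n,\nu,N$ be positive integers with $n\mid N$, $1\le\nu<N$; let $q\in k$ be a primitive $n$th root of unity and $r=|q^\nu|$ the multiplicative order of $q^\nu$. $H_{n,q,N,\nu}$ is the Hopf algebra over $k$ generated as an algebra by $a,x$ with relations $a^N=1$, $x^r=0$, $xa=qax$, and with $\Delta(a)=a\otimes a$, $\Delta(x)=x\otimes a^\nu+1\otimes x$, $\varepsilon(a)=1$, $\varepsilon(x)=0$, antipode $s(a)=a^{-1}$, $s(x)=-q^{-\nu}a^{-\nu}x$. The condition $H_{n,q,N,\nu}\neq k\mathbb Z_N$ means $x\ne0$, i.e. $r>1$ (equivalently $n\nmid\nu$). *)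

theory Defs
  imports
    "HOL-Library.Poly_Mapping"
    "HOL-Algebra.QuotRing"
    "HOL-Algebra.Multiplicative_Group"
    "HOL-Algebra.Algebraic_Closure_Type"
begin

section \<open>Algebras over a field and their quotients\<close>

text \<open>The ground field is a type of class \<open>field\<close>; the library predicates about modules see it as
  the ring \<^const>\<open>ring_of_type_algebra\<close>. The library locale \<open>algebra\<close> is restricted to commutative
  algebras.\<close>

locale assoc_algebra =
  module ring_of_type_algebra A + ring A
  for A :: "('k::field, 'a, 'm) module_scheme" (structure) +
  assumes smult_mult_left:
      "\<lbrakk> a \<in> carrier A; b \<in> carrier A \<rbrakk> \<Longrightarrow> (c \<odot> a) \<otimes> b = c \<odot> (a \<otimes> b)"
    and smult_mult_right:
      "\<lbrakk> a \<in> carrier A; b \<in> carrier A \<rbrakk> \<Longrightarrow> a \<otimes> (c \<odot> b) = c \<odot> (a \<otimes> b)"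

definition scalars :: "('k::field, 'k) module"
  where "scalars = \<lparr>carrier = UNIV, monoid.mult = (*), one = 1, ring.zero = 0, add = (+),
    module.smult = (*)\<rparr>"

definition linear_maps ::
    "('k::field, 'a, 'm) module_scheme \<Rightarrow> ('k, 'b, 'n) module_scheme \<Rightarrow> ('a \<Rightarrow> 'b) set"
  where "linear_maps A B =
    {f \<in> carrier A \<rightarrow> carrier B.
       (\<forall>a\<in>carrier A. \<forall>b\<in>carrier A. f (a \<oplus>\<^bsub>A\<^esub> b) = f a \<oplus>\<^bsub>B\<^esub> f b) \<and>
       (\<forall>c. \<forall>a\<in>carrier A. f (c \<odot>\<^bsub>A\<^esub> a) = c \<odot>\<^bsub>B\<^esub> f a)}"

definition algebra_homs ::
    "('k::field, 'a, 'm) module_scheme \<Rightarrow> ('k, 'b, 'n) module_scheme \<Rightarrow> ('a \<Rightarrow> 'b) set"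
  where "algebra_homs A B = ring_hom A B \<inter> linear_maps A B"

definition quot_algebra ::
    "('k::field, 'a, 'm) module_scheme \<Rightarrow> 'a set \<Rightarrow> ('k, 'a set) module"
  where "quot_algebra A I =
    \<lparr>carrier = carrier (A Quot I), monoid.mult = monoid.mult (A Quot I), one = one (A Quot I),
     ring.zero = ring.zero (A Quot I), add = add (A Quot I),
     module.smult = (\<lambda>c C. \<Union>a\<in>C. I +>\<^bsub>A\<^esub> (c \<odot>\<^bsub>A\<^esub> a))\<rparr>"

text \<open>The map on cosets induced by a map \<open>f\<close> that is constant on each of them.\<close>

definition on_cosets :: "('a \<Rightarrow> 'b) \<Rightarrow> 'a set \<Rightarrow> 'b"
  where "on_cosets f C = the_elem (f ` C)"


section \<open>Formal linear combinations\<close>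

definition fm_scale :: "'k::field \<Rightarrow> ('b \<Rightarrow>\<^sub>0 'k) \<Rightarrow> ('b \<Rightarrow>\<^sub>0 'k)"
  where "fm_scale c p = Poly_Mapping.map ((*) c) p"

lemma lookup_fm_scale [simp]:
  "Poly_Mapping.lookup (fm_scale c p) b = c * Poly_Mapping.lookup p b"
  by (simp add: fm_scale_def Poly_Mapping.map.rep_eq when_def)

interpretation fm: vector_space fm_scale
  by unfold_locales (auto intro!: poly_mapping_eqI simp: lookup_add algebra_simps)

definition monoid_algebra :: "('b, 'm) monoid_scheme \<Rightarrow> ('k::field, 'b \<Rightarrow>\<^sub>0 'k) module"
  where "monoid_algebra M =
    \<lparr>carrier = {p. Poly_Mapping.keys p \<subseteq> carrier M},
     monoid.mult = (\<lambda>p p'. \<Sum>b\<in>Poly_Mapping.keys p. \<Sum>c\<in>Poly_Mapping.keys p'.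
        Poly_Mapping.single (b \<otimes>\<^bsub>M\<^esub> c) (Poly_Mapping.lookup p b * Poly_Mapping.lookup p' c)),
     one = Poly_Mapping.single \<one>\<^bsub>M\<^esub> 1, ring.zero = 0, add = (+), module.smult = fm_scale\<rparr>"

definition lin_ext ::
    "('k::field, 'a, 'm) module_scheme \<Rightarrow> ('b \<Rightarrow> 'a) \<Rightarrow> ('b \<Rightarrow>\<^sub>0 'k) \<Rightarrow> 'a"
  where "lin_ext A f p =
    (\<Oplus>\<^bsub>A\<^esub>b\<in>Poly_Mapping.keys p. Poly_Mapping.lookup p b \<odot>\<^bsub>A\<^esub> f b)"


section \<open>Tensor products of algebras\<close>

definition bilinearity ::
    "('k::field, 'a, 'm) module_scheme \<Rightarrow> ('k, 'b, 'n) module_scheme \<Rightarrow> ('a \<times> 'b \<Rightarrow>\<^sub>0 'k) set"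
  where "bilinearity A B =
    {Poly_Mapping.single (a \<oplus>\<^bsub>A\<^esub> a', b) 1 - Poly_Mapping.single (a, b) 1
       - Poly_Mapping.single (a', b) 1 | a a' b.
       a \<in> carrier A \<and> a' \<in> carrier A \<and> b \<in> carrier B} \<union>
    {Poly_Mapping.single (a, b \<oplus>\<^bsub>B\<^esub> b') 1 - Poly_Mapping.single (a, b) 1
       - Poly_Mapping.single (a, b') 1 | a b b'.
       a \<in> carrier A \<and> b \<in> carrier B \<and> b' \<in> carrier B} \<union>
    {Poly_Mapping.single (c \<odot>\<^bsub>A\<^esub> a, b) 1 - Poly_Mapping.single (a, b) c | c a b.
       a \<in> carrier A \<and> b \<in> carrier B} \<union>
    {Poly_Mapping.single (a, c \<odot>\<^bsub>B\<^esub> b) 1 - Poly_Mapping.single (a, b) c | c a b.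
       a \<in> carrier A \<and> b \<in> carrier B}"

text \<open>The vector space with basis \<open>A \<times> B\<close> modulo the subspace spanned by the bilinearity relations.
  That subspace is an ideal of the monoid algebra of \<open>A \<times> B\<close>, which accounts for the product
  \<open>(a \<otimes> b)(a' \<otimes> b') = aa' \<otimes> bb'\<close>.\<close>

definition tensor ::
    "('k::field, 'a, 'm) module_scheme \<Rightarrow> ('k, 'b, 'n) module_scheme \<Rightarrow>
      ('k, ('a \<times> 'b \<Rightarrow>\<^sub>0 'k) set) module"
  where "tensor A B = quot_algebra (monoid_algebra (A \<times>\<times> B)) (fm.span (bilinearity A B))"

definition pure_tensor ::
    "('k::field, 'a, 'm) module_scheme \<Rightarrow> ('k, 'b, 'n) module_scheme \<Rightarrow>
      'a \<Rightarrow> 'b \<Rightarrow> ('a \<times> 'b \<Rightarrow>\<^sub>0 'k) set"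
  where "pure_tensor A B a b =
    fm.span (bilinearity A B)
      +>\<^bsub>(monoid_algebra (A \<times>\<times> B) :: ('k, _) module)\<^esub> Poly_Mapping.single (a, b) 1"

text \<open>The linear map \<open>a \<otimes> b \<mapsto> \<beta> a b\<close> into \<open>U\<close> induced by a bilinear map \<open>\<beta>\<close>.\<close>

definition tensor_lift ::
    "('k::field, 'u, 'm) module_scheme \<Rightarrow> ('a \<Rightarrow> 'b \<Rightarrow> 'u) \<Rightarrow> ('a \<times> 'b \<Rightarrow>\<^sub>0 'k) set \<Rightarrow> 'u"
  where "tensor_lift U \<beta> = on_cosets (lin_ext U (\<lambda>(a, b). \<beta> a b))"

text \<open>\<open>f \<otimes> g\<close>, with values in \<open>C \<otimes> D\<close>.\<close>

definition tensor_map ::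
    "('k::field, 'c, 'm) module_scheme \<Rightarrow> ('k, 'd, 'n) module_scheme \<Rightarrow>
      ('a \<Rightarrow> 'c) \<Rightarrow> ('b \<Rightarrow> 'd) \<Rightarrow> ('a \<times> 'b \<Rightarrow>\<^sub>0 'k) set \<Rightarrow> ('c \<times> 'd \<Rightarrow>\<^sub>0 'k) set"
  where "tensor_map C D f g = tensor_lift (tensor C D) (\<lambda>a b. pure_tensor C D (f a) (g b))"

text \<open>\<open>(A \<otimes> B) \<otimes> C \<rightarrow> A \<otimes> (B \<otimes> C)\<close>\<close>

definition tensor_assoc ::
    "('k::field, 'a, 'm) module_scheme \<Rightarrow> ('k, 'b, 'n) module_scheme \<Rightarrow>
      ('k, 'c, 'l) module_scheme \<Rightarrow>
      (('a \<times> 'b \<Rightarrow>\<^sub>0 'k) set \<times> 'c \<Rightarrow>\<^sub>0 'k) set \<Rightarrow> ('a \<times> ('b \<times> 'c \<Rightarrow>\<^sub>0 'k) set \<Rightarrow>\<^sub>0 'k) set"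
  where "tensor_assoc A B C =
    tensor_lift (tensor A (tensor B C))
      (\<lambda>t c. tensor_lift (tensor A (tensor B C))
         (\<lambda>a b. pure_tensor A (tensor B C) a (pure_tensor B C b c)) t)"


section \<open>Hopf algebras\<close>

record (overloaded) ('k::zero, 'a) hopf = "('k, 'a) module" +
  comult :: "'a \<Rightarrow> ('a \<times> 'a \<Rightarrow>\<^sub>0 'k) set"
  counit :: "'a \<Rightarrow> 'k"
  antipode :: "'a \<Rightarrow> 'a"

locale hopf_algebra = assoc_algebra H
  for H :: "('k::field, 'a, 'm) hopf_scheme" (structure) +
  assumes comult_hom: "comult H \<in> algebra_homs H (tensor H H)"
    and counit_hom: "counit H \<in> algebra_homs H scalars"
    and antipode_linear: "antipode H \<in> linear_maps H H"
    and coassoc: "h \<in> carrier H \<Longrightarrow>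
      tensor_assoc H H H (tensor_map (tensor H H) H (comult H) id (comult H h)) =
      tensor_map H (tensor H H) id (comult H) (comult H h)"
    and counit_left: "h \<in> carrier H \<Longrightarrow>
      tensor_lift H (\<lambda>a b. counit H a \<odot> b) (comult H h) = h"
    and counit_right: "h \<in> carrier H \<Longrightarrow>
      tensor_lift H (\<lambda>a b. counit H b \<odot> a) (comult H h) = h"
    and antipode_left: "h \<in> carrier H \<Longrightarrow>
      tensor_lift H (\<lambda>a b. antipode H a \<otimes> b) (comult H h) = counit H h \<odot> \<one>"
    and antipode_right: "h \<in> carrier H \<Longrightarrow>
      tensor_lift H (\<lambda>a b. a \<otimes> antipode H b) (comult H h) = counit H h \<odot> \<one>"

definition hopf_homs ::
    "('k::field, 'a, 'm) hopf_scheme \<Rightarrow> ('k, 'b, 'n) hopf_scheme \<Rightarrow> ('a \<Rightarrow> 'b) set"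
  where "hopf_homs A B =
    {\<phi> \<in> algebra_homs A B. \<forall>a\<in>carrier A.
       comult B (\<phi> a) = tensor_map B B \<phi> \<phi> (comult A a) \<and>
       counit B (\<phi> a) = counit A a \<and>
       antipode B (\<phi> a) = \<phi> (antipode A a)}"

definition hopf_isomorphic ::
    "('k::field, 'a, 'm) hopf_scheme \<Rightarrow> ('k, 'b, 'n) hopf_scheme \<Rightarrow> bool"
  where "hopf_isomorphic A B \<longleftrightarrow>
    hopf_algebra A \<and> hopf_algebra B \<and>
    (\<exists>\<phi>\<in>hopf_homs A B. bij_betw \<phi> (carrier A) (carrier B))"


section \<open>The dual of a finite-dimensional Hopf algebra\<close>

text \<open>Functionals are made \<^const>\<open>extensional\<close>, so that equality of functions is equality
  of functionals.\<close>

definition dual_algebra :: "('k::field, 'a, 'm) hopf_scheme \<Rightarrow> ('k, 'a \<Rightarrow> 'k) module"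
  where "dual_algebra H =
    \<lparr>carrier = linear_maps H scalars \<inter> extensional (carrier H),
     monoid.mult = (\<lambda>f g. \<lambda>h\<in>carrier H. tensor_lift scalars (\<lambda>a b. f a * g b) (comult H h)),
     one = restrict (counit H) (carrier H),
     ring.zero = (\<lambda>h\<in>carrier H. 0),
     add = (\<lambda>f g. \<lambda>h\<in>carrier H. f h + g h),
     module.smult = (\<lambda>c f. \<lambda>h\<in>carrier H. c * f h)\<rparr>"

text \<open>\<open>\<Delta> f\<close> is the element of \<open>H\<^sup>* \<otimes> H\<^sup>*\<close> that corresponds to \<open>h \<otimes> h' \<mapsto> f (h h')\<close> under the
  embedding \<open>H\<^sup>* \<otimes> H\<^sup>* \<rightarrow> (H \<otimes> H)\<^sup>*\<close>, which is surjective when \<open>H\<close> has finite dimension.\<close>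

definition hopf_dual :: "('k::field, 'a, 'm) hopf_scheme \<Rightarrow> ('k, 'a \<Rightarrow> 'k) hopf"
  where "hopf_dual H =
    \<lparr>carrier = carrier (dual_algebra H), monoid.mult = monoid.mult (dual_algebra H),
     one = one (dual_algebra H), ring.zero = ring.zero (dual_algebra H),
     add = add (dual_algebra H), module.smult = module.smult (dual_algebra H),
     comult = (\<lambda>f. THE t. t \<in> carrier (tensor (dual_algebra H) (dual_algebra H)) \<and>
       (\<forall>h\<in>carrier H. \<forall>h'\<in>carrier H.
          tensor_lift scalars (\<lambda>f\<^sub>1 f\<^sub>2. f\<^sub>1 h * f\<^sub>2 h') t = f (h \<otimes>\<^bsub>H\<^esub> h'))),
     counit = (\<lambda>f. f \<one>\<^bsub>H\<^esub>),
     antipode = (\<lambda>f. \<lambda>h\<in>carrier H. f (antipode H h))\<rparr>"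


section \<open>The Hopf algebras \<open>H\<^bsub>n,q,N,\<nu>\<^esub>\<close>\<close>

definition primitive_root_of_unity :: "nat \<Rightarrow> 'k::field \<Rightarrow> bool"
  where "primitive_root_of_unity n q \<longleftrightarrow> 0 < n \<and> q ^ n = 1 \<and> (\<forall>m. 0 < m \<and> m < n \<longrightarrow> q ^ m \<noteq> 1)"

definition mult_order :: "'k::field \<Rightarrow> nat"
  where "mult_order c = group.ord (mult_of ring_of_type_algebra) c"

definition radford_params :: "nat \<Rightarrow> 'k::field \<Rightarrow> nat \<Rightarrow> nat \<Rightarrow> bool"
  where "radford_params n q N \<nu> \<longleftrightarrow>
    0 < n \<and> 0 < N \<and> n dvd N \<and> 1 \<le> \<nu> \<and> \<nu> < N \<and> primitive_root_of_unity n q"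

datatype generator = Gen_a | Gen_x

definition free_monoid :: "generator list monoid"
  where "free_monoid = \<lparr>carrier = UNIV, monoid.mult = (@), one = []\<rparr>"

definition free_algebra :: "('k::field, generator list \<Rightarrow>\<^sub>0 'k) module"
  where "free_algebra = monoid_algebra free_monoid"

definition radford_relations :: "'k::field \<Rightarrow> nat \<Rightarrow> nat \<Rightarrow> (generator list \<Rightarrow>\<^sub>0 'k) set"
  where "radford_relations q N \<nu> =
    {Poly_Mapping.single (replicate N Gen_a) 1 - Poly_Mapping.single [] 1,
     Poly_Mapping.single (replicate (mult_order (q ^ \<nu>)) Gen_x) 1,
     Poly_Mapping.single [Gen_x, Gen_a] 1 - Poly_Mapping.single [Gen_a, Gen_x] q}"

definition radford_ideal :: "'k::field \<Rightarrow> nat \<Rightarrow> nat \<Rightarrow> (generator list \<Rightarrow>\<^sub>0 'k) set"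
  where "radford_ideal q N \<nu> = Idl\<^bsub>free_algebra\<^esub> (radford_relations q N \<nu>)"

definition radford_algebra ::
    "'k::field \<Rightarrow> nat \<Rightarrow> nat \<Rightarrow> ('k, (generator list \<Rightarrow>\<^sub>0 'k) set) module"
  where "radford_algebra q N \<nu> = quot_algebra free_algebra (radford_ideal q N \<nu>)"

definition generator_class ::
    "'k::field \<Rightarrow> nat \<Rightarrow> nat \<Rightarrow> generator \<Rightarrow> (generator list \<Rightarrow>\<^sub>0 'k) set"
  where "generator_class q N \<nu> g =
    radford_ideal q N \<nu> +>\<^bsub>(free_algebra :: ('k, _) module)\<^esub> Poly_Mapping.single [g] 1"

text \<open>The homomorphism (resp. antihomomorphism) to \<open>B\<close> with prescribed values on the generators,
  defined on a quotient of the free algebra.\<close>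

definition word_value :: "('k::field, 'b, 'm) module_scheme \<Rightarrow> (generator \<Rightarrow> 'b) \<Rightarrow> generator list \<Rightarrow> 'b"
  where "word_value B v w = foldr (\<lambda>g b. v g \<otimes>\<^bsub>B\<^esub> b) w \<one>\<^bsub>B\<^esub>"

definition hom_by_generators ::
    "('k::field, 'b, 'm) module_scheme \<Rightarrow> (generator \<Rightarrow> 'b) \<Rightarrow> (generator list \<Rightarrow>\<^sub>0 'k) set \<Rightarrow> 'b"
  where "hom_by_generators B v = on_cosets (lin_ext B (word_value B v))"

definition antihom_by_generators ::
    "('k::field, 'b, 'm) module_scheme \<Rightarrow> (generator \<Rightarrow> 'b) \<Rightarrow> (generator list \<Rightarrow>\<^sub>0 'k) set \<Rightarrow> 'b"
  where "antihom_by_generators B v = on_cosets (lin_ext B (\<lambda>w. word_value B v (rev w)))"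

text \<open>The index \<open>n\<close> is the order of \<open>q\<close> by \<^const>\<open>radford_params\<close>; the presentation depends on it
  only through \<open>q\<close>.\<close>

definition radford_hopf ::
    "nat \<Rightarrow> 'k::field \<Rightarrow> nat \<Rightarrow> nat \<Rightarrow> ('k, (generator list \<Rightarrow>\<^sub>0 'k) set) hopf"
  where "radford_hopf n q N \<nu> =
    (let A = radford_algebra q N \<nu>;
         a = generator_class q N \<nu> Gen_a;
         x = generator_class q N \<nu> Gen_x
     in \<lparr>carrier = carrier A, monoid.mult = monoid.mult A, one = one A,
         ring.zero = ring.zero A, add = add A, module.smult = module.smult A,
         comult = hom_by_generators (tensor A A)
           (case_generator
              (pure_tensor A A a a)
              (pure_tensor A A x (a [^]\<^bsub>A\<^esub> \<nu>) \<oplus>\<^bsub>tensor A A\<^esub> pure_tensor A A \<one>\<^bsub>A\<^esub> x)),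
         counit = hom_by_generators scalars (case_generator 1 0),
         antipode = antihom_by_generators A
           (case_generator
              (inv\<^bsub>A\<^esub> a)
              ((- inverse (q ^ \<nu>)) \<odot>\<^bsub>A\<^esub> ((inv\<^bsub>A\<^esub> a) [^]\<^bsub>A\<^esub> \<nu> \<otimes>\<^bsub>A\<^esub> x)))\<rparr>)"

end

theory Submission
  imports Defs
begin

text \<open>Let \<open>H = H\<^bsub>n,q,N,\<nu>\<^esub>\<close> and write \<open>q = \<omega>\<^sup>\<mu>\<close>. The dual contains the character \<open>A\<close> with
  \<open>A(a) = \<omega>\<close>, \<open>A(x) = 0\<close>, and the functional \<open>\<xi>\<close> that vanishes on every \<open>a\<^sup>i x\<^sup>j\<close> except
  \<open>\<xi>(a\<^sup>i x) = 1\<close>; it is the off-diagonal entry of a representation of \<open>H\<close> by upper triangular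
  matrices, so \<open>\<xi>(gh) = \<epsilon>(g) \<xi>(h) + \<xi>(g) A\<^sup>\<mu>(h)\<close>. Left translation of functionals by \<open>a\<close> is
  multiplicative for the convolution product and left translation by \<open>x\<close> is a skew derivation of
  it. Hence \<open>A\<^sup>N = 1\<close>, \<open>\<xi>A = \<omega>\<^sup>\<nu> A\<xi>\<close>, \<open>\<xi>\<^sup>r = 0\<close>, and the value of \<open>A\<^sup>i \<xi>\<^sup>j\<close> at \<open>a\<^sup>l x\<^sup>t\<close> is \<open>0\<close> for
  \<open>t \<noteq> j\<close> and \<open>\<omega>\<^bsup>il\<^esup> [j]!\<close> for \<open>t = j\<close>, where the Gaussian factorial \<open>[j]!\<close> at \<open>q\<^sup>\<nu>\<close> is nonzero for
  \<open>j < r\<close>. So \<open>a \<mapsto> A\<close>, \<open>x \<mapsto> \<xi>\<close> defines a homomorphism from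
  \<open>H\<^bsub>N/(N,\<nu>),\<omega>\<^sup>\<nu>,N,\<mu>\<^esub>\<close> to \<open>H\<^sup>*\<close>, and a discrete Fourier transform inverts it. It
  respects the comultiplications by the product formulas for \<open>A\<close> and \<open>\<xi>\<close>, and the antipodes
  because antipodes are unique.\<close>

text \<open>No basis theorem for \<open>H\<close> enters. For \<open>H\<close> and for the candidate
  dual \<open>K\<close> it is only shown that the monomials \<open>a^i x^j\<close> span
  (\<open>monomials_determine\<close>). The values of the functionals \<open>M i j\<close> on them
  form an invertible matrix: a Fourier matrix in the exponents of \<open>a\<close>, diagonal in
  those of \<open>x\<close>. With spanning on both sides this yields a two-sided inverse of
  \<open>\<psi>\<close>. Dividing by \<open>N\<close> is legitimate because a field with a primitive
  \<open>N\<close>th root of unity has \<open>N \<noteq> 0\<close>. The obstacle on the coalgebra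
  side is that the comultiplication of the dual is a definite description over a tensor product made
  of cosets of formal sums. Its uniqueness is injectivity of the map from the tensor square of the
  dual to functionals on the tensor square of \<open>H\<close>. Its existence is not deduced from
  finite dimension: the relation \<open>represents\<close> holds at the two generators and is stable
  under the algebra operations, so it holds on the image of \<open>\<psi>\<close>, which is
  everything. The Hopf axioms of the dual are then carried over from \<open>K\<close> instead of
  being verified directly.\<close>

lemma ring_of_type_algebra_simps [simp]:
  "carrier ring_of_type_algebra = UNIV"
  "monoid.mult ring_of_type_algebra = (*)"
  "one ring_of_type_algebra = 1"
  "ring.zero ring_of_type_algebra = 0"
  "add ring_of_type_algebra = (+)"
  by (simp_all add: ring_of_type_algebra_def)

text \<open>Additive inverses are absent from the premises because \<open>(- 1) \<odot> x\<close>
  supplies them. What remains is closure and equations, which simplification settles for most of the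
  concrete algebras below.\<close>

lemma assoc_algebraI:
  fixes A :: "('k::field, 'a, 'm) module_scheme" (structure)
  assumes "\<And>x y. x \<in> carrier A \<Longrightarrow> y \<in> carrier A \<Longrightarrow> x \<oplus> y \<in> carrier A"
    and "\<zero> \<in> carrier A"
    and "\<And>x y z. x \<in> carrier A \<Longrightarrow> y \<in> carrier A \<Longrightarrow> z \<in> carrier A \<Longrightarrow> x \<oplus> y \<oplus> z = x \<oplus> (y \<oplus> z)"
    and "\<And>x y. x \<in> carrier A \<Longrightarrow> y \<in> carrier A \<Longrightarrow> x \<oplus> y = y \<oplus> x"
    and "\<And>x. x \<in> carrier A \<Longrightarrow> \<zero> \<oplus> x = x"
    and "\<And>x y. x \<in> carrier A \<Longrightarrow> y \<in> carrier A \<Longrightarrow> x \<otimes> y \<in> carrier A"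
    and "\<one> \<in> carrier A"
    and "\<And>x y z. x \<in> carrier A \<Longrightarrow> y \<in> carrier A \<Longrightarrow> z \<in> carrier A \<Longrightarrow> x \<otimes> y \<otimes> z = x \<otimes> (y \<otimes> z)"
    and "\<And>x. x \<in> carrier A \<Longrightarrow> \<one> \<otimes> x = x"
    and "\<And>x. x \<in> carrier A \<Longrightarrow> x \<otimes> \<one> = x"
    and "\<And>x y z. x \<in> carrier A \<Longrightarrow> y \<in> carrier A \<Longrightarrow> z \<in> carrier A \<Longrightarrow> (x \<oplus> y) \<otimes> z = x \<otimes> z \<oplus> y \<otimes> z"
    and "\<And>x y z. x \<in> carrier A \<Longrightarrow> y \<in> carrier A \<Longrightarrow> z \<in> carrier A \<Longrightarrow> z \<otimes> (x \<oplus> y) = z \<otimes> x \<oplus> z \<otimes> y"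
    and "\<And>c x. x \<in> carrier A \<Longrightarrow> c \<odot> x \<in> carrier A"
    and "\<And>c d x. x \<in> carrier A \<Longrightarrow> (c + d) \<odot> x = c \<odot> x \<oplus> d \<odot> x"
    and "\<And>c x y. x \<in> carrier A \<Longrightarrow> y \<in> carrier A \<Longrightarrow> c \<odot> (x \<oplus> y) = c \<odot> x \<oplus> c \<odot> y"
    and "\<And>c d x. x \<in> carrier A \<Longrightarrow> (c * d) \<odot> x = c \<odot> (d \<odot> x)"
    and one: "\<And>x. x \<in> carrier A \<Longrightarrow> 1 \<odot> x = x"
    and zero: "\<And>x. x \<in> carrier A \<Longrightarrow> 0 \<odot> x = \<zero>"
    and "\<And>c x y. x \<in> carrier A \<Longrightarrow> y \<in> carrier A \<Longrightarrow> (c \<odot> x) \<otimes> y = c \<odot> (x \<otimes> y)"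
    and "\<And>c x y. x \<in> carrier A \<Longrightarrow> y \<in> carrier A \<Longrightarrow> x \<otimes> (c \<odot> y) = c \<odot> (x \<otimes> y)"
  shows "assoc_algebra A"
proof -
  have "\<exists>y\<in>carrier A. y \<oplus> x = \<zero>" if "x \<in> carrier A" for x
  proof
    show "(- 1) \<odot> x \<in> carrier A"
      using that by (rule assms(13))
    have "(- 1) \<odot> x \<oplus> x = (- 1) \<odot> x \<oplus> 1 \<odot> x"
      using that by (simp add: one)
    also have "\<dots> = (- 1 + 1) \<odot> x"
      using that by (rule assms(14)[symmetric])
    finally show "(- 1) \<odot> x \<oplus> x = \<zero>"
      using that by (simp add: zero)
  qed
  then have group: "abelian_group A"
    by (intro abelian_groupI) (use assms(1-5) in auto)
  have "ring A"
    by (intro ringI monoidI group; rule assms; assumption)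
  moreover have "module ring_of_type_algebra A"
    by (intro moduleI cring_from_type_algebra group; simp; rule assms; assumption)
  ultimately show ?thesis
    by (intro assoc_algebra.intro assoc_algebra_axioms.intro assms)
qed

context assoc_algebra
begin

lemma smult_closed' [simp, intro]: "x \<in> carrier A \<Longrightarrow> c \<odot> x \<in> carrier A"
  using smult_closed by simp

lemma smult_add_left: "x \<in> carrier A \<Longrightarrow> (c + d) \<odot> x = c \<odot> x \<oplus> d \<odot> x"
  using smult_l_distr by simp

lemma smult_add_right: "x \<in> carrier A \<Longrightarrow> y \<in> carrier A \<Longrightarrow> c \<odot> (x \<oplus> y) = c \<odot> x \<oplus> c \<odot> y"
  using smult_r_distr by simp

lemma smult_smult: "x \<in> carrier A \<Longrightarrow> c \<odot> (d \<odot> x) = (c * d) \<odot> x"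
  using smult_assoc1 by simp

lemma smult_1 [simp]: "x \<in> carrier A \<Longrightarrow> 1 \<odot> x = x"
  using smult_one by simp

lemma smult_0 [simp]: assumes "x \<in> carrier A" shows "0 \<odot> x = \<zero>"
proof -
  have "0 \<odot> x \<oplus> 0 \<odot> x = 0 \<odot> x"
    using smult_add_left[of x 0 0] assms by simp
  then show ?thesis
    using assms by (metis add.r_cancel_one' smult_closed')
qed

lemma smult_zero [simp]: "c \<odot> \<zero> = \<zero>"
  using smult_smult[of \<zero> c 0] by simp

lemma smult_minus_1: assumes "x \<in> carrier A" shows "(- 1) \<odot> x = \<ominus> x"
proof -
  have "(- 1) \<odot> x \<oplus> x = (- 1 + 1) \<odot> x"
    using assms by (metis smult_1 smult_add_left)
  then show ?thesis
    using assms by (simp add: minus_equality)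
qed

lemma is_assoc_algebra: "assoc_algebra A" ..

end

section \<open>Linear maps\<close>

lemma linear_mapsI:
  assumes "\<And>a. a \<in> carrier A \<Longrightarrow> f a \<in> carrier B"
    and "\<And>a b. a \<in> carrier A \<Longrightarrow> b \<in> carrier A \<Longrightarrow> f (a \<oplus>\<^bsub>A\<^esub> b) = f a \<oplus>\<^bsub>B\<^esub> f b"
    and "\<And>c a. a \<in> carrier A \<Longrightarrow> f (c \<odot>\<^bsub>A\<^esub> a) = c \<odot>\<^bsub>B\<^esub> f a"
  shows "f \<in> linear_maps A B"
  using assms by (auto simp: linear_maps_def)

lemma linear_closed: "f \<in> linear_maps A B \<Longrightarrow> a \<in> carrier A \<Longrightarrow> f a \<in> carrier B"
  and linear_add: "f \<in> linear_maps A B \<Longrightarrow> a \<in> carrier A \<Longrightarrow> b \<in> carrier A \<Longrightarrow>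
    f (a \<oplus>\<^bsub>A\<^esub> b) = f a \<oplus>\<^bsub>B\<^esub> f b"
  and linear_smult: "f \<in> linear_maps A B \<Longrightarrow> a \<in> carrier A \<Longrightarrow> f (c \<odot>\<^bsub>A\<^esub> a) = c \<odot>\<^bsub>B\<^esub> f a"
  by (auto simp: linear_maps_def)

lemma linear_zero:
  assumes "assoc_algebra A" "assoc_algebra B" "f \<in> linear_maps A B"
  shows "f \<zero>\<^bsub>A\<^esub> = \<zero>\<^bsub>B\<^esub>"
proof -
  interpret A: assoc_algebra A by fact
  interpret B: assoc_algebra B by fact
  show ?thesis
    using linear_smult[OF assms(3) A.zero_closed, of 0] linear_closed[OF assms(3) A.zero_closed]
    by simp
qed

lemma linear_comp:
  assumes "f \<in> linear_maps A B" "g \<in> linear_maps B C"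
  shows "(\<lambda>x. g (f x)) \<in> linear_maps A C"
  using assms by (auto simp: linear_maps_def Pi_iff)

lemma linear_id: "(\<lambda>x. x) \<in> linear_maps A A" "id \<in> linear_maps A A"
  by (auto simp: linear_maps_def)

text \<open>Linearity depends only on values on the carrier, so a map may be exchanged for one that
  agrees with it there, as happens with the lambda terms and restricted functions below.\<close>

lemma linear_cong:
  assumes "f \<in> linear_maps A B" "\<And>x. x \<in> carrier A \<Longrightarrow> f x = g x" "assoc_algebra A"
  shows "g \<in> linear_maps A B"
proof -
  interpret A: assoc_algebra A by fact
  have g: "g x = f x" if "x \<in> carrier A" for x
    using assms(2)[OF that] by simp
  show ?thesis
    by (intro linear_mapsI) (simp_all add: g linear_closed[OF assms(1)] linear_add[OF assms(1)] linear_smult[OF assms(1)])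
qed

lemma algebra_homsI:
  assumes "f \<in> linear_maps A B"
    and "\<And>a b. a \<in> carrier A \<Longrightarrow> b \<in> carrier A \<Longrightarrow> f (a \<otimes>\<^bsub>A\<^esub> b) = f a \<otimes>\<^bsub>B\<^esub> f b"
    and "f \<one>\<^bsub>A\<^esub> = \<one>\<^bsub>B\<^esub>"
  shows "f \<in> algebra_homs A B"
  using assms by (auto simp: algebra_homs_def ring_hom_def linear_maps_def)

lemma algebra_hom_linear: "f \<in> algebra_homs A B \<Longrightarrow> f \<in> linear_maps A B"
  and algebra_hom_mult: "f \<in> algebra_homs A B \<Longrightarrow> a \<in> carrier A \<Longrightarrow> b \<in> carrier A \<Longrightarrow>
    f (a \<otimes>\<^bsub>A\<^esub> b) = f a \<otimes>\<^bsub>B\<^esub> f b"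
  and algebra_hom_one: "f \<in> algebra_homs A B \<Longrightarrow> f \<one>\<^bsub>A\<^esub> = \<one>\<^bsub>B\<^esub>"
  and algebra_hom_ring: "f \<in> algebra_homs A B \<Longrightarrow> f \<in> ring_hom A B"
  by (auto simp: algebra_homs_def ring_hom_def)

lemmas algebra_hom_closed = linear_closed[OF algebra_hom_linear]
lemmas algebra_hom_add = linear_add[OF algebra_hom_linear]
lemmas algebra_hom_smult = linear_smult[OF algebra_hom_linear]

lemma algebra_hom_comp:
  assumes "f \<in> algebra_homs A B" "g \<in> algebra_homs B C"
  shows "(\<lambda>x. g (f x)) \<in> algebra_homs A C"
  using assms
  by (intro algebra_homsI linear_comp[of f A B g C])
    (auto simp: algebra_hom_linear algebra_hom_mult algebra_hom_one algebra_hom_closed)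

lemma algebra_hom_id: "id \<in> algebra_homs A A"
  by (intro algebra_homsI linear_id) auto

lemma algebra_hom_pow:
  assumes "assoc_algebra A" "assoc_algebra B" "f \<in> algebra_homs A B" "a \<in> carrier A"
  shows "f (a [^]\<^bsub>A\<^esub> (n::nat)) = f a [^]\<^bsub>B\<^esub> n"
proof -
  interpret A: assoc_algebra A by fact
  interpret B: assoc_algebra B by fact
  show ?thesis
    using assms(3,4)
    by (induction n) (simp_all add: algebra_hom_mult algebra_hom_one A.nat_pow_closed)
qed

lemma scalars_simps [simp]:
  "carrier scalars = UNIV" "monoid.mult scalars = (*)" "one scalars = 1"
  "ring.zero scalars = 0" "add scalars = (+)" "module.smult scalars = (*)"
  by (simp_all add: scalars_def)

lemma scalars_algebra [simp]: "assoc_algebra scalars"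
  by (rule assoc_algebraI) (auto simp: algebra_simps)

context assoc_algebra
begin

lemma linear_maps_add:
  assumes "assoc_algebra B" "f \<in> linear_maps B A" "g \<in> linear_maps B A"
  shows "(\<lambda>x. f x \<oplus> g x) \<in> linear_maps B A"
proof -
  interpret B: assoc_algebra B by fact
  show ?thesis
    using assms(2,3)
    by (intro linear_mapsI) (auto simp: linear_add linear_smult linear_closed smult_add_right a_ac)
qed

lemma linear_maps_smult:
  assumes "f \<in> linear_maps B A"
  shows "(\<lambda>x. c \<odot> f x) \<in> linear_maps B A"
  using assms
  by (intro linear_mapsI) (auto simp: linear_add linear_smult linear_closed smult_add_right smult_smult mult.commute)

lemma linear_maps_scalar_smult:
  assumes "f \<in> linear_maps B scalars" "y \<in> carrier A"
  shows "(\<lambda>x. f x \<odot> y) \<in> linear_maps B A"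
  using assms
  by (intro linear_mapsI) (auto simp: linear_add linear_smult smult_add_left smult_smult)

lemma linear_maps_mult_left:
  assumes "y \<in> carrier A" shows "(\<lambda>x. y \<otimes> x) \<in> linear_maps A A"
  using assms by (intro linear_mapsI) (auto simp: r_distr smult_mult_right)

lemma linear_maps_mult_right:
  assumes "y \<in> carrier A" shows "(\<lambda>x. x \<otimes> y) \<in> linear_maps A A"
  using assms by (intro linear_mapsI) (auto simp: l_distr smult_mult_left)

end

section \<open>Quotient algebras\<close>

lemma quot_algebra_simps:
  "carrier (quot_algebra A I) = carrier (A Quot I)"
  "monoid.mult (quot_algebra A I) = monoid.mult (A Quot I)"
  "one (quot_algebra A I) = one (A Quot I)"
  "ring.zero (quot_algebra A I) = ring.zero (A Quot I)"
  "add (quot_algebra A I) = add (A Quot I)"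
  by (simp_all add: quot_algebra_def)

locale algebra_ideal = assoc_algebra A + ideal I A
  for I and A :: "('k::field, 'a, 'm) module_scheme" (structure)
begin

text \<open>A ring ideal of a unital algebra is automatically a subspace: scaling \<open>i\<close>
  by \<open>c\<close> is multiplication by \<open>c \<odot> \<one>\<close>.\<close>

lemma ideal_smult: "i \<in> I \<Longrightarrow> c \<odot> i \<in> I"
  using I_l_closed[of i "c \<odot> \<one>"] smult_mult_left[of \<one> i c] Icarr by auto

lemma carrier_quot: "carrier (quot_algebra A I) = (+>) I ` carrier A"
  by (auto simp: quot_algebra_simps FactRing_def A_RCOSETS_def')

lemma quot_coset_closed: "a \<in> carrier A \<Longrightarrow> I +> a \<in> carrier (quot_algebra A I)"
  by (simp add: carrier_quot)

lemma quot_coset_hom: "(+>) I \<in> ring_hom A (A Quot I)"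
  by (rule rcos_ring_hom)

text \<open>The scalar action on cosets is a union over all representatives. By
  \<open>ideal_smult\<close> all the cosets in that union coincide, so the union is a single
  coset.\<close>

lemma coset_smult:
  assumes "a \<in> carrier A"
  shows "c \<odot>\<^bsub>quot_algebra A I\<^esub> (I +> a) = I +> (c \<odot> a)"
proof -
  have "I +> (c \<odot> b) = I +> (c \<odot> a)" if b: "b \<in> I +> a" for b
  proof -
    obtain i where i: "i \<in> I" "b = i \<oplus> a"
      using b by (auto simp: a_r_coset_def')
    then have "c \<odot> b = c \<odot> i \<oplus> c \<odot> a"
      using assms Icarr by (simp add: smult_add_right)
    moreover have "c \<odot> i \<in> I"
      using i ideal_smult by blast
    ultimately have "c \<odot> b \<in> I +> (c \<odot> a)"
      by (auto simp: a_r_coset_def')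
    then show ?thesis
      using assms by (metis a_repr_independence' smult_closed')
  qed
  moreover have "a \<in> I +> a"
    using assms a_rcos_self by blast
  ultimately have "(\<Union>b\<in>I +> a. I +> (c \<odot> b)) = I +> (c \<odot> a)"
    by (intro SUP_eq_const) blast+
  then show ?thesis
    by (simp add: quot_algebra_def)
qed

lemma coset_ops:
  assumes "a \<in> carrier A" "b \<in> carrier A"
  shows "(I +> a) \<oplus>\<^bsub>quot_algebra A I\<^esub> (I +> b) = I +> (a \<oplus> b)"
    and "(I +> a) \<otimes>\<^bsub>quot_algebra A I\<^esub> (I +> b) = I +> (a \<otimes> b)"
  using assms quot_coset_hom by (simp_all add: quot_algebra_simps ring_hom_def)

lemma coset_one: "\<one>\<^bsub>quot_algebra A I\<^esub> = I +> \<one>"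
  and coset_zero: "\<zero>\<^bsub>quot_algebra A I\<^esub> = I +> \<zero>"
  using quot_coset_hom by (simp_all add: quot_algebra_simps FactRing_def a_rcos_zero is_ideal)

lemma quot_assoc_algebra: "assoc_algebra (quot_algebra A I)"
  by (rule assoc_algebraI; clarsimp simp: carrier_quot coset_ops coset_smult coset_one coset_zero)
    (simp_all add: m_assoc a_ac l_distr r_distr smult_add_left smult_add_right smult_smult
       smult_mult_left smult_mult_right)

lemma coset_algebra_hom: "(+>) I \<in> algebra_homs A (quot_algebra A I)"
  by (intro algebra_homsI linear_mapsI) (auto simp: carrier_quot coset_ops coset_smult coset_one)

lemma coset_eq_iff:
  assumes "a \<in> carrier A" "b \<in> carrier A"
  shows "I +> a = I +> b \<longleftrightarrow> a \<ominus> b \<in> I"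
  using quotient_eq_iff_same_a_r_cos[OF is_ideal assms] by blast

context
  fixes B f assumes B: "assoc_algebra B" and f: "f \<in> linear_maps A B"
    and vanish: "\<And>i. i \<in> I \<Longrightarrow> f i = \<zero>\<^bsub>B\<^esub>"
begin

text \<open>A linear map that vanishes on \<open>I\<close> is constant on each coset, so the image
  of the coset is a singleton and \<open>the_elem\<close> is meaningful.\<close>

lemma on_cosets_coset: 
  assumes "a \<in> carrier A" shows "on_cosets f (I +> a) = f a"
proof -
  interpret B: assoc_algebra B by fact
  have "f b = f a" if b: "b \<in> I +> a" for b
  proof -
    obtain i where i: "i \<in> I" "b = i \<oplus> a"
      using b by (auto simp: a_r_coset_def')
    then show ?thesis
      using assms f Icarr vanish by (auto simp: linear_add linear_closed)
  qed
  moreover have "a \<in> I +> a"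
    using assms a_rcos_self by blast
  ultimately have "f ` (I +> a) = {f a}"
    by blast
  then show ?thesis
    by (simp add: on_cosets_def)
qed

lemma on_cosets_linear: "on_cosets f \<in> linear_maps (quot_algebra A I) B"
  using f by (intro linear_mapsI)
    (auto simp: carrier_quot coset_ops coset_smult on_cosets_coset linear_closed linear_add linear_smult)

lemma on_cosets_hom:
  assumes "f \<in> algebra_homs A B" shows "on_cosets f \<in> algebra_homs (quot_algebra A I) B"
  using assms by (intro algebra_homsI on_cosets_linear)
    (auto simp: carrier_quot coset_ops coset_one on_cosets_coset algebra_hom_mult algebra_hom_one)

end

end

section \<open>Monoid algebras\<close>

lemma fm_scale_single [simp]: "fm_scale c (Poly_Mapping.single b d) = Poly_Mapping.single b (c * d)"
  by (rule poly_mapping_eqI) (simp add: lookup_single when_def)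

lemma keys_fm_scale: "Poly_Mapping.keys (fm_scale c p) \<subseteq> Poly_Mapping.keys p"
  by (auto simp: in_keys_iff)

lemma fm_eq_sum:
  "p = (\<Sum>b\<in>Poly_Mapping.keys p. fm_scale (Poly_Mapping.lookup p b) (Poly_Mapping.single b 1))"
  by (rule poly_mapping_eqI)
    (auto simp: lookup_sum lookup_single when_def in_keys_iff)

text \<open>Induction along linear combinations of basis vectors. The support hypotheses reappear in
  the cases because linearity of the maps in question is known only on the carrier.\<close>

lemma fm_induct [consumes 1, case_names zero single add scale]:
  assumes "Poly_Mapping.keys p \<subseteq> S"
    and zero: "P 0"
    and single: "\<And>b. b \<in> S \<Longrightarrow> P (Poly_Mapping.single b 1)"
    and add: "\<And>p q. Poly_Mapping.keys p \<subseteq> S \<Longrightarrow> Poly_Mapping.keys q \<subseteq> S \<Longrightarrow> P p \<Longrightarrow> P q \<Longrightarrow> P (p + q)"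
    and scale: "\<And>c p. Poly_Mapping.keys p \<subseteq> S \<Longrightarrow> P p \<Longrightarrow> P (fm_scale c p)"
  shows "P p"
proof -
  \<comment> \<open>The support is carried along with \<open>P\<close>, since the premise
    \<open>add\<close> asks that both summands be supported in \<open>S\<close>.\<close>
  have "P (sum f T) \<and> Poly_Mapping.keys (sum f T) \<subseteq> S"
    if "finite T" and f: "\<And>b. b \<in> T \<Longrightarrow> P (f b) \<and> Poly_Mapping.keys (f b) \<subseteq> S"
    for f :: "'a \<Rightarrow> 'a \<Rightarrow>\<^sub>0 'b" and T
    using that
  proof (induction T)
    case (insert b T)
    then show ?case
      using add[of "f b" "sum f T"] keys_add[of "f b" "sum f T"] by auto
  qed (simp add: zero)
  moreover have "P (fm_scale c (Poly_Mapping.single b 1)) \<and>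
      Poly_Mapping.keys (fm_scale c (Poly_Mapping.single b 1)) \<subseteq> S" if "b \<in> S" for b c
    using that single scale[of "Poly_Mapping.single b 1" c] by auto
  ultimately show ?thesis
    using assms(1) by (subst fm_eq_sum) (metis (no_types, lifting) finite_keys subsetD)
qed

lemma monoid_algebra_simps [simp]:
  "carrier (monoid_algebra M) = {p. Poly_Mapping.keys p \<subseteq> carrier M}"
  "one (monoid_algebra M) = Poly_Mapping.single \<one>\<^bsub>M\<^esub> 1"
  "ring.zero (monoid_algebra M) = 0"
  "add (monoid_algebra M) = (+)"
  "module.smult (monoid_algebra M) = fm_scale"
  by (simp_all add: monoid_algebra_def)

text \<open>Enlarging the index sets beyond the supports adds only zero terms. Products of different
  elements can thus be written over common index sets, which makes bilinearity a termwise
  statement.\<close>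

lemma monoid_algebra_mult:
  assumes "finite S" "finite T" "Poly_Mapping.keys p \<subseteq> S" "Poly_Mapping.keys p' \<subseteq> T"
  shows "p \<otimes>\<^bsub>monoid_algebra M\<^esub> p' = (\<Sum>b\<in>S. \<Sum>c\<in>T.
    Poly_Mapping.single (b \<otimes>\<^bsub>M\<^esub> c) (Poly_Mapping.lookup p b * Poly_Mapping.lookup p' c))"
proof -
  have "(\<Sum>c\<in>T. Poly_Mapping.single (b \<otimes>\<^bsub>M\<^esub> c) (Poly_Mapping.lookup p b * Poly_Mapping.lookup p' c)) =
    (\<Sum>c\<in>Poly_Mapping.keys p'. Poly_Mapping.single (b \<otimes>\<^bsub>M\<^esub> c) (Poly_Mapping.lookup p b * Poly_Mapping.lookup p' c))" for b
    using assms by (intro sum.mono_neutral_right) (auto simp: in_keys_iff)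
  moreover have "(\<Sum>b\<in>S. \<Sum>c\<in>Poly_Mapping.keys p'.
      Poly_Mapping.single (b \<otimes>\<^bsub>M\<^esub> c) (Poly_Mapping.lookup p b * Poly_Mapping.lookup p' c)) =
    (\<Sum>b\<in>Poly_Mapping.keys p. \<Sum>c\<in>Poly_Mapping.keys p'.
      Poly_Mapping.single (b \<otimes>\<^bsub>M\<^esub> c) (Poly_Mapping.lookup p b * Poly_Mapping.lookup p' c))"
    using assms by (intro sum.mono_neutral_right) (auto simp: in_keys_iff)
  ultimately show ?thesis
    by (simp add: monoid_algebra_def)
qed

lemma monoid_algebra_mult_add_left:
  "(p + q) \<otimes>\<^bsub>monoid_algebra M\<^esub> s = p \<otimes>\<^bsub>monoid_algebra M\<^esub> s + q \<otimes>\<^bsub>monoid_algebra M\<^esub> s"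
proof -
  let ?S = "Poly_Mapping.keys p \<union> Poly_Mapping.keys q" and ?T = "Poly_Mapping.keys s"
  show ?thesis
    using keys_add[of p q]
    by (simp add: monoid_algebra_mult[of ?S ?T] lookup_add distrib_right single_add sum.distrib)
qed

lemma monoid_algebra_mult_add_right:
  "s \<otimes>\<^bsub>monoid_algebra M\<^esub> (p + q) = s \<otimes>\<^bsub>monoid_algebra M\<^esub> p + s \<otimes>\<^bsub>monoid_algebra M\<^esub> q"
proof -
  let ?T = "Poly_Mapping.keys p \<union> Poly_Mapping.keys q" and ?S = "Poly_Mapping.keys s"
  show ?thesis
    using keys_add[of p q]
    by (simp add: monoid_algebra_mult[of ?S ?T] lookup_add distrib_left single_add sum.distrib)
qed

lemma monoid_algebra_mult_scale_left:
  "fm_scale c p \<otimes>\<^bsub>monoid_algebra M\<^esub> s = fm_scale c (p \<otimes>\<^bsub>monoid_algebra M\<^esub> s)"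
  using keys_fm_scale[of c p]
  by (simp add: monoid_algebra_mult[of "Poly_Mapping.keys p" "Poly_Mapping.keys s"] fm.scale_sum_right mult.assoc)

lemma monoid_algebra_mult_scale_right:
  "s \<otimes>\<^bsub>monoid_algebra M\<^esub> fm_scale c p = fm_scale c (s \<otimes>\<^bsub>monoid_algebra M\<^esub> p)"
  using keys_fm_scale[of c p]
  by (simp add: monoid_algebra_mult[of "Poly_Mapping.keys s" "Poly_Mapping.keys p"] fm.scale_sum_right mult_ac)

lemma monoid_algebra_mult_0 [simp]:
  "0 \<otimes>\<^bsub>monoid_algebra M\<^esub> s = 0" "s \<otimes>\<^bsub>monoid_algebra M\<^esub> 0 = 0"
  by (simp_all add: monoid_algebra_def)

lemma monoid_algebra_mult_single [simp]:
  "Poly_Mapping.single b c \<otimes>\<^bsub>monoid_algebra M\<^esub> Poly_Mapping.single b' c' =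
    Poly_Mapping.single (b \<otimes>\<^bsub>M\<^esub> b') (c * c')"
  by (simp add: monoid_algebra_mult[of "{b}" "{b'}"])

lemmas monoid_algebra_bilinear =
  monoid_algebra_mult_add_left monoid_algebra_mult_add_right
  monoid_algebra_mult_scale_left monoid_algebra_mult_scale_right

context monoid
begin

lemma monoid_algebra_mult_closed:
  assumes "Poly_Mapping.keys p \<subseteq> carrier G" "Poly_Mapping.keys p' \<subseteq> carrier G"
  shows "Poly_Mapping.keys (p \<otimes>\<^bsub>monoid_algebra G\<^esub> p') \<subseteq> carrier G"
proof -
  have "Poly_Mapping.keys (p \<otimes>\<^bsub>monoid_algebra G\<^esub> p') \<subseteq>
      (\<Union>b\<in>Poly_Mapping.keys p. \<Union>c\<in>Poly_Mapping.keys p'. {b \<otimes> c})"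
    unfolding monoid_algebra_def monoid.simps
    by (rule order_trans[OF keys_sum], rule UN_mono[OF subset_refl],
        rule order_trans[OF keys_sum], rule UN_mono[OF subset_refl]) auto
  then show ?thesis
    using assms by blast
qed

text \<open>Both sides of associativity are trilinear, so three nested inductions reduce it to basis
  elements and hence to associativity in \<open>G\<close>.\<close>

lemma monoid_algebra_assoc_algebra: "assoc_algebra (monoid_algebra G :: ('k::field, _) module)"
proof (rule assoc_algebraI; unfold monoid_algebra_simps mem_Collect_eq)
  fix p p' p'' :: "'a \<Rightarrow>\<^sub>0 'k"
  let ?A = "monoid_algebra G :: ('k, _) module"
  assume keys: "Poly_Mapping.keys p \<subseteq> carrier G" "Poly_Mapping.keys p' \<subseteq> carrier G"
    "Poly_Mapping.keys p'' \<subseteq> carrier G"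
  show "p \<otimes>\<^bsub>?A\<^esub> p' \<otimes>\<^bsub>?A\<^esub> p'' = p \<otimes>\<^bsub>?A\<^esub> (p' \<otimes>\<^bsub>?A\<^esub> p'')"
    using keys(1)
  proof (induction rule: fm_induct)
    case (single b)
    show ?case
      using keys(2)
    proof (induction rule: fm_induct)
      case (single b')
      show ?case
        using keys(3)
        by (induction rule: fm_induct) (use \<open>b \<in> _\<close> single in \<open>auto simp: monoid_algebra_bilinear m_assoc\<close>)
    qed (simp_all add: monoid_algebra_bilinear)
  qed (simp_all add: monoid_algebra_bilinear)
next
  fix p :: "'a \<Rightarrow>\<^sub>0 'k"
  let ?A = "monoid_algebra G :: ('k, _) module"
  assume keys: "Poly_Mapping.keys p \<subseteq> carrier G"
  show "Poly_Mapping.single \<one> 1 \<otimes>\<^bsub>?A\<^esub> p = p" "p \<otimes>\<^bsub>?A\<^esub> Poly_Mapping.single \<one> 1 = p"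
    using keys by (induction rule: fm_induct) (simp_all add: monoid_algebra_bilinear)
qed (auto simp: monoid_algebra_bilinear monoid_algebra_mult_closed fm.scale_left_distrib fm.scale_right_distrib
    algebra_simps dest: subsetD[OF keys_add] subsetD[OF keys_fm_scale])

end

context assoc_algebra
begin

lemma lin_ext_superset:
  assumes "finite S" "Poly_Mapping.keys p \<subseteq> S" "f \<in> S \<rightarrow> carrier A"
  shows "lin_ext A f p = (\<Oplus>b\<in>S. Poly_Mapping.lookup p b \<odot> f b)"
  unfolding lin_ext_def using assms
  by (intro add.finprod_mono_neutral_cong_left) (auto simp: in_keys_iff Pi_iff)

lemma lin_ext_single:
  assumes "f b \<in> carrier A" shows "lin_ext A f (Poly_Mapping.single b c) = c \<odot> f b"
  using assms by (subst lin_ext_superset[of "{b}"]) auto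

lemma finsum_smult:
  assumes "finite S" "f \<in> S \<rightarrow> carrier A"
  shows "c \<odot> (\<Oplus>b\<in>S. f b) = (\<Oplus>b\<in>S. c \<odot> f b)"
  using assms
proof (induction S)
  case (insert b S)
  then have "f b \<in> carrier A" "f \<in> S \<rightarrow> carrier A" "(\<lambda>b. c \<odot> f b) \<in> S \<rightarrow> carrier A"
    by auto
  then show ?case
    using insert by (simp add: smult_add_right)
qed simp

lemma lin_ext_linear:
  assumes f: "f \<in> carrier M \<rightarrow> carrier A"
  shows "lin_ext A f \<in> linear_maps (monoid_algebra M) A"
proof (rule linear_mapsI; unfold monoid_algebra_simps mem_Collect_eq)
  fix p :: "_ \<Rightarrow>\<^sub>0 'k"
  assume p: "Poly_Mapping.keys p \<subseteq> carrier M"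
  have closed: "(\<lambda>b. Poly_Mapping.lookup p b \<odot> f b) \<in> Poly_Mapping.keys p \<rightarrow> carrier A"
    if "Poly_Mapping.keys p \<subseteq> carrier M" for p :: "_ \<Rightarrow>\<^sub>0 'k"
    using that f by auto
  show "lin_ext A f p \<in> carrier A"
    using closed[OF p] unfolding lin_ext_def by (intro finsum_closed)
  fix c
  have "lin_ext A f (fm_scale c p) = (\<Oplus>b\<in>Poly_Mapping.keys p. Poly_Mapping.lookup (fm_scale c p) b \<odot> f b)"
    using p f by (intro lin_ext_superset) (auto simp: in_keys_iff)
  also have "\<dots> = (\<Oplus>b\<in>Poly_Mapping.keys p. c \<odot> (Poly_Mapping.lookup p b \<odot> f b))"
    using p f by (intro add.finprod_cong') (auto simp: smult_smult Pi_iff subset_iff)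
  finally show "lin_ext A f (fm_scale c p) = c \<odot> lin_ext A f p"
    using p f unfolding lin_ext_def by (subst finsum_smult) auto
next
  fix p q :: "_ \<Rightarrow>\<^sub>0 'k"
  assume p: "Poly_Mapping.keys p \<subseteq> carrier M" and q: "Poly_Mapping.keys q \<subseteq> carrier M"
  let ?S = "Poly_Mapping.keys p \<union> Poly_Mapping.keys q"
  have S: "f \<in> ?S \<rightarrow> carrier A" "finite ?S" "Poly_Mapping.keys (p + q) \<subseteq> ?S"
    using p q f keys_add[of p q] by auto
  have "lin_ext A f (p + q) = (\<Oplus>b\<in>?S. Poly_Mapping.lookup (p + q) b \<odot> f b)"
    using S by (intro lin_ext_superset)
  also have "\<dots> = (\<Oplus>b\<in>?S. Poly_Mapping.lookup p b \<odot> f b \<oplus> Poly_Mapping.lookup q b \<odot> f b)"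
    using S(1) by (intro add.finprod_cong') (auto simp: lookup_add smult_add_left Pi_iff)
  also have "\<dots> = lin_ext A f p \<oplus> lin_ext A f q"
    using S by (subst add.finprod_multf) (auto simp: lin_ext_superset[of ?S])
  finally show "lin_ext A f (p + q) = lin_ext A f p \<oplus> lin_ext A f q" .
qed

end

lemma monoid_algebra_linear_eq:
  assumes "assoc_algebra A" "f \<in> linear_maps (monoid_algebra M) A" "g \<in> linear_maps (monoid_algebra M) A"
    and "\<And>b. b \<in> carrier M \<Longrightarrow> f (Poly_Mapping.single b 1) = g (Poly_Mapping.single b 1)"
    and "Poly_Mapping.keys p \<subseteq> carrier M"
  shows "f p = g p"
  using assms(5)
proof (induction rule: fm_induct)
  case zero
  \<comment> \<open>\<open>linear_zero\<close> does not apply: \<open>M\<close> is arbitrary here,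
    so \<open>monoid_algebra M\<close> need not be an algebra. Homogeneity with scalar
    \<open>0\<close> gives the value at \<open>0\<close> instead.\<close>
  have "f 0 = f (fm_scale 0 0)" "g 0 = g (fm_scale 0 0)"
    by simp_all
  moreover have "f 0 \<in> carrier A" "g 0 \<in> carrier A"
    using linear_closed[OF assms(2), of 0] linear_closed[OF assms(3), of 0] by simp_all
  ultimately show ?case
    using linear_smult[OF assms(2), of 0 0] linear_smult[OF assms(3), of 0 0] assms(1)
    by (simp add: assoc_algebra.smult_0)
next
  case (add p q)
  then show ?case
    using linear_add[OF assms(2), of p q] linear_add[OF assms(3), of p q] by simp
next
  case (scale c p)
  then show ?case
    using linear_smult[OF assms(2), of p c] linear_smult[OF assms(3), of p c] by simp
qed (use assms(4) in auto)

text \<open>Both sides of multiplicativity are linear in each factor. The second factor is reduced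
  to basis elements while the first is one, then the first factor is reduced.\<close>

lemma (in assoc_algebra) lin_ext_hom:
  assumes M: "monoid M" and f: "f \<in> carrier M \<rightarrow> carrier A"
    and mult: "\<And>b c. b \<in> carrier M \<Longrightarrow> c \<in> carrier M \<Longrightarrow> f (b \<otimes>\<^bsub>M\<^esub> c) = f b \<otimes> f c"
    and one: "f \<one>\<^bsub>M\<^esub> = \<one>"
  shows "lin_ext A f \<in> algebra_homs (monoid_algebra M) A"
proof (rule algebra_homsI[OF lin_ext_linear[OF f]]; unfold monoid_algebra_simps mem_Collect_eq)
  interpret M: monoid M by fact
  interpret MA: assoc_algebra "monoid_algebra M :: ('k, _) module"
    by (rule M.monoid_algebra_assoc_algebra)
  have lin: "lin_ext A f \<in> linear_maps (monoid_algebra M) A"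
    by (rule lin_ext_linear[OF f])
  have f': "f b \<in> carrier A" if "b \<in> carrier M" for b
    using f that by auto
  show "lin_ext A f (Poly_Mapping.single \<one>\<^bsub>M\<^esub> 1) = \<one>"
    by (simp add: lin_ext_single one)
  fix p q :: "_ \<Rightarrow>\<^sub>0 'k"
  assume p: "Poly_Mapping.keys p \<subseteq> carrier M" and q: "Poly_Mapping.keys q \<subseteq> carrier M"
  have closed: "lin_ext A f p \<in> carrier A" if "Poly_Mapping.keys p \<subseteq> carrier M" for p
    using linear_closed[OF lin, of p] that by simp
  have single: "lin_ext A f (Poly_Mapping.single b 1 \<otimes>\<^bsub>monoid_algebra M\<^esub> q) =
      lin_ext A f (Poly_Mapping.single b 1) \<otimes> lin_ext A f q" if b: "b \<in> carrier M" for b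
  proof (rule monoid_algebra_linear_eq[OF is_assoc_algebra _ _ _ q])
    show "(\<lambda>q. lin_ext A f (Poly_Mapping.single b 1 \<otimes>\<^bsub>monoid_algebra M\<^esub> q)) \<in> linear_maps (monoid_algebra M) A"
      using b by (intro linear_comp[OF MA.linear_maps_mult_left lin]) simp
    show "(\<lambda>q. lin_ext A f (Poly_Mapping.single b 1) \<otimes> lin_ext A f q) \<in> linear_maps (monoid_algebra M) A"
      using b by (intro linear_comp[OF lin linear_maps_mult_left] closed) simp
  qed (use b in \<open>simp add: lin_ext_single f' mult\<close>)
  show "lin_ext A f (p \<otimes>\<^bsub>monoid_algebra M\<^esub> q) = lin_ext A f p \<otimes> lin_ext A f q"
  proof (rule monoid_algebra_linear_eq[OF is_assoc_algebra _ _ _ p])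
    show "(\<lambda>p. lin_ext A f (p \<otimes>\<^bsub>monoid_algebra M\<^esub> q)) \<in> linear_maps (monoid_algebra M) A"
      using q by (intro linear_comp[OF MA.linear_maps_mult_right lin]) simp
    show "(\<lambda>p. lin_ext A f p \<otimes> lin_ext A f q) \<in> linear_maps (monoid_algebra M) A"
      using q by (intro linear_comp[OF lin linear_maps_mult_right] closed)
  qed (use single in simp)
qed

section \<open>Tensor products\<close>

definition bilinear_maps ::
    "('k::field, 'a, 'm) module_scheme \<Rightarrow> ('k, 'b, 'n) module_scheme \<Rightarrow> ('k, 'u, 'l) module_scheme \<Rightarrow>
      ('a \<Rightarrow> 'b \<Rightarrow> 'u) set"
  where "bilinear_maps A B U =
    {\<beta>. (\<forall>a\<in>carrier A. \<beta> a \<in> linear_maps B U) \<and> (\<forall>b\<in>carrier B. (\<lambda>a. \<beta> a b) \<in> linear_maps A U)}"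

lemma bilinear_mapsI:
  assumes "\<And>a. a \<in> carrier A \<Longrightarrow> \<beta> a \<in> linear_maps B U"
    and "\<And>b. b \<in> carrier B \<Longrightarrow> (\<lambda>a. \<beta> a b) \<in> linear_maps A U"
  shows "\<beta> \<in> bilinear_maps A B U"
  using assms by (simp add: bilinear_maps_def)

lemma bilinear_left: "\<beta> \<in> bilinear_maps A B U \<Longrightarrow> a \<in> carrier A \<Longrightarrow> \<beta> a \<in> linear_maps B U"
  and bilinear_right: "\<beta> \<in> bilinear_maps A B U \<Longrightarrow> b \<in> carrier B \<Longrightarrow> (\<lambda>a. \<beta> a b) \<in> linear_maps A U"
  by (simp_all add: bilinear_maps_def)

lemma bilinear_closed: "\<beta> \<in> bilinear_maps A B U \<Longrightarrow> a \<in> carrier A \<Longrightarrow> b \<in> carrier B \<Longrightarrow> \<beta> a b \<in> carrier U"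
  using bilinear_left linear_closed by metis

lemma bilinear_comp:
  assumes "\<beta> \<in> bilinear_maps C D U" "f \<in> linear_maps A C" "g \<in> linear_maps B D"
  shows "(\<lambda>a b. \<beta> (f a) (g b)) \<in> bilinear_maps A B U"
proof (rule bilinear_mapsI)
  show "(\<lambda>b. \<beta> (f a) (g b)) \<in> linear_maps B U" if "a \<in> carrier A" for a
    using linear_comp[OF assms(3) bilinear_left[OF assms(1) linear_closed[OF assms(2) that]]] .
  show "(\<lambda>a. \<beta> (f a) (g b)) \<in> linear_maps A U" if "b \<in> carrier B" for b
    using linear_comp[OF assms(2) bilinear_right[OF assms(1) linear_closed[OF assms(3) that]]] .
qed

lemma bilinear_post:
  assumes "\<beta> \<in> bilinear_maps A B U" "h \<in> linear_maps U V"
  shows "(\<lambda>a b. h (\<beta> a b)) \<in> bilinear_maps A B V"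
  by (intro bilinear_mapsI linear_comp[OF bilinear_left[OF assms(1)] assms(2)]
    linear_comp[OF bilinear_right[OF assms(1)] assms(2)])

lemma bilinear_cong:
  assumes "\<beta> \<in> bilinear_maps A B U"
    and eq: "\<And>a b. a \<in> carrier A \<Longrightarrow> b \<in> carrier B \<Longrightarrow> \<beta> a b = \<beta>' a b"
    and "assoc_algebra A" "assoc_algebra B"
  shows "\<beta>' \<in> bilinear_maps A B U"
proof (rule bilinear_mapsI)
  show "\<beta>' a \<in> linear_maps B U" if "a \<in> carrier A" for a
    by (rule linear_cong[OF bilinear_left[OF assms(1) that] eq[OF that] assms(4)])
  show "(\<lambda>a. \<beta>' a b) \<in> linear_maps A U" if "b \<in> carrier B" for b
    by (rule linear_cong[OF bilinear_right[OF assms(1) that] eq[OF _ that] assms(3)])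
qed

lemma (in assoc_algebra) bilinear_mult: "(\<lambda>a b. a \<otimes> b) \<in> bilinear_maps A A A"
  by (intro bilinear_mapsI linear_maps_mult_left linear_maps_mult_right)

lemma bilinear_scalars:
  assumes "f \<in> linear_maps A scalars" "g \<in> linear_maps B scalars"
  shows "(\<lambda>a b. f a * g b) \<in> bilinear_maps A B scalars"
  using assms by (intro bilinear_mapsI linear_mapsI) (auto simp: linear_add linear_smult algebra_simps)

lemma (in assoc_algebra) bilinear_scalar_smult:
  assumes "f \<in> linear_maps B scalars" "g \<in> linear_maps C A"
  shows "(\<lambda>a b. f a \<odot> g b) \<in> bilinear_maps B C A" "(\<lambda>b a. f a \<odot> g b) \<in> bilinear_maps C B A"
  using assms by (auto intro!: bilinear_mapsI linear_maps_smult linear_maps_scalar_smult intro: linear_closed)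

locale algebra_pair = A: assoc_algebra A + B: assoc_algebra B
  for A :: "('k::field, 'a, 'm) module_scheme" and B :: "('k, 'b, 'n) module_scheme"
begin

abbreviation MA :: "('k, 'a \<times> 'b \<Rightarrow>\<^sub>0 'k) module" where "MA \<equiv> monoid_algebra (A \<times>\<times> B)"
abbreviation J :: "('a \<times> 'b \<Rightarrow>\<^sub>0 'k) set" where "J \<equiv> fm.span (bilinearity A B)"
abbreviation T :: "('k, ('a \<times> 'b \<Rightarrow>\<^sub>0 'k) set) module" where "T \<equiv> tensor A B"
abbreviation pt :: "'a \<Rightarrow> 'b \<Rightarrow> ('a \<times> 'b \<Rightarrow>\<^sub>0 'k) set" where "pt \<equiv> pure_tensor A B"
abbreviation sg :: "'a \<times> 'b \<Rightarrow> 'k \<Rightarrow> ('a \<times> 'b \<Rightarrow>\<^sub>0 'k)" where "sg \<equiv> Poly_Mapping.single"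

lemma bilinearityI:
  "a \<in> carrier A \<Longrightarrow> a' \<in> carrier A \<Longrightarrow> b \<in> carrier B \<Longrightarrow>
    sg (a \<oplus>\<^bsub>A\<^esub> a', b) 1 - sg (a, b) 1 - sg (a', b) 1 \<in> bilinearity A B"
  "a \<in> carrier A \<Longrightarrow> b \<in> carrier B \<Longrightarrow> b' \<in> carrier B \<Longrightarrow>
    sg (a, b \<oplus>\<^bsub>B\<^esub> b') 1 - sg (a, b) 1 - sg (a, b') 1 \<in> bilinearity A B"
  "a \<in> carrier A \<Longrightarrow> b \<in> carrier B \<Longrightarrow> sg (c \<odot>\<^bsub>A\<^esub> a, b) 1 - sg (a, b) c \<in> bilinearity A B"
  "a \<in> carrier A \<Longrightarrow> b \<in> carrier B \<Longrightarrow> sg (a, c \<odot>\<^bsub>B\<^esub> b) 1 - sg (a, b) c \<in> bilinearity A B"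
  unfolding bilinearity_def by blast+

lemma bilinearityE:
  assumes "p \<in> bilinearity A B"
  obtains a a' b where "p = sg (a \<oplus>\<^bsub>A\<^esub> a', b) 1 - sg (a, b) 1 - sg (a', b) 1"
      "a \<in> carrier A" "a' \<in> carrier A" "b \<in> carrier B"
  | a b b' where "p = sg (a, b \<oplus>\<^bsub>B\<^esub> b') 1 - sg (a, b) 1 - sg (a, b') 1"
      "a \<in> carrier A" "b \<in> carrier B" "b' \<in> carrier B"
  | c a b where "p = sg (c \<odot>\<^bsub>A\<^esub> a, b) 1 - sg (a, b) c" "a \<in> carrier A" "b \<in> carrier B"
  | c a b where "p = sg (a, c \<odot>\<^bsub>B\<^esub> b) 1 - sg (a, b) c" "a \<in> carrier A" "b \<in> carrier B"
  using assms unfolding bilinearity_def by blast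

lemma carrier_prod [simp]: "carrier (A \<times>\<times> B) = carrier A \<times> carrier B"
  by (simp add: DirProd_def)

lemma monoid_prod: "monoid (A \<times>\<times> B)"
  by (intro DirProd_monoid A.monoid_axioms B.monoid_axioms)

interpretation MA: assoc_algebra MA
  by (rule monoid.monoid_algebra_assoc_algebra[OF monoid_prod])

lemma subspace_carrier: "fm.subspace {p :: 'a \<times> 'b \<Rightarrow>\<^sub>0 'k. Poly_Mapping.keys p \<subseteq> S}"
  unfolding fm.subspace_def by (auto dest!: subsetD[OF keys_add] subsetD[OF keys_fm_scale])

lemma span_carrier: "J \<subseteq> carrier MA"
proof (rule fm.span_minimal)
  have "Poly_Mapping.keys p \<subseteq> carrier A \<times> carrier B" if "p \<in> bilinearity A B" for p
    using that
    by (cases rule: bilinearityE; simp; intro order_trans[OF keys_diff] Un_least; simp)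
  then show "bilinearity A B \<subseteq> carrier MA"
    by auto
qed (simp add: subspace_carrier)

lemma mult_diff: 
  "p \<otimes>\<^bsub>MA\<^esub> (s - t) = p \<otimes>\<^bsub>MA\<^esub> s - p \<otimes>\<^bsub>MA\<^esub> t" "(s - t) \<otimes>\<^bsub>MA\<^esub> p = s \<otimes>\<^bsub>MA\<^esub> p - t \<otimes>\<^bsub>MA\<^esub> p"
  using monoid_algebra_mult_add_right[where M = "A \<times>\<times> B", of p "s - t" t]
    monoid_algebra_mult_add_left[where M = "A \<times>\<times> B", of "s - t" t p]
  by (simp_all add: algebra_simps)

text \<open>Multiplying a bilinearity relation by a basis pair \<open>(a', b')\<close> produces
  another relation of the same kind, because the products of \<open>A\<close> and \<open>B\<close>
  are distributive and commute with scalars. The elements sent into \<open>J\<close> by both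
  multiplications form a subspace, so they include the whole span.\<close>

lemma span_mult:
  assumes "Poly_Mapping.keys p \<subseteq> carrier A \<times> carrier B" "i \<in> J"
  shows "p \<otimes>\<^bsub>MA\<^esub> i \<in> J \<and> i \<otimes>\<^bsub>MA\<^esub> p \<in> J"
  using assms(1)
proof (induction rule: fm_induct)
  case zero
  then show ?case by (simp add: fm.span_zero)
next
  case (add p q)
  then show ?case by (simp add: monoid_algebra_bilinear fm.span_add)
next
  case (scale c p)
  then show ?case by (simp add: monoid_algebra_bilinear fm.span_scale)
next
  case (single x)
  obtain a' b' where x: "x = (a', b')" "a' \<in> carrier A" "b' \<in> carrier B"
    using single by auto
  have gen: "sg x 1 \<otimes>\<^bsub>MA\<^esub> p \<in> J \<and> p \<otimes>\<^bsub>MA\<^esub> sg x 1 \<in> J" if "p \<in> bilinearity A B" for p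
    using that x
    by (cases rule: bilinearityE; intro conjI fm.span_base)
      (simp_all add: mult_diff mult_DirProd A.l_distr A.r_distr B.l_distr B.r_distr
        A.smult_mult_left A.smult_mult_right B.smult_mult_left B.smult_mult_right bilinearityI)
  have "fm.subspace {p. sg x 1 \<otimes>\<^bsub>MA\<^esub> p \<in> J \<and> p \<otimes>\<^bsub>MA\<^esub> sg x 1 \<in> J}"
    unfolding fm.subspace_def
    by (simp add: monoid_algebra_bilinear fm.span_add fm.span_scale fm.span_zero)
  then have "J \<subseteq> {p. sg x 1 \<otimes>\<^bsub>MA\<^esub> p \<in> J \<and> p \<otimes>\<^bsub>MA\<^esub> sg x 1 \<in> J}"
    using gen by (intro fm.span_minimal) auto
  then show ?case
    using assms(2) by blast
qed

lemma span_ideal: "ideal J MA"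
proof (rule idealI[OF MA.ring_axioms])
  show "subgroup J (add_monoid MA)"
  proof (rule group.subgroupI[OF MA.add.is_group])
    show "inv\<^bsub>add_monoid MA\<^esub> p \<in> J" if "p \<in> J" for p
    proof -
      have "\<ominus>\<^bsub>MA\<^esub> p \<in> J"
        using fm.span_scale[OF that, of "-1"] span_carrier that MA.smult_minus_1[of p] by auto
      then show ?thesis
        by (simp add: a_inv_def)
    qed
  qed (use span_carrier in \<open>auto intro: fm.span_add fm.span_zero\<close>)
qed (use span_mult in auto)

interpretation quot: algebra_ideal J MA
  by (intro algebra_ideal.intro span_ideal MA.is_assoc_algebra)

lemma tensor_eq: "T = quot_algebra MA J"
  by (simp add: tensor_def)

lemma pt_eq: "pt a b = J +>\<^bsub>MA\<^esub> sg (a, b) 1"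
  by (simp add: pure_tensor_def)

lemma tensor_assoc_algebra: "assoc_algebra T"
  unfolding tensor_eq by (rule quot.quot_assoc_algebra)

sublocale T: assoc_algebra T
  by (rule tensor_assoc_algebra)

lemma coset_eq_of_span:
  assumes "s - t \<in> J" "Poly_Mapping.keys s \<subseteq> carrier A \<times> carrier B" "Poly_Mapping.keys t \<subseteq> carrier A \<times> carrier B"
  shows "J +>\<^bsub>MA\<^esub> s = J +>\<^bsub>MA\<^esub> t"
proof -
  have "s \<ominus>\<^bsub>MA\<^esub> t = s - t"
    using assms MA.smult_minus_1[of t] by (simp add: a_minus_def)
  then show ?thesis
    using assms by (subst quot.coset_eq_iff) auto
qed

lemma pt_closed [simp, intro]: "a \<in> carrier A \<Longrightarrow> b \<in> carrier B \<Longrightarrow> pt a b \<in> carrier T"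
  unfolding tensor_eq pt_eq by (rule quot.quot_coset_closed) simp

lemma pt_add_left:
  assumes "a \<in> carrier A" "a' \<in> carrier A" "b \<in> carrier B"
  shows "pt (a \<oplus>\<^bsub>A\<^esub> a') b = pt a b \<oplus>\<^bsub>T\<^esub> pt a' b"
proof -
  have "J +>\<^bsub>MA\<^esub> sg (a \<oplus>\<^bsub>A\<^esub> a', b) 1 = J +>\<^bsub>MA\<^esub> (sg (a, b) 1 + sg (a', b) 1)"
    using assms bilinearityI(1)[OF assms] subset_trans[OF keys_add]
    by (intro coset_eq_of_span) (auto simp: fm.span_base diff_diff_eq intro!: subset_trans[OF keys_add])
  then show ?thesis
    using assms unfolding tensor_eq pt_eq by (subst quot.coset_ops) auto
qed

lemma pt_add_right:
  assumes "a \<in> carrier A" "b \<in> carrier B" "b' \<in> carrier B"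
  shows "pt a (b \<oplus>\<^bsub>B\<^esub> b') = pt a b \<oplus>\<^bsub>T\<^esub> pt a b'"
proof -
  have "J +>\<^bsub>MA\<^esub> sg (a, b \<oplus>\<^bsub>B\<^esub> b') 1 = J +>\<^bsub>MA\<^esub> (sg (a, b) 1 + sg (a, b') 1)"
    using assms bilinearityI(2)[OF assms] subset_trans[OF keys_add]
    by (intro coset_eq_of_span) (auto simp: fm.span_base diff_diff_eq intro!: subset_trans[OF keys_add])
  then show ?thesis
    using assms unfolding tensor_eq pt_eq by (subst quot.coset_ops) auto
qed

lemma pt_smult_left:
  assumes "a \<in> carrier A" "b \<in> carrier B"
  shows "pt (c \<odot>\<^bsub>A\<^esub> a) b = c \<odot>\<^bsub>T\<^esub> pt a b"
proof -
  have "J +>\<^bsub>MA\<^esub> sg (c \<odot>\<^bsub>A\<^esub> a, b) 1 = J +>\<^bsub>MA\<^esub> (sg (a, b) c)"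
    using assms bilinearityI(3)[OF assms] by (intro coset_eq_of_span) (auto simp: fm.span_base)
  then show ?thesis
    using assms unfolding tensor_eq pt_eq by (subst quot.coset_smult) auto
qed

lemma pt_smult_right:
  assumes "a \<in> carrier A" "b \<in> carrier B"
  shows "pt a (c \<odot>\<^bsub>B\<^esub> b) = c \<odot>\<^bsub>T\<^esub> pt a b"
proof -
  have "J +>\<^bsub>MA\<^esub> sg (a, c \<odot>\<^bsub>B\<^esub> b) 1 = J +>\<^bsub>MA\<^esub> (sg (a, b) c)"
    using assms bilinearityI(4)[OF assms] by (intro coset_eq_of_span) (auto simp: fm.span_base)
  then show ?thesis
    using assms unfolding tensor_eq pt_eq by (subst quot.coset_smult) auto
qed

lemma pt_bilinear: "pt \<in> bilinear_maps A B T"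
  by (intro bilinear_mapsI linear_mapsI)
    (auto simp: pt_add_left pt_add_right pt_smult_left pt_smult_right)

lemma pt_mult:
  assumes "a \<in> carrier A" "a' \<in> carrier A" "b \<in> carrier B" "b' \<in> carrier B"
  shows "pt a b \<otimes>\<^bsub>T\<^esub> pt a' b' = pt (a \<otimes>\<^bsub>A\<^esub> a') (b \<otimes>\<^bsub>B\<^esub> b')"
  using assms unfolding tensor_eq pt_eq by (subst quot.coset_ops) (auto simp: mult_DirProd)

lemma tensor_one: "\<one>\<^bsub>T\<^esub> = pt \<one>\<^bsub>A\<^esub> \<one>\<^bsub>B\<^esub>"
  unfolding tensor_eq pt_eq by (subst quot.coset_one) (simp add: one_DirProd)

lemma pt_pow:
  assumes "a \<in> carrier A" "b \<in> carrier B"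
  shows "pt a b [^]\<^bsub>T\<^esub> (n::nat) = pt (a [^]\<^bsub>A\<^esub> n) (b [^]\<^bsub>B\<^esub> n)"
  using assms by (induction n) (simp_all add: tensor_one pt_mult)

lemma pt_zero:
  "b \<in> carrier B \<Longrightarrow> pt \<zero>\<^bsub>A\<^esub> b = \<zero>\<^bsub>T\<^esub>" "a \<in> carrier A \<Longrightarrow> pt a \<zero>\<^bsub>B\<^esub> = \<zero>\<^bsub>T\<^esub>"
  using pt_smult_left[of "\<zero>\<^bsub>A\<^esub>" b 0] pt_smult_right[of a "\<zero>\<^bsub>B\<^esub>" 0] by simp_all

text \<open>Zero and scalar multiples need no cases of their own: a multiple of a pure tensor is
  again pure, with the scalar moved into the first factor, and zero is pure.\<close>

lemma tensor_induct [consumes 1, case_names pure add]: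
  assumes "t \<in> carrier T"
    and pure: "\<And>a b. a \<in> carrier A \<Longrightarrow> b \<in> carrier B \<Longrightarrow> P (pt a b)"
    and add: "\<And>s t. s \<in> carrier T \<Longrightarrow> t \<in> carrier T \<Longrightarrow> P s \<Longrightarrow> P t \<Longrightarrow> P (s \<oplus>\<^bsub>T\<^esub> t)"
  shows "P t"
proof -
  obtain p where p: "t = J +>\<^bsub>MA\<^esub> p" "Poly_Mapping.keys p \<subseteq> carrier A \<times> carrier B"
    using assms(1) by (auto simp: tensor_eq quot.carrier_quot)
  have coset: "J +>\<^bsub>MA\<^esub> p \<in> carrier T" if "Poly_Mapping.keys p \<subseteq> carrier A \<times> carrier B" for p
    using that unfolding tensor_eq by (intro quot.quot_coset_closed) simp
  \<comment> \<open>Quantifying over all multiples lets the scalar case of \<open>fm_induct\<close>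
    go through, since \<open>P\<close> itself is not assumed stable under scaling.\<close>
  have "\<forall>c. P (c \<odot>\<^bsub>T\<^esub> (J +>\<^bsub>MA\<^esub> p))"
    using p(2)
  proof (induction rule: fm_induct)
    case zero
    have "J +>\<^bsub>MA\<^esub> 0 = \<zero>\<^bsub>T\<^esub>"
      using quot.coset_zero by (simp add: tensor_eq)
    moreover have "P \<zero>\<^bsub>T\<^esub>"
      using pure[of "\<zero>\<^bsub>A\<^esub>" "\<zero>\<^bsub>B\<^esub>"] pt_zero(1)[of "\<zero>\<^bsub>B\<^esub>"] by simp
    ultimately show ?case
      by simp
  next
    case (single x)
    then obtain a b where "x = (a, b)" "a \<in> carrier A" "b \<in> carrier B"
      by auto
    then show ?case
      using pure by (simp flip: pt_eq pt_smult_left)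
  next
    case (add p q)
    have "J +>\<^bsub>MA\<^esub> (p + q) = (J +>\<^bsub>MA\<^esub> p) \<oplus>\<^bsub>T\<^esub> (J +>\<^bsub>MA\<^esub> q)"
      using add(1,2) quot.coset_ops(1)[of p q] by (simp add: tensor_eq)
    then show ?case
      using add coset assms(3) by (simp add: T.smult_add_right)
  next
    case (scale d p)
    have "J +>\<^bsub>MA\<^esub> (fm_scale d p) = d \<odot>\<^bsub>T\<^esub> (J +>\<^bsub>MA\<^esub> p)"
      using scale(1) quot.coset_smult[of p d] by (simp add: tensor_eq)
    then show ?case
      using scale coset by (simp add: T.smult_smult)
  qed
  then show ?thesis
    using p coset by (metis T.smult_1)
qed

lemma tensor_linear_eq:
  assumes "t \<in> carrier T" "f \<in> linear_maps T U" "g \<in> linear_maps T U"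
    and "\<And>a b. a \<in> carrier A \<Longrightarrow> b \<in> carrier B \<Longrightarrow> f (pt a b) = g (pt a b)"
  shows "f t = g t"
  using assms(1) by (induction rule: tensor_induct) (use assms in \<open>simp_all add: linear_add\<close>)

context
  fixes U :: "('k, 'u, 'l) module_scheme" assumes U: "assoc_algebra U"
begin

interpretation U: assoc_algebra U by (rule U)

context
  fixes \<beta> assumes \<beta>: "\<beta> \<in> bilinear_maps A B U"
begin

lemma lin_ext_bilinear: "lin_ext U (\<lambda>(a, b). \<beta> a b) \<in> linear_maps MA U"
  using \<beta> by (intro U.lin_ext_linear) (auto simp: bilinear_closed)

text \<open>This is the universal property of the tensor product: the kernel of the linear extension
  is a subspace, and bilinearity of \<open>\<beta>\<close> says exactly that it contains each of the
  four kinds of relations.\<close>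

lemma lin_ext_vanish:
  assumes "p \<in> J" shows "lin_ext U (\<lambda>(a, b). \<beta> a b) p = \<zero>\<^bsub>U\<^esub>"
proof -
  let ?f = "lin_ext U (\<lambda>(a, b). \<beta> a b)"
  let ?K = "{p. Poly_Mapping.keys p \<subseteq> carrier A \<times> carrier B \<and> ?f p = \<zero>\<^bsub>U\<^esub>}"
  have f_add: "?f (p + q) = ?f p \<oplus>\<^bsub>U\<^esub> ?f q" and f_scale: "?f (fm_scale c p) = c \<odot>\<^bsub>U\<^esub> ?f p"
    if "Poly_Mapping.keys p \<subseteq> carrier A \<times> carrier B" "Poly_Mapping.keys q \<subseteq> carrier A \<times> carrier B" for p q c
    using linear_add[OF lin_ext_bilinear, of p q] linear_smult[OF lin_ext_bilinear, of p c] that by simp_all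
  have f_sg: "?f (sg (a, b) c) = c \<odot>\<^bsub>U\<^esub> \<beta> a b" if "a \<in> carrier A" "b \<in> carrier B" for a b c
    using that \<beta> by (subst U.lin_ext_single) (auto simp: bilinear_closed)
  have f_closed: "?f p \<in> carrier U" if "Poly_Mapping.keys p \<subseteq> carrier A \<times> carrier B" for p
    using linear_closed[OF lin_ext_bilinear, of p] that by simp
  have f_diff: "?f (p - q) = ?f p \<ominus>\<^bsub>U\<^esub> ?f q"
    if "Poly_Mapping.keys p \<subseteq> carrier A \<times> carrier B" "Poly_Mapping.keys q \<subseteq> carrier A \<times> carrier B" for p q
  proof -
    have "p - q = p + fm_scale (-1) q"
      by simp
    moreover have "Poly_Mapping.keys (fm_scale (-1) q) \<subseteq> carrier A \<times> carrier B"
      using that by simp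
    moreover have "?f (fm_scale (-1) q) = \<ominus>\<^bsub>U\<^esub> ?f q"
      using f_scale[OF that, of "-1"] f_scale[OF that(2,2), of "-1"] f_closed[OF that(2)]
      by (simp add: U.smult_minus_1)
    ultimately show ?thesis
      using that f_add[of p "fm_scale (-1) q"] by (simp add: a_minus_def)
  qed
  have zero: "?f 0 = \<zero>\<^bsub>U\<^esub>"
    using linear_zero[OF MA.is_assoc_algebra U lin_ext_bilinear] by simp
  have "fm.subspace ?K"
    unfolding fm.subspace_def using zero
    by (auto simp: f_add f_scale dest: subsetD[OF keys_add] subsetD[OF keys_fm_scale])
  moreover have "bilinearity A B \<subseteq> ?K"
  proof
    have [simp]: "Poly_Mapping.keys (sg x c - sg y d) \<subseteq> carrier A \<times> carrier B"
      if "x \<in> carrier A \<times> carrier B" "y \<in> carrier A \<times> carrier B" for x y c d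
      using that by (intro order_trans[OF keys_diff]) auto
    have [simp]: "x \<oplus>\<^bsub>U\<^esub> (y \<oplus>\<^bsub>U\<^esub> (\<ominus>\<^bsub>U\<^esub> x \<oplus>\<^bsub>U\<^esub> \<ominus>\<^bsub>U\<^esub> y)) = \<zero>\<^bsub>U\<^esub>"
      if "x \<in> carrier U" "y \<in> carrier U" for x y
      using that U.r_neg[of "x \<oplus>\<^bsub>U\<^esub> y"] by (simp add: U.minus_add U.a_assoc)
    fix p assume p: "p \<in> bilinearity A B"
    have "?f p = \<zero>\<^bsub>U\<^esub>"
      using p \<beta>
      by (cases rule: bilinearityE)
        (auto simp: f_diff f_sg linear_add[OF bilinear_left] linear_smult[OF bilinear_left]
          linear_add[OF bilinear_right[OF \<beta>]] linear_smult[OF bilinear_right[OF \<beta>]]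
          bilinear_closed a_minus_def U.minus_add U.a_ac U.r_neg)
    then show "p \<in> ?K"
      using p span_carrier fm.span_base[of p "bilinearity A B"] by auto
  qed
  ultimately have "J \<subseteq> ?K"
    by (rule fm.span_minimal[rotated])
  then show ?thesis
    using assms by blast
qed

lemma tensor_lift_linear: "tensor_lift U \<beta> \<in> linear_maps T U"
  unfolding tensor_lift_def tensor_eq
  by (rule quot.on_cosets_linear[OF U lin_ext_bilinear lin_ext_vanish])

lemma tensor_lift_pure:
  assumes "a \<in> carrier A" "b \<in> carrier B"
  shows "tensor_lift U \<beta> (pt a b) = \<beta> a b"
proof -
  have "tensor_lift U \<beta> (pt a b) = lin_ext U (\<lambda>(a, b). \<beta> a b) (sg (a, b) 1)"
    unfolding tensor_lift_def pt_eq using assms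
    by (intro quot.on_cosets_coset[OF U lin_ext_bilinear lin_ext_vanish]) simp_all
  then show ?thesis
    using assms \<beta> by (simp add: U.lin_ext_single bilinear_closed)
qed

lemmas tensor_lift_add = linear_add[OF tensor_lift_linear]

end

lemma tensor_lift_cong:
  assumes "\<beta> \<in> bilinear_maps A B U" "t \<in> carrier T"
    and "\<And>a b. a \<in> carrier A \<Longrightarrow> b \<in> carrier B \<Longrightarrow> \<beta> a b = \<beta>' a b"
  shows "tensor_lift U \<beta> t = tensor_lift U \<beta>' t"
proof -
  have "\<beta>' \<in> bilinear_maps A B U"
    using bilinear_cong[OF assms(1,3) A.is_assoc_algebra B.is_assoc_algebra] by blast
  then show ?thesis
    using assms(1,3)
    by (intro tensor_linear_eq[OF assms(2) tensor_lift_linear tensor_lift_linear]) (auto simp: tensor_lift_pure)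
qed

lemma tensor_lift_eqI:
  assumes "f \<in> linear_maps T U" "\<beta> \<in> bilinear_maps A B U" "t \<in> carrier T"
    and "\<And>a b. a \<in> carrier A \<Longrightarrow> b \<in> carrier B \<Longrightarrow> f (pt a b) = \<beta> a b"
  shows "f t = tensor_lift U \<beta> t"
  using assms by (intro tensor_linear_eq[OF assms(3,1) tensor_lift_linear]) (auto simp: tensor_lift_pure)

text \<open>Linearity in a parameter is assumed on pure tensors and passes to sums. This is what
  makes nested Sweedler sums linear in the variables of the outer sum.\<close>

lemma tensor_lift_param:
  assumes "assoc_algebra P" "t \<in> carrier T"
    and bil: "\<And>p. p \<in> carrier P \<Longrightarrow> \<beta> p \<in> bilinear_maps A B U"
    and lin: "\<And>a b. a \<in> carrier A \<Longrightarrow> b \<in> carrier B \<Longrightarrow> (\<lambda>p. \<beta> p a b) \<in> linear_maps P U"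
  shows "(\<lambda>p. tensor_lift U (\<beta> p) t) \<in> linear_maps P U"
  using assms(2)
proof (induction rule: tensor_induct)
  case (pure a b)
  then show ?case
    by (intro linear_cong[OF lin _ assms(1), of a b]) (simp_all add: tensor_lift_pure bil)
next
  case (add s t)
  show ?case
    by (rule linear_cong[OF U.linear_maps_add[OF assms(1) add(3,4)] _ assms(1)])
      (use add(1,2) in \<open>simp add: tensor_lift_add bil\<close>)
qed

text \<open>For comultiplications \<open>s\<close> and \<open>t\<close> of two elements this
  expresses a sum over the comultiplication of their product as a double sum; see
  \<open>sw_mult\<close>.\<close>

lemma tensor_lift_mult:
  assumes \<beta>: "\<beta> \<in> bilinear_maps A B U" and "s \<in> carrier T" "t \<in> carrier T"
  shows "tensor_lift U \<beta> (s \<otimes>\<^bsub>T\<^esub> t) =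
    tensor_lift U (\<lambda>a b. tensor_lift U (\<lambda>a' b'. \<beta> (a \<otimes>\<^bsub>A\<^esub> a') (b \<otimes>\<^bsub>B\<^esub> b')) t) s"
proof (rule tensor_lift_eqI[OF linear_comp[OF T.linear_maps_mult_right tensor_lift_linear]])
  have bil: "(\<lambda>a' b'. \<beta> (a \<otimes>\<^bsub>A\<^esub> a') (b \<otimes>\<^bsub>B\<^esub> b')) \<in> bilinear_maps A B U"
    if "a \<in> carrier A" "b \<in> carrier B" for a b
    using that by (intro bilinear_comp[OF \<beta>] A.linear_maps_mult_left B.linear_maps_mult_left)
  have bil': "(\<lambda>a b. \<beta> (a \<otimes>\<^bsub>A\<^esub> a') (b \<otimes>\<^bsub>B\<^esub> b')) \<in> bilinear_maps A B U"
    if "a' \<in> carrier A" "b' \<in> carrier B" for a' b'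
    using that by (intro bilinear_comp[OF \<beta>] A.linear_maps_mult_right B.linear_maps_mult_right)
  show "(\<lambda>a b. tensor_lift U (\<lambda>a' b'. \<beta> (a \<otimes>\<^bsub>A\<^esub> a') (b \<otimes>\<^bsub>B\<^esub> b')) t) \<in> bilinear_maps A B U"
    using assms(3)
    by (auto intro!: bilinear_mapsI tensor_lift_param bil A.is_assoc_algebra B.is_assoc_algebra
      intro: bilinear_left[OF bil'] bilinear_right[OF bil'])
  show "tensor_lift U \<beta> (pt a b \<otimes>\<^bsub>T\<^esub> t) = tensor_lift U (\<lambda>a' b'. \<beta> (a \<otimes>\<^bsub>A\<^esub> a') (b \<otimes>\<^bsub>B\<^esub> b')) t"
    if "a \<in> carrier A" "b \<in> carrier B" for a b
    using that assms(3)
    by (intro tensor_lift_eqI[OF linear_comp[OF T.linear_maps_mult_left tensor_lift_linear[OF \<beta>]]])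
      (simp_all add: bil pt_mult tensor_lift_pure[OF \<beta>])
qed (use assms in simp_all)

lemma tensor_hom:
  assumes f: "f \<in> linear_maps T U"
    and mult: "\<And>a b a' b'. a \<in> carrier A \<Longrightarrow> b \<in> carrier B \<Longrightarrow> a' \<in> carrier A \<Longrightarrow> b' \<in> carrier B \<Longrightarrow>
      f (pt (a \<otimes>\<^bsub>A\<^esub> a') (b \<otimes>\<^bsub>B\<^esub> b')) = f (pt a b) \<otimes>\<^bsub>U\<^esub> f (pt a' b')"
    and one: "f (pt \<one>\<^bsub>A\<^esub> \<one>\<^bsub>B\<^esub>) = \<one>\<^bsub>U\<^esub>"
  shows "f \<in> algebra_homs T U"
proof (rule algebra_homsI[OF f])
  fix s t assume s: "s \<in> carrier T" and t: "t \<in> carrier T"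
  have *: "f (pt a b \<otimes>\<^bsub>T\<^esub> t) = f (pt a b) \<otimes>\<^bsub>U\<^esub> f t" if "a \<in> carrier A" "b \<in> carrier B" for a b
    using that by (intro tensor_linear_eq[OF t linear_comp[OF T.linear_maps_mult_left f]
      linear_comp[OF f U.linear_maps_mult_left]]) (auto simp: pt_mult mult linear_closed[OF f])
  show "f (s \<otimes>\<^bsub>T\<^esub> t) = f s \<otimes>\<^bsub>U\<^esub> f t"
    using t by (intro tensor_linear_eq[OF s linear_comp[OF T.linear_maps_mult_right f]
      linear_comp[OF f U.linear_maps_mult_right]]) (auto simp: * linear_closed[OF f])
qed (simp add: tensor_one one)

end

lemma tensor_lift_post:
  assumes U: "assoc_algebra U" and V: "assoc_algebra V"
    and "\<beta> \<in> bilinear_maps A B U" "g \<in> linear_maps U V" "t \<in> carrier T"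
  shows "g (tensor_lift U \<beta> t) = tensor_lift V (\<lambda>a b. g (\<beta> a b)) t"
  using assms(3-5)
  by (intro tensor_lift_eqI[OF V linear_comp[OF tensor_lift_linear[OF U]]])
    (auto simp: tensor_lift_pure[OF U] intro: bilinear_post)

end

locale algebra_pair_maps = AB: algebra_pair A B + CD: algebra_pair C D
  for A :: "('k::field, 'a, 'm) module_scheme" and B :: "('k, 'b, 'n) module_scheme"
    and C :: "('k, 'c, 'm2) module_scheme" and D :: "('k, 'd, 'n2) module_scheme" +
  fixes f :: "'a \<Rightarrow> 'c" and g :: "'b \<Rightarrow> 'd"
  assumes f: "f \<in> linear_maps A C" and g: "g \<in> linear_maps B D"
begin

lemma map_bilinear: "(\<lambda>a b. pure_tensor C D (f a) (g b)) \<in> bilinear_maps A B (tensor C D)"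
  by (intro bilinear_comp[OF CD.pt_bilinear f g])

lemma tensor_map_linear: "tensor_map C D f g \<in> linear_maps (tensor A B) (tensor C D)"
  unfolding tensor_map_def by (intro AB.tensor_lift_linear CD.tensor_assoc_algebra map_bilinear)

lemmas tensor_map_closed = linear_closed[OF tensor_map_linear]

lemma tensor_map_pure:
  "a \<in> carrier A \<Longrightarrow> b \<in> carrier B \<Longrightarrow>
    tensor_map C D f g (pure_tensor A B a b) = pure_tensor C D (f a) (g b)"
  unfolding tensor_map_def by (simp add: AB.tensor_lift_pure CD.tensor_assoc_algebra map_bilinear)

lemma tensor_lift_map:
  assumes U: "assoc_algebra U" and \<beta>: "\<beta> \<in> bilinear_maps C D U" and "t \<in> carrier (tensor A B)"
  shows "tensor_lift U \<beta> (tensor_map C D f g t) = tensor_lift U (\<lambda>a b. \<beta> (f a) (g b)) t"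
  using assms(3) f g
  by (intro AB.tensor_lift_eqI[OF U linear_comp[OF tensor_map_linear CD.tensor_lift_linear[OF U \<beta>]]]
      bilinear_comp[OF \<beta>])
    (auto simp: tensor_map_pure CD.tensor_lift_pure[OF U \<beta>] linear_closed)

lemma tensor_map_hom:
  assumes "f \<in> algebra_homs A C" "g \<in> algebra_homs B D"
  shows "tensor_map C D f g \<in> algebra_homs (tensor A B) (tensor C D)"
  using assms
  by (intro AB.tensor_hom CD.tensor_assoc_algebra tensor_map_linear)
    (auto simp: tensor_map_pure CD.pt_mult algebra_hom_mult algebra_hom_one algebra_hom_closed CD.tensor_one)

end

section \<open>Triple tensor products and the associator\<close>

locale algebra_triple = A: assoc_algebra A + B: assoc_algebra B + C: assoc_algebra C
  for A :: "('k::field, 'a, 'm) module_scheme" and B :: "('k, 'b, 'n) module_scheme"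
    and C :: "('k, 'c, 'l) module_scheme"
begin

sublocale AB: algebra_pair A B ..
sublocale BC: algebra_pair B C ..
sublocale ABC1: algebra_pair "tensor A B" C ..
sublocale ABC2: algebra_pair A "tensor B C" ..

lemma assoc_inner_bilinear:
  assumes "c \<in> carrier C"
  shows "(\<lambda>a b. pure_tensor A (tensor B C) a (pure_tensor B C b c)) \<in> bilinear_maps A B (tensor A (tensor B C))"
  by (intro bilinear_comp[OF ABC2.pt_bilinear] linear_id bilinear_right[OF BC.pt_bilinear] assms)

lemma assoc_bilinear:
  "(\<lambda>t c. tensor_lift (tensor A (tensor B C))
         (\<lambda>a b. pure_tensor A (tensor B C) a (pure_tensor B C b c)) t)
    \<in> bilinear_maps (tensor A B) C (tensor A (tensor B C))"
proof (rule bilinear_mapsI)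
  fix t assume t: "t \<in> carrier (tensor A B)"
  show "(\<lambda>c. tensor_lift (tensor A (tensor B C))
         (\<lambda>a b. pure_tensor A (tensor B C) a (pure_tensor B C b c)) t) \<in> linear_maps C (tensor A (tensor B C))"
    using t by (intro AB.tensor_lift_param ABC2.tensor_assoc_algebra C.is_assoc_algebra assoc_inner_bilinear
      linear_comp[OF bilinear_left[OF BC.pt_bilinear] bilinear_left[OF ABC2.pt_bilinear]])
qed (intro AB.tensor_lift_linear ABC2.tensor_assoc_algebra assoc_inner_bilinear)

lemma tensor_assoc_linear:
  "tensor_assoc A B C \<in> linear_maps (tensor (tensor A B) C) (tensor A (tensor B C))"
  unfolding tensor_assoc_def by (intro ABC1.tensor_lift_linear ABC2.tensor_assoc_algebra assoc_bilinear)

lemma tensor_assoc_pure: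
  assumes "a \<in> carrier A" "b \<in> carrier B" "c \<in> carrier C"
  shows "tensor_assoc A B C (pure_tensor (tensor A B) C (pure_tensor A B a b) c) =
    pure_tensor A (tensor B C) a (pure_tensor B C b c)"
  using assms unfolding tensor_assoc_def
  by (simp add: ABC1.tensor_lift_pure[OF ABC2.tensor_assoc_algebra assoc_bilinear]
      AB.tensor_lift_pure[OF ABC2.tensor_assoc_algebra assoc_inner_bilinear])

lemma tensor3_linear_eq:
  assumes "t \<in> carrier (tensor (tensor A B) C)"
    and f: "f \<in> linear_maps (tensor (tensor A B) C) U" and g: "g \<in> linear_maps (tensor (tensor A B) C) U"
    and "\<And>a b c. a \<in> carrier A \<Longrightarrow> b \<in> carrier B \<Longrightarrow> c \<in> carrier C \<Longrightarrow>
      f (pure_tensor (tensor A B) C (pure_tensor A B a b) c) = g (pure_tensor (tensor A B) C (pure_tensor A B a b) c)"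
  shows "f t = g t"
proof (rule ABC1.tensor_linear_eq[OF assms(1-3)])
  fix s c assume s: "s \<in> carrier (tensor A B)" and c: "c \<in> carrier C"
  note lin = linear_comp[OF bilinear_right[OF ABC1.pt_bilinear c]]
  show "f (pure_tensor (tensor A B) C s c) = g (pure_tensor (tensor A B) C s c)"
    by (rule AB.tensor_linear_eq[OF s lin[OF f] lin[OF g]]) (rule assms(4)[OF _ _ c])
qed

text \<open>Multiplicativity of the associator makes both sides of coassociativity algebra
  homomorphisms, so that coassociativity can be checked on generators in
  \<open>coassoc_R\<close>.\<close>

lemma tensor_assoc_hom:
  "tensor_assoc A B C \<in> algebra_homs (tensor (tensor A B) C) (tensor A (tensor B C))" (is "?f \<in> _")
proof (rule algebra_homsI[OF tensor_assoc_linear])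
  let ?S = "tensor (tensor A B) C" and ?T = "tensor A (tensor B C)"
  fix s t assume s: "s \<in> carrier ?S" and t: "t \<in> carrier ?S"
  have *: "?f (pure_tensor (tensor A B) C (pure_tensor A B a b) c \<otimes>\<^bsub>?S\<^esub> t) =
    ?f (pure_tensor (tensor A B) C (pure_tensor A B a b) c) \<otimes>\<^bsub>?T\<^esub> ?f t"
    if "a \<in> carrier A" "b \<in> carrier B" "c \<in> carrier C" for a b c
    using that by (intro tensor3_linear_eq[OF t linear_comp[OF ABC1.T.linear_maps_mult_left tensor_assoc_linear]
      linear_comp[OF tensor_assoc_linear ABC2.T.linear_maps_mult_left]])
      (auto simp: ABC1.pt_mult ABC2.pt_mult AB.pt_mult BC.pt_mult tensor_assoc_pure)
  show "?f (s \<otimes>\<^bsub>?S\<^esub> t) = ?f s \<otimes>\<^bsub>?T\<^esub> ?f t"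
    using t by (intro tensor3_linear_eq[OF s linear_comp[OF ABC1.T.linear_maps_mult_right tensor_assoc_linear]
      linear_comp[OF tensor_assoc_linear ABC2.T.linear_maps_mult_right]])
      (auto simp: * linear_closed[OF tensor_assoc_linear])
qed (simp add: ABC1.tensor_one ABC2.tensor_one AB.tensor_one BC.tensor_one tensor_assoc_pure)

context
  fixes U :: "('k, 'u, 'p) module_scheme" and \<tau>
  assumes U: "assoc_algebra U"
    and \<tau>1: "\<And>b c. b \<in> carrier B \<Longrightarrow> c \<in> carrier C \<Longrightarrow> (\<lambda>a. \<tau> a b c) \<in> linear_maps A U"
    and \<tau>2: "\<And>a c. a \<in> carrier A \<Longrightarrow> c \<in> carrier C \<Longrightarrow> (\<lambda>b. \<tau> a b c) \<in> linear_maps B U"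
    and \<tau>3: "\<And>a b. a \<in> carrier A \<Longrightarrow> b \<in> carrier B \<Longrightarrow> (\<lambda>c. \<tau> a b c) \<in> linear_maps C U"
begin

lemma trilinear_bilinear:
  "a \<in> carrier A \<Longrightarrow> (\<lambda>b c. \<tau> a b c) \<in> bilinear_maps B C U"
  "c \<in> carrier C \<Longrightarrow> (\<lambda>a b. \<tau> a b c) \<in> bilinear_maps A B U"
  by (auto intro!: bilinear_mapsI \<tau>1 \<tau>2 \<tau>3)

lemma trilinear_lift_right: "(\<lambda>a t. tensor_lift U (\<lambda>b c. \<tau> a b c) t) \<in> bilinear_maps A (tensor B C) U"
  by (intro bilinear_mapsI BC.tensor_lift_linear U trilinear_bilinear BC.tensor_lift_param A.is_assoc_algebra \<tau>1)

lemma trilinear_lift_left: "(\<lambda>t c. tensor_lift U (\<lambda>a b. \<tau> a b c) t) \<in> bilinear_maps (tensor A B) C U"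
  by (intro bilinear_mapsI AB.tensor_lift_linear U trilinear_bilinear AB.tensor_lift_param C.is_assoc_algebra \<tau>3)

text \<open>A trilinear map factors through either bracketing of the triple tensor product, and the
  associator matches the two factorizations. In this form coassociativity applies to sums.\<close>

lemma tensor_lift_assoc:
  assumes "t \<in> carrier (tensor (tensor A B) C)"
  shows "tensor_lift U (\<lambda>a t. tensor_lift U (\<lambda>b c. \<tau> a b c) t) (tensor_assoc A B C t) =
    tensor_lift U (\<lambda>t c. tensor_lift U (\<lambda>a b. \<tau> a b c) t) t"
  by (rule tensor3_linear_eq[OF assms linear_comp[OF tensor_assoc_linear
      ABC2.tensor_lift_linear[OF U trilinear_lift_right]] ABC1.tensor_lift_linear[OF U trilinear_lift_left]])
    (simp add: tensor_assoc_pure ABC2.tensor_lift_pure[OF U trilinear_lift_right] BC.tensor_lift_pure[OF U trilinear_bilinear(1)]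
      ABC1.tensor_lift_pure[OF U trilinear_lift_left] AB.tensor_lift_pure[OF U trilinear_bilinear(2)])

end

end

section \<open>Tensors are separated by products of evaluations\<close>

context algebra_pair
begin

text \<open>A list, not a set, indexes the summands: pairs may repeat, and the length of the list is
  the induction measure of \<open>tensor_separating\<close>.\<close>

definition tsum :: "('a \<times> 'b) list \<Rightarrow> ('a \<times> 'b \<Rightarrow>\<^sub>0 'k) set"
  where "tsum xs = foldr (\<lambda>(a, b) s. pt a b \<oplus>\<^bsub>T\<^esub> s) xs \<zero>\<^bsub>T\<^esub>"

lemma tsum_simps [simp]:
  "tsum [] = \<zero>\<^bsub>T\<^esub>" "tsum ((a, b) # xs) = pt a b \<oplus>\<^bsub>T\<^esub> tsum xs"
  by (simp_all add: tsum_def)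

lemma tsum_closed: "set xs \<subseteq> carrier A \<times> carrier B \<Longrightarrow> tsum xs \<in> carrier T"
  by (induction xs) auto

lemma tsum_append:
  "set xs \<subseteq> carrier A \<times> carrier B \<Longrightarrow> set ys \<subseteq> carrier A \<times> carrier B \<Longrightarrow>
    tsum (xs @ ys) = tsum xs \<oplus>\<^bsub>T\<^esub> tsum ys"
  by (induction xs) (auto simp: tsum_closed T.a_assoc)

lemma tensor_eq_tsum:
  assumes "t \<in> carrier T" obtains xs where "set xs \<subseteq> carrier A \<times> carrier B" "t = tsum xs"
proof -
  have "\<exists>xs. set xs \<subseteq> carrier A \<times> carrier B \<and> t = tsum xs"
    using assms
  proof (induction rule: tensor_induct)
    case (pure a b)
    then show ?case by (intro exI[of _ "[(a, b)]"]) auto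
  next
    case (add s t)
    then obtain xs ys where "set xs \<subseteq> carrier A \<times> carrier B" "s = tsum xs"
      "set ys \<subseteq> carrier A \<times> carrier B" "t = tsum ys" by blast
    then show ?case by (intro exI[of _ "xs @ ys"]) (auto simp: tsum_append)
  qed
  then show ?thesis using that by blast
qed

text \<open>A shortest representation \<open>\<Sum> a\<^sub>i \<otimes> b\<^sub>i\<close> of an element on which all products of
  evaluations vanish can be shortened: a nonzero value of some \<open>b\<^sub>i\<close> expresses \<open>a\<^sub>i\<close> by the others.\<close>

lemma tensor_separating:
  fixes evA :: "'a \<Rightarrow> 's \<Rightarrow> 'k" and evB :: "'b \<Rightarrow> 't \<Rightarrow> 'k"
  assumes linA: "\<And>s. s \<in> S \<Longrightarrow> (\<lambda>a. evA a s) \<in> linear_maps A scalars"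
    and linB: "\<And>s. s \<in> S' \<Longrightarrow> (\<lambda>b. evB b s) \<in> linear_maps B scalars"
    and sepA: "\<And>a. a \<in> carrier A \<Longrightarrow> (\<And>s. s \<in> S \<Longrightarrow> evA a s = 0) \<Longrightarrow> a = \<zero>\<^bsub>A\<^esub>"
    and sepB: "\<And>b. b \<in> carrier B \<Longrightarrow> (\<And>s. s \<in> S' \<Longrightarrow> evB b s = 0) \<Longrightarrow> b = \<zero>\<^bsub>B\<^esub>"
    and t: "t \<in> carrier T"
    and vanish: "\<And>s s'. s \<in> S \<Longrightarrow> s' \<in> S' \<Longrightarrow> tensor_lift scalars (\<lambda>a b. evA a s * evB b s') t = 0"
  shows "t = \<zero>\<^bsub>T\<^esub>"
proof -
  have bil: "(\<lambda>a b. evA a s * evB b s') \<in> bilinear_maps A B scalars" if "s \<in> S" "s' \<in> S'" for s s'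
    using that by (intro bilinear_scalars linA linB)
  have lift_tsum: "tensor_lift scalars (\<lambda>a b. evA a s * evB b s') (tsum xs) = (\<Sum>(a, b)\<leftarrow>xs. evA a s * evB b s')"
    if "s \<in> S" "s' \<in> S'" "set xs \<subseteq> carrier A \<times> carrier B" for s s' xs
    using that(3)
  proof (induction xs)
    case Nil
    then show ?case
      using linear_zero[OF tensor_assoc_algebra scalars_algebra tensor_lift_linear[OF scalars_algebra bil[OF that(1,2)]]]
      by simp
  next
    case (Cons x xs)
    then show ?case
      using that(1,2) bil[OF that(1,2)]
      by (cases x) (simp add: tensor_lift_add[OF scalars_algebra] tensor_lift_pure[OF scalars_algebra] tsum_closed)
  qed
  have "tsum xs = \<zero>\<^bsub>T\<^esub>" if "set xs \<subseteq> carrier A \<times> carrier B"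
    "\<And>s s'. s \<in> S \<Longrightarrow> s' \<in> S' \<Longrightarrow> (\<Sum>(a, b)\<leftarrow>xs. evA a s * evB b s') = 0" for xs
    using that
  proof (induction "length xs" arbitrary: xs)
    case (Suc n)
    then obtain a b ys where xs: "xs = (a, b) # ys" "length ys = n" "a \<in> carrier A" "b \<in> carrier B"
      "set ys \<subseteq> carrier A \<times> carrier B"
      by (cases xs) auto
    show ?case
    proof (cases "\<forall>s\<in>S'. evB b s = 0")
      case True
      then have "b = \<zero>\<^bsub>B\<^esub>"
        using sepB xs by blast
      moreover have "tsum ys = \<zero>\<^bsub>T\<^esub>"
        using True Suc.prems xs by (intro Suc.hyps(1)) auto
      ultimately show ?thesis
        using xs by (simp add: pt_zero)
    next
      case False
      then obtain s0 where s0: "s0 \<in> S'" "evB b s0 \<noteq> 0"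
        by blast
      \<comment> \<open>Evaluating the second factors at \<open>s0\<close> makes the value of
        \<open>evB b s0\<close> times \<open>a\<close>, plus the corresponding multiples of the
        other first factors, vanish under every evaluation of \<open>A\<close>. Solving for
        \<open>a\<close> gives these coefficients.\<close>
      define c where "c b' = - evB b' s0 / evB b s0" for b'
      define comb where "comb zs = foldr (\<lambda>(a', b') s. c b' \<odot>\<^bsub>A\<^esub> a' \<oplus>\<^bsub>A\<^esub> s) zs \<zero>\<^bsub>A\<^esub>" for zs
      have comb_simps: "comb [] = \<zero>\<^bsub>A\<^esub>" "comb ((a', b') # zs) = c b' \<odot>\<^bsub>A\<^esub> a' \<oplus>\<^bsub>A\<^esub> comb zs" for a' b' zs
        by (simp_all add: comb_def)
      \<comment> \<open>Inserting the expression of \<open>a\<close> by the other first factors into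
        the tensor of \<open>a\<close> and \<open>b\<close> distributes multiples of
        \<open>b\<close> over the remaining second factors, which saves one term.\<close>
      define f :: "'a \<times> 'b \<Rightarrow> 'a \<times> 'b" where "f = (\<lambda>(a', b'). (a', b' \<oplus>\<^bsub>B\<^esub> c b' \<odot>\<^bsub>B\<^esub> b))"
      have comb_closed: "comb zs \<in> carrier A" if "set zs \<subseteq> carrier A \<times> carrier B" for zs
        using that by (induction zs) (auto simp: comb_simps)
      have ev_comb: "evA (comb zs) s = (\<Sum>(a', b')\<leftarrow>zs. c b' * evA a' s)"
        if "set zs \<subseteq> carrier A \<times> carrier B" "s \<in> S" for zs s
        using that(1)
      proof (induction zs)
        case Nil
        then show ?case
          using linear_zero[OF A.is_assoc_algebra scalars_algebra linA[OF that(2)]] by (simp add: comb_simps)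
      next
        case (Cons z zs)
        then show ?case
          using linear_add[OF linA[OF that(2)]] linear_smult[OF linA[OF that(2)]]
          by (cases z) (simp add: comb_simps comb_closed)
      qed
      have "a = comb ys"
      proof -
        have "evA (a \<ominus>\<^bsub>A\<^esub> comb ys) s = 0" if "s \<in> S" for s
        proof -
          have "evA a s * evB b s0 + (\<Sum>(a', b')\<leftarrow>ys. evA a' s * evB b' s0) = 0"
            using Suc.prems(2)[OF that s0(1)] xs by simp
          moreover have "(\<Sum>(a', b')\<leftarrow>ys. evA a' s * evB b' s0) = - (\<Sum>(a', b')\<leftarrow>ys. c b' * evA a' s) * evB b s0"
            using s0(2) by (induction ys) (auto simp: c_def field_simps)
          ultimately have "(evA a s - evA (comb ys) s) * evB b s0 = 0"
            using ev_comb[OF xs(5) that] by (simp add: algebra_simps)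
          moreover have "evA (a \<ominus>\<^bsub>A\<^esub> comb ys) s = evA a s + (- 1) * evA (comb ys) s"
            using linear_add[OF linA[OF that], of a "\<ominus>\<^bsub>A\<^esub> comb ys"]
              linear_smult[OF linA[OF that], of "comb ys" "-1"] xs comb_closed[OF xs(5)]
            by (simp add: a_minus_def A.smult_minus_1)
          ultimately show ?thesis
            using s0(2) by simp
        qed
        then have "a \<ominus>\<^bsub>A\<^esub> comb ys = \<zero>\<^bsub>A\<^esub>"
          using xs comb_closed[OF xs(5)] by (intro sepA) auto
        then show ?thesis
          using xs comb_closed[OF xs(5)] by (simp add: A.r_right_minus_eq)
      qed
      moreover have "tsum (map f zs) = pt (comb zs) b \<oplus>\<^bsub>T\<^esub> tsum zs" if "set zs \<subseteq> carrier A \<times> carrier B" for zs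
        using that
      proof (induction zs)
        case (Cons z zs)
        obtain a' b' where z: "z = (a', b')" "a' \<in> carrier A" "b' \<in> carrier B"
          using Cons.prems by auto
        then have "tsum (map f (z # zs)) = (pt a' b' \<oplus>\<^bsub>T\<^esub> c b' \<odot>\<^bsub>T\<^esub> pt a' b) \<oplus>\<^bsub>T\<^esub> (pt (comb zs) b \<oplus>\<^bsub>T\<^esub> tsum zs)"
          using Cons xs by (simp add: f_def pt_add_right pt_smult_right)
        moreover have "comb zs \<in> carrier A" "tsum zs \<in> carrier T"
          using Cons comb_closed tsum_closed by auto
        ultimately show ?case
          using z xs Cons
          by (simp add: comb_simps pt_add_left pt_smult_left T.a_ac)
      qed (use xs in \<open>simp add: comb_simps pt_zero\<close>)
      moreover have "tsum (map f ys) = \<zero>\<^bsub>T\<^esub>"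
      proof (rule Suc.hyps(1))
        show "n = length (map f ys)"
          using xs by simp
        show "set (map f ys) \<subseteq> carrier A \<times> carrier B"
          using xs by (auto simp: f_def)
        fix s s' assume s: "s \<in> S" "s' \<in> S'"
        have "(\<Sum>(a', b')\<leftarrow>map f zs. evA a' s * evB b' s') =
          (\<Sum>(a', b')\<leftarrow>zs. evA a' s * evB b' s') + evA (comb zs) s * evB b s'"
          if "set zs \<subseteq> carrier A \<times> carrier B" for zs
          using that
        proof (induction zs)
          case Nil
          then show ?case
            using ev_comb[of "[]", OF _ s(1)] by simp
        next
          case (Cons z zs)
          then show ?case
            using xs linear_add[OF linB[OF s(2)]] linear_smult[OF linB[OF s(2)]]
              ev_comb[OF _ s(1)]
            by (cases z) (simp add: f_def algebra_simps)
        qed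
        then show "(\<Sum>(a', b')\<leftarrow>map f ys. evA a' s * evB b' s') = 0"
          using Suc.prems(2)[OF s] xs \<open>a = comb ys\<close> by (simp add: algebra_simps)
      qed
      ultimately show ?thesis
        using xs by simp
    qed
  qed simp
  moreover obtain xs where "set xs \<subseteq> carrier A \<times> carrier B" "t = tsum xs"
    using tensor_eq_tsum[OF t] by blast
  ultimately show ?thesis
    using vanish lift_tsum by metis
qed

end

section \<open>Hopf algebras\<close>

context hopf_algebra
begin

sublocale HHH: algebra_triple H H H ..

text \<open>Sweedler notation: \<open>sw U \<beta> h\<close> is the sum of the
  \<open>\<beta> h\<^sub>1 h\<^sub>2\<close>, with values in \<open>U\<close>.\<close>

abbreviation sw :: "('k, 'u, 'n) module_scheme \<Rightarrow> ('a \<Rightarrow> 'a \<Rightarrow> 'u) \<Rightarrow> 'a \<Rightarrow> 'u"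
  where "sw U \<beta> h \<equiv> tensor_lift U \<beta> (comult H h)"

lemma comult_linear: "comult H \<in> linear_maps H (tensor H H)"
  by (rule algebra_hom_linear[OF comult_hom])

lemma counit_linear: "counit H \<in> linear_maps H scalars"
  by (rule algebra_hom_linear[OF counit_hom])

lemma comult_closed [simp, intro]: "h \<in> carrier H \<Longrightarrow> comult H h \<in> carrier (tensor H H)"
  by (rule linear_closed[OF comult_linear])

lemma antipode_closed [simp, intro]: "h \<in> carrier H \<Longrightarrow> antipode H h \<in> carrier H"
  by (rule linear_closed[OF antipode_linear])

lemma sw_linear:
  assumes "assoc_algebra U" "\<beta> \<in> bilinear_maps H H U"
  shows "sw U \<beta> \<in> linear_maps H U"
  by (rule linear_comp[OF comult_linear HHH.AB.tensor_lift_linear[OF assms]])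

lemma sw_mult:
  assumes "assoc_algebra U" "\<beta> \<in> bilinear_maps H H U" "g \<in> carrier H" "h \<in> carrier H"
  shows "sw U \<beta> (g \<otimes> h) = sw U (\<lambda>a b. sw U (\<lambda>a' b'. \<beta> (a \<otimes> a') (b \<otimes> b')) h) g"
  using assms(3,4) HHH.AB.tensor_lift_mult[OF assms(1,2)] by (simp add: algebra_hom_mult[OF comult_hom])

lemma sw_cong:
  assumes "assoc_algebra U" "\<beta> \<in> bilinear_maps H H U" "h \<in> carrier H"
    and "\<And>a b. a \<in> carrier H \<Longrightarrow> b \<in> carrier H \<Longrightarrow> \<beta> a b = \<beta>' a b"
  shows "sw U \<beta> h = sw U \<beta>' h"
  using assms by (intro HHH.AB.tensor_lift_cong) auto

text \<open>Coassociativity in the form used for computation: a trilinear expression in three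
  Sweedler components does not depend on which component was split.\<close>

lemma sw_assoc:
  assumes U: "assoc_algebra U" and h: "h \<in> carrier H"
    and \<tau>: "\<And>b c. b \<in> carrier H \<Longrightarrow> c \<in> carrier H \<Longrightarrow> (\<lambda>a. \<tau> a b c) \<in> linear_maps H U"
     "\<And>a c. a \<in> carrier H \<Longrightarrow> c \<in> carrier H \<Longrightarrow> (\<lambda>b. \<tau> a b c) \<in> linear_maps H U"
     "\<And>a b. a \<in> carrier H \<Longrightarrow> b \<in> carrier H \<Longrightarrow> (\<lambda>c. \<tau> a b c) \<in> linear_maps H U"
  shows "sw U (\<lambda>a b. sw U (\<lambda>b1 b2. \<tau> a b1 b2) b) h = sw U (\<lambda>a b. sw U (\<lambda>a1 a2. \<tau> a1 a2 b) a) h"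
proof -
  interpret M1: algebra_pair_maps H H "tensor H H" H "comult H" id
    by unfold_locales (simp_all add: comult_linear linear_id)
  interpret M2: algebra_pair_maps H H H "tensor H H" id "comult H"
    by unfold_locales (simp_all add: comult_linear linear_id)
  note right = HHH.trilinear_lift_right[where \<tau> = \<tau>, OF U \<tau>]
  note left = HHH.trilinear_lift_left[where \<tau> = \<tau>, OF U \<tau>]
  have "sw U (\<lambda>a b. sw U (\<lambda>b1 b2. \<tau> a b1 b2) b) h =
    tensor_lift U (\<lambda>a t. tensor_lift U (\<lambda>b1 b2. \<tau> a b1 b2) t) (tensor_map H (tensor H H) id (comult H) (comult H h))"
    using h by (subst M2.tensor_lift_map[OF U right]) simp_all
  also have "\<dots> = tensor_lift U (\<lambda>t c. tensor_lift U (\<lambda>a b. \<tau> a b c) t) (tensor_map (tensor H H) H (comult H) id (comult H h))"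
    using h by (simp flip: coassoc add: HHH.tensor_lift_assoc[where \<tau> = \<tau>, OF U \<tau>] M1.tensor_map_closed)
  also have "\<dots> = sw U (\<lambda>a b. sw U (\<lambda>a1 a2. \<tau> a1 a2 b) a) h"
    using h by (subst M1.tensor_lift_map[OF U left]) simp_all
  finally show ?thesis .
qed

lemma sw_post:
  assumes "assoc_algebra U" "assoc_algebra V" "\<beta> \<in> bilinear_maps H H U" "g \<in> linear_maps U V" "h \<in> carrier H"
  shows "g (sw U \<beta> h) = sw V (\<lambda>a b. g (\<beta> a b)) h"
  using assms by (intro HHH.AB.tensor_lift_post) auto

lemma sw_param:
  assumes "assoc_algebra U" "assoc_algebra P" "h \<in> carrier H"
    and "\<And>p. p \<in> carrier P \<Longrightarrow> \<beta> p \<in> bilinear_maps H H U"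
    and "\<And>a b. a \<in> carrier H \<Longrightarrow> b \<in> carrier H \<Longrightarrow> (\<lambda>p. \<beta> p a b) \<in> linear_maps P U"
  shows "(\<lambda>p. sw U (\<beta> p) h) \<in> linear_maps P U"
  using assms by (intro HHH.AB.tensor_lift_param) auto

lemma sw_counit_left:
  assumes "assoc_algebra U" "f \<in> linear_maps H U" "h \<in> carrier H"
  shows "sw U (\<lambda>a b. counit H a \<odot>\<^bsub>U\<^esub> f b) h = f h"
proof -
  have bil: "(\<lambda>a b. counit H a \<odot> b) \<in> bilinear_maps H H H"
    by (intro bilinear_scalar_smult counit_linear linear_id)
  have "f h = f (sw H (\<lambda>a b. counit H a \<odot> b) h)"
    using assms by (simp add: counit_left)
  also have "\<dots> = sw U (\<lambda>a b. f (counit H a \<odot> b)) h"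
    using assms bil by (intro sw_post is_assoc_algebra)
  also have "\<dots> = sw U (\<lambda>a b. counit H a \<odot>\<^bsub>U\<^esub> f b) h"
    using assms bil by (intro sw_cong) (auto simp: linear_smult intro: bilinear_post)
  finally show ?thesis by simp
qed

lemma sw_counit_right:
  assumes "assoc_algebra U" "f \<in> linear_maps H U" "h \<in> carrier H"
  shows "sw U (\<lambda>a b. counit H b \<odot>\<^bsub>U\<^esub> f a) h = f h"
proof -
  have bil: "(\<lambda>a b. counit H b \<odot> a) \<in> bilinear_maps H H H"
    by (intro bilinear_scalar_smult counit_linear linear_id)
  have "f h = f (sw H (\<lambda>a b. counit H b \<odot> a) h)"
    using assms by (simp add: counit_right)
  also have "\<dots> = sw U (\<lambda>a b. f (counit H b \<odot> a)) h"
    using assms bil by (intro sw_post is_assoc_algebra)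
  also have "\<dots> = sw U (\<lambda>a b. counit H b \<odot>\<^bsub>U\<^esub> f a) h"
    using assms bil by (intro sw_cong) (auto simp: linear_smult intro: bilinear_post)
  finally show ?thesis by simp
qed

text \<open>In the convolution algebra the antipode \<open>s\<close> is a left inverse of the
  identity and \<open>S\<close> a right inverse, so they agree:
  \<open>s = s * (id * S) = (s * id) * S = S\<close>, with \<open>*\<close> denoting
  convolution.\<close>

lemma antipode_unique:
  assumes S: "S \<in> linear_maps H H"
    and right: "\<And>h. h \<in> carrier H \<Longrightarrow> sw H (\<lambda>a b. a \<otimes> S b) h = counit H h \<odot> \<one>"
    and h: "h \<in> carrier H"
  shows "S h = antipode H h"
proof -
  let ?s = "antipode H" and ?\<epsilon> = "counit H"
  note lin = antipode_linear S linear_id is_assoc_algebra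
  have bil1: "(\<lambda>a b. a \<otimes> S b) \<in> bilinear_maps H H H"
    by (rule bilinear_comp[OF bilinear_mult linear_id(1) S])
  have bil2: "(\<lambda>a b. ?s a \<otimes> b) \<in> bilinear_maps H H H"
    by (rule bilinear_comp[OF bilinear_mult antipode_linear linear_id(1)])
  have "?s h = sw H (\<lambda>a b. ?\<epsilon> b \<odot> ?s a) h"
    using h by (simp add: sw_counit_right lin)
  also have "\<dots> = sw H (\<lambda>a b. sw H (\<lambda>b1 b2. ?s a \<otimes> (b1 \<otimes> S b2)) b) h"
  proof (rule sw_cong[OF is_assoc_algebra _ h])
    show "(\<lambda>a b. ?\<epsilon> b \<odot> ?s a) \<in> bilinear_maps H H H"
      by (intro bilinear_scalar_smult counit_linear lin)
    fix a b assume ab: "a \<in> carrier H" "b \<in> carrier H"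
    have "?\<epsilon> b \<odot> ?s a = ?s a \<otimes> sw H (\<lambda>a b. a \<otimes> S b) b"
      using ab by (simp add: right smult_mult_right)
    also have "\<dots> = sw H (\<lambda>b1 b2. ?s a \<otimes> (b1 \<otimes> S b2)) b"
      using ab by (intro sw_post lin bil1 linear_maps_mult_left) simp_all
    finally show "?\<epsilon> b \<odot> ?s a = sw H (\<lambda>b1 b2. ?s a \<otimes> (b1 \<otimes> S b2)) b" .
  qed
  also have "\<dots> = sw H (\<lambda>a b. sw H (\<lambda>a1 a2. ?s a1 \<otimes> (a2 \<otimes> S b)) a) h"
  proof (rule sw_assoc[OF is_assoc_algebra h])
    fix a b assume ab: "a \<in> carrier H" "b \<in> carrier H"
    show "(\<lambda>x. ?s x \<otimes> (a \<otimes> S b)) \<in> linear_maps H H"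
      using ab by (intro linear_comp[OF antipode_linear linear_maps_mult_right]) (simp add: linear_closed[OF S])
    show "(\<lambda>x. ?s a \<otimes> (x \<otimes> S b)) \<in> linear_maps H H"
      using ab by (intro linear_comp[OF linear_maps_mult_right linear_maps_mult_left]) (simp_all add: linear_closed[OF S])
    show "(\<lambda>x. ?s a \<otimes> (b \<otimes> S x)) \<in> linear_maps H H"
      using ab by (intro linear_comp[OF S linear_comp[OF linear_maps_mult_left linear_maps_mult_left]]) simp_all
  qed
  also have "\<dots> = sw H (\<lambda>a b. ?\<epsilon> a \<odot> S b) h"
  proof (rule sw_cong[OF is_assoc_algebra _ h, symmetric])
    show "(\<lambda>a b. ?\<epsilon> a \<odot> S b) \<in> bilinear_maps H H H"
      by (intro bilinear_scalar_smult counit_linear lin)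
    fix a b assume ab: "a \<in> carrier H" "b \<in> carrier H"
    then have Sb: "S b \<in> carrier H"
      by (simp add: linear_closed[OF S])
    have "?\<epsilon> a \<odot> S b = sw H (\<lambda>a1 a2. ?s a1 \<otimes> a2) a \<otimes> S b"
      using ab Sb by (simp add: antipode_left smult_mult_left)
    also have "\<dots> = sw H (\<lambda>a1 a2. (?s a1 \<otimes> a2) \<otimes> S b) a"
      using ab Sb by (intro sw_post[where g = "\<lambda>x. x \<otimes> S b"] lin bil2 linear_maps_mult_right) simp_all
    also have "\<dots> = sw H (\<lambda>a1 a2. ?s a1 \<otimes> (a2 \<otimes> S b)) a"
      using ab Sb by (intro sw_cong is_assoc_algebra bilinear_post[OF bil2 linear_maps_mult_right[OF Sb]]) (simp_all add: m_assoc)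
    finally show "?\<epsilon> a \<odot> S b = sw H (\<lambda>a1 a2. ?s a1 \<otimes> (a2 \<otimes> S b)) a" .
  qed
  also have "\<dots> = S h"
    using h by (simp add: sw_counit_left lin)
  finally show ?thesis by simp
qed

end

section \<open>Transport of structure\<close>

lemma tensor_map_comp:
  assumes "algebra_pair_maps A B C D f g" "algebra_pair_maps C D E F f' g'" "t \<in> carrier (tensor A B)"
  shows "tensor_map E F f' g' (tensor_map C D f g t) = tensor_map E F (\<lambda>x. f' (f x)) (\<lambda>x. g' (g x)) t"
proof -
  interpret X: algebra_pair_maps A B C D f g by fact
  interpret Y: algebra_pair_maps C D E F f' g' by fact
  show ?thesis
    using X.tensor_lift_map[OF Y.CD.tensor_assoc_algebra Y.map_bilinear assms(3)]
    by (simp add: tensor_map_def)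
qed

lemma tensor_map_cong:
  assumes "algebra_pair_maps A B C D f g" "t \<in> carrier (tensor A B)"
    and "\<And>a. a \<in> carrier A \<Longrightarrow> f a = f' a" "\<And>b. b \<in> carrier B \<Longrightarrow> g b = g' b"
  shows "tensor_map C D f g t = tensor_map C D f' g' t"
proof -
  interpret X: algebra_pair_maps A B C D f g by fact
  show ?thesis
    unfolding tensor_map_def using assms(2-)
    by (intro X.AB.tensor_lift_cong[OF X.CD.tensor_assoc_algebra X.map_bilinear]) auto
qed

lemma tensor_map_id:
  assumes "assoc_algebra A" "assoc_algebra B" "t \<in> carrier (tensor A B)"
  shows "tensor_map A B (\<lambda>x. x) (\<lambda>x. x) t = t"
proof -
  interpret algebra_pair A B by (intro algebra_pair.intro assms)
  show ?thesis
    unfolding tensor_map_def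
    by (rule tensor_lift_eqI[OF tensor_assoc_algebra linear_id(1) pt_bilinear assms(3), symmetric]) simp
qed

lemma algebra_hom_cong:
  assumes "f \<in> algebra_homs A B" "\<And>x. x \<in> carrier A \<Longrightarrow> f x = g x" "assoc_algebra A"
  shows "g \<in> algebra_homs A B"
proof -
  interpret A: assoc_algebra A by fact
  show ?thesis
    using assms(1)
    by (intro algebra_homsI linear_cong[OF algebra_hom_linear[OF assms(1)] assms(2,3)])
      (simp_all add: algebra_hom_mult algebra_hom_one flip: assms(2))
qed

text \<open>Naturality of the associator, which carries coassociativity across \<open>\<psi>\<close>
  in the transport theorem.\<close>

lemma tensor_assoc_natural:
  assumes A: "assoc_algebra A" and B: "assoc_algebra B" and f: "f \<in> linear_maps A B"
    and t: "t \<in> carrier (tensor (tensor A A) A)"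
  shows "tensor_assoc B B B (tensor_map (tensor B B) B (tensor_map B B f f) f t) =
    tensor_map B (tensor B B) f (tensor_map B B f f) (tensor_assoc A A A t)"
proof -
  interpret A: algebra_triple A A A by (intro algebra_triple.intro A)
  interpret B: algebra_triple B B B by (intro algebra_triple.intro B)
  interpret F: algebra_pair_maps A A B B f f by unfold_locales (rule f)+
  interpret F1: algebra_pair_maps "tensor A A" A "tensor B B" B "tensor_map B B f f" f
    by unfold_locales (simp_all add: f F.tensor_map_linear)
  interpret F2: algebra_pair_maps A "tensor A A" B "tensor B B" f "tensor_map B B f f"
    by unfold_locales (simp_all add: f F.tensor_map_linear)
  show ?thesis
    by (rule A.tensor3_linear_eq[OF t linear_comp[OF F1.tensor_map_linear B.tensor_assoc_linear]
        linear_comp[OF A.tensor_assoc_linear F2.tensor_map_linear]])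
      (simp add: F1.tensor_map_pure F2.tensor_map_pure F.tensor_map_pure A.tensor_assoc_pure B.tensor_assoc_pure linear_closed[OF f])
qed

text \<open>The Hopf axioms of \<open>D\<close> are consequences, not premises: each is the image
  under \<open>\<psi>\<close> of the axiom of \<open>K\<close>. For the dual this avoids reasoning
  about its comultiplication beyond its values on the image of \<open>\<psi>\<close>. Since the
  isomorphism is wanted from \<open>D\<close> to \<open>K\<close>, the inverse
  \<open>\<iota>\<close> is shown to be a Hopf map.\<close>

theorem hopf_isomorphic_transport:
  fixes K :: "('k::field, 'a, 'm) hopf_scheme" and D :: "('k, 'd, 'n) hopf_scheme"
  assumes K: "hopf_algebra K" and D: "assoc_algebra D"
    and \<psi>: "\<psi> \<in> algebra_homs K D" and bij: "bij_betw \<psi> (carrier K) (carrier D)"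
    and comult: "\<And>k. k \<in> carrier K \<Longrightarrow> comult D (\<psi> k) = tensor_map D D \<psi> \<psi> (comult K k)"
    and counit: "\<And>k. k \<in> carrier K \<Longrightarrow> counit D (\<psi> k) = counit K k"
    and antipode: "\<And>k. k \<in> carrier K \<Longrightarrow> antipode D (\<psi> k) = \<psi> (antipode K k)"
  shows "hopf_isomorphic D K"
proof -
  interpret K: hopf_algebra K by fact
  interpret D: assoc_algebra D by fact
  interpret D3: algebra_triple D D D ..
  note lin = algebra_hom_linear[OF \<psi>]
  interpret P: algebra_pair_maps K K D D \<psi> \<psi> by unfold_locales (rule lin)+
  define \<iota> where "\<iota> = inv_into (carrier K) \<psi>"
  have \<iota>_closed: "\<iota> d \<in> carrier K" and \<psi>_\<iota>: "\<psi> (\<iota> d) = d" if "d \<in> carrier D" for d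
    using bij that by (simp_all add: \<iota>_def bij_betw_def inv_into_into f_inv_into_f)
  have \<iota>_\<psi>: "\<iota> (\<psi> k) = k" if "k \<in> carrier K" for k
    using bij that by (simp add: \<iota>_def bij_betw_def)
  have ex: "\<exists>k\<in>carrier K. d = \<psi> k" if "d \<in> carrier D" for d
    using that \<iota>_closed \<psi>_\<iota> by metis
  have \<psi>_closed: "\<psi> k \<in> carrier D" if "k \<in> carrier K" for k
    using that by (rule linear_closed[OF lin])
  have \<iota>: "\<iota> \<in> algebra_homs D K"
  proof (intro algebra_homsI linear_mapsI)
    fix d e c assume de: "d \<in> carrier D" "e \<in> carrier D"
    obtain k l where k: "k \<in> carrier K" "d = \<psi> k" and l: "l \<in> carrier K" "e = \<psi> l"
      using de ex by meson
    show "\<iota> (d \<oplus>\<^bsub>D\<^esub> e) = \<iota> d \<oplus>\<^bsub>K\<^esub> \<iota> e" "\<iota> (d \<otimes>\<^bsub>D\<^esub> e) = \<iota> d \<otimes>\<^bsub>K\<^esub> \<iota> e"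
      using k l by (simp_all add: \<iota>_\<psi> flip: algebra_hom_add[OF \<psi>] algebra_hom_mult[OF \<psi>])
  next
    fix c d assume "d \<in> carrier D"
    then obtain k where "k \<in> carrier K" "d = \<psi> k"
      using ex by meson
    then show "\<iota> (c \<odot>\<^bsub>D\<^esub> d) = c \<odot>\<^bsub>K\<^esub> \<iota> d"
      by (simp add: \<iota>_\<psi> flip: algebra_hom_smult[OF \<psi>])
  next
    show "\<iota> \<one>\<^bsub>D\<^esub> = \<one>\<^bsub>K\<^esub>"
      using \<iota>_\<psi>[of "\<one>\<^bsub>K\<^esub>"] by (simp add: algebra_hom_one[OF \<psi>])
  qed (rule \<iota>_closed)
  note \<iota>_lin = algebra_hom_linear[OF \<iota>]
  interpret Q: algebra_pair_maps D D K K \<iota> \<iota> by unfold_locales (rule \<iota>_lin)+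
  let ?\<Psi> = "tensor_map D D \<psi> \<psi>"
  \<comment> \<open>On the carrier \<open>comult D\<close> is the composition of
    \<open>\<iota>\<close>, the comultiplication of \<open>K\<close> and \<open>\<psi>\<close> on
    both tensor factors, all of them homomorphisms. The counit and the antipode are treated
    likewise.\<close>
  have comult_hom: "comult D \<in> algebra_homs D (tensor D D)"
    by (rule algebra_hom_cong[OF algebra_hom_comp[OF \<iota> algebra_hom_comp[OF K.comult_hom P.tensor_map_hom[OF \<psi> \<psi>]]] _ D])
      (simp flip: comult add: \<iota>_closed \<psi>_\<iota>)
  have counit_hom: "counit D \<in> algebra_homs D scalars"
    by (rule algebra_hom_cong[OF algebra_hom_comp[OF \<iota> K.counit_hom] _ D])
      (simp flip: counit add: \<iota>_closed \<psi>_\<iota>)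
  have antipode_linear: "antipode D \<in> linear_maps D D"
    by (rule linear_cong[OF linear_comp[OF \<iota>_lin linear_comp[OF K.antipode_linear lin]] _ D])
      (simp flip: antipode add: \<iota>_closed \<psi>_\<iota>)
  note counit_lin = algebra_hom_linear[OF counit_hom]
  have hopf: "hopf_algebra D"
  proof (intro hopf_algebra.intro hopf_algebra_axioms.intro D comult_hom counit_hom antipode_linear)
    fix d assume "d \<in> carrier D"
    then obtain k where k: "k \<in> carrier K" "d = \<psi> k"
      using ex by meson
    let ?t = "comult K k"
    have t: "?t \<in> carrier (tensor K K)"
      using k by simp
    have d: "comult D d = ?\<Psi> ?t"
      using k comult by simp
    show "tensor_lift D (\<lambda>a b. counit D a \<odot>\<^bsub>D\<^esub> b) (comult D d) = d"
    proof -
      have "tensor_lift D (\<lambda>a b. counit D a \<odot>\<^bsub>D\<^esub> b) (comult D d) =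
          tensor_lift D (\<lambda>a b. counit D (\<psi> a) \<odot>\<^bsub>D\<^esub> \<psi> b) ?t"
        unfolding d by (rule P.tensor_lift_map[OF D D.bilinear_scalar_smult(1)[OF counit_lin linear_id(1)] t])
      also have "\<dots> = tensor_lift D (\<lambda>a b. counit K a \<odot>\<^bsub>D\<^esub> \<psi> b) ?t"
        using counit by (intro K.sw_cong[OF D D.bilinear_scalar_smult(1)[OF linear_comp[OF lin counit_lin] lin] k(1)]) simp
      finally show ?thesis
        using K.sw_counit_left[OF D lin k(1)] k(2) by simp
    qed
    show "tensor_lift D (\<lambda>a b. counit D b \<odot>\<^bsub>D\<^esub> a) (comult D d) = d"
    proof -
      have "tensor_lift D (\<lambda>a b. counit D b \<odot>\<^bsub>D\<^esub> a) (comult D d) =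
          tensor_lift D (\<lambda>a b. counit D (\<psi> b) \<odot>\<^bsub>D\<^esub> \<psi> a) ?t"
        unfolding d by (rule P.tensor_lift_map[OF D D.bilinear_scalar_smult(2)[OF counit_lin linear_id(1)] t])
      also have "\<dots> = tensor_lift D (\<lambda>a b. counit K b \<odot>\<^bsub>D\<^esub> \<psi> a) ?t"
        using counit by (intro K.sw_cong[OF D D.bilinear_scalar_smult(2)[OF linear_comp[OF lin counit_lin] lin] k(1)]) simp
      finally show ?thesis
        using K.sw_counit_right[OF D lin k(1)] k(2) by simp
    qed
    have unit: "\<psi> (counit K k \<odot>\<^bsub>K\<^esub> \<one>\<^bsub>K\<^esub>) = counit D d \<odot>\<^bsub>D\<^esub> \<one>\<^bsub>D\<^esub>"
      using k counit by (simp add: algebra_hom_smult[OF \<psi>] algebra_hom_one[OF \<psi>])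
    show "tensor_lift D (\<lambda>a b. antipode D a \<otimes>\<^bsub>D\<^esub> b) (comult D d) = counit D d \<odot>\<^bsub>D\<^esub> \<one>\<^bsub>D\<^esub>"
    proof -
      have "tensor_lift D (\<lambda>a b. antipode D a \<otimes>\<^bsub>D\<^esub> b) (comult D d) =
          tensor_lift D (\<lambda>a b. antipode D (\<psi> a) \<otimes>\<^bsub>D\<^esub> \<psi> b) ?t"
        unfolding d by (rule P.tensor_lift_map[OF D bilinear_comp[OF D.bilinear_mult antipode_linear linear_id(1)] t])
      also have "\<dots> = tensor_lift D (\<lambda>a b. \<psi> (antipode K a \<otimes>\<^bsub>K\<^esub> b)) ?t"
        by (intro K.sw_cong[OF D bilinear_comp[OF D.bilinear_mult linear_comp[OF lin antipode_linear] lin] k(1)])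
          (simp add: antipode algebra_hom_mult[OF \<psi>])
      also have "\<dots> = \<psi> (tensor_lift K (\<lambda>a b. antipode K a \<otimes>\<^bsub>K\<^esub> b) ?t)"
        by (rule K.sw_post[OF K.is_assoc_algebra D bilinear_comp[OF K.bilinear_mult K.antipode_linear linear_id(1)] lin k(1), symmetric])
      finally show ?thesis
        using K.antipode_left[OF k(1)] unit by simp
    qed
    show "tensor_lift D (\<lambda>a b. a \<otimes>\<^bsub>D\<^esub> antipode D b) (comult D d) = counit D d \<odot>\<^bsub>D\<^esub> \<one>\<^bsub>D\<^esub>"
    proof -
      have "tensor_lift D (\<lambda>a b. a \<otimes>\<^bsub>D\<^esub> antipode D b) (comult D d) =
          tensor_lift D (\<lambda>a b. \<psi> a \<otimes>\<^bsub>D\<^esub> antipode D (\<psi> b)) ?t"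
        unfolding d by (rule P.tensor_lift_map[OF D bilinear_comp[OF D.bilinear_mult linear_id(1) antipode_linear] t])
      also have "\<dots> = tensor_lift D (\<lambda>a b. \<psi> (a \<otimes>\<^bsub>K\<^esub> antipode K b)) ?t"
        by (intro K.sw_cong[OF D bilinear_comp[OF D.bilinear_mult lin linear_comp[OF lin antipode_linear]] k(1)])
          (simp add: antipode algebra_hom_mult[OF \<psi>])
      also have "\<dots> = \<psi> (tensor_lift K (\<lambda>a b. a \<otimes>\<^bsub>K\<^esub> antipode K b) ?t)"
        by (rule K.sw_post[OF K.is_assoc_algebra D bilinear_comp[OF K.bilinear_mult linear_id(1) K.antipode_linear] lin k(1), symmetric])
      finally show ?thesis
        using K.antipode_right[OF k(1)] unit by simp
    qed
    note comult_lin = algebra_hom_linear[OF comult_hom]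
    interpret F1: algebra_pair_maps D D "tensor D D" D "comult D" id
      by unfold_locales (simp_all add: comult_lin linear_id)
    interpret F2: algebra_pair_maps D D D "tensor D D" id "comult D"
      by unfold_locales (simp_all add: comult_lin linear_id)
    interpret G1: algebra_pair_maps K K "tensor K K" K "comult K" id
      by unfold_locales (simp_all add: K.comult_linear linear_id)
    interpret G2: algebra_pair_maps K K K "tensor K K" id "comult K"
      by unfold_locales (simp_all add: K.comult_linear linear_id)
    interpret L1: algebra_pair_maps "tensor K K" K "tensor D D" D ?\<Psi> \<psi>
      by unfold_locales (simp_all add: P.tensor_map_linear lin)
    interpret L2: algebra_pair_maps K "tensor K K" D "tensor D D" \<psi> ?\<Psi>
      by unfold_locales (simp_all add: P.tensor_map_linear lin)
    interpret M1: algebra_pair_maps K K "tensor D D" D "\<lambda>x. ?\<Psi> (comult K x)" \<psi>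
      by unfold_locales (simp_all add: lin linear_comp[OF K.comult_linear P.tensor_map_linear])
    interpret M2: algebra_pair_maps K K D "tensor D D" \<psi> "\<lambda>x. ?\<Psi> (comult K x)"
      by unfold_locales (simp_all add: lin linear_comp[OF K.comult_linear P.tensor_map_linear])
    \<comment> \<open>Each side of coassociativity at \<open>\<psi> k\<close> is rewritten as the
      image of the corresponding side at \<open>k\<close> under \<open>\<psi>\<close> on all three
      factors. Naturality of the associator joins the two computations.\<close>
    have "tensor_map (tensor D D) D (comult D) id (comult D d) =
        tensor_map (tensor D D) D (\<lambda>x. comult D (\<psi> x)) \<psi> ?t"
      unfolding d using tensor_map_comp[OF P.algebra_pair_maps_axioms F1.algebra_pair_maps_axioms t] by simp
    also have "\<dots> = tensor_map (tensor D D) D (\<lambda>x. ?\<Psi> (comult K x)) \<psi> ?t"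
      by (rule tensor_map_cong[OF M1.algebra_pair_maps_axioms t, symmetric]) (simp_all add: comult)
    also have "\<dots> = tensor_map (tensor D D) D ?\<Psi> \<psi> (tensor_map (tensor K K) K (comult K) id ?t)"
      using tensor_map_comp[OF G1.algebra_pair_maps_axioms L1.algebra_pair_maps_axioms t] by simp
    finally have left: "tensor_assoc D D D (tensor_map (tensor D D) D (comult D) id (comult D d)) =
        tensor_map D (tensor D D) \<psi> ?\<Psi> (tensor_map K (tensor K K) id (comult K) ?t)"
      using tensor_assoc_natural[OF K.is_assoc_algebra D lin G1.tensor_map_closed[OF t]] k
      by (simp add: K.coassoc)
    have "tensor_map D (tensor D D) id (comult D) (comult D d) =
        tensor_map D (tensor D D) \<psi> (\<lambda>x. comult D (\<psi> x)) ?t"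
      unfolding d using tensor_map_comp[OF P.algebra_pair_maps_axioms F2.algebra_pair_maps_axioms t] by simp
    also have "\<dots> = tensor_map D (tensor D D) \<psi> (\<lambda>x. ?\<Psi> (comult K x)) ?t"
      by (rule tensor_map_cong[OF M2.algebra_pair_maps_axioms t, symmetric]) (simp_all add: comult)
    also have "\<dots> = tensor_map D (tensor D D) \<psi> ?\<Psi> (tensor_map K (tensor K K) id (comult K) ?t)"
      using tensor_map_comp[OF G2.algebra_pair_maps_axioms L2.algebra_pair_maps_axioms t] by simp
    finally show "tensor_assoc D D D (tensor_map (tensor D D) D (comult D) id (comult D d)) =
        tensor_map D (tensor D D) id (comult D) (comult D d)"
      using left by simp
  qed
  moreover have "\<iota> \<in> hopf_homs D K"
    unfolding hopf_homs_def
  proof (intro CollectI conjI ballI \<iota>)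
    fix d assume "d \<in> carrier D"
    then obtain k where k: "k \<in> carrier K" "d = \<psi> k"
      using ex by meson
    show "counit K (\<iota> d) = counit D d" "antipode K (\<iota> d) = \<iota> (antipode D d)"
      using k by (simp_all add: \<iota>_\<psi> counit antipode)
    interpret I: algebra_pair_maps K K K K "\<lambda>x. x" "\<lambda>x. x"
      by unfold_locales (simp_all add: linear_id)
    have "tensor_map K K \<iota> \<iota> (comult D d) = tensor_map K K (\<lambda>x. \<iota> (\<psi> x)) (\<lambda>x. \<iota> (\<psi> x)) (comult K k)"
      using k tensor_map_comp[OF P.algebra_pair_maps_axioms Q.algebra_pair_maps_axioms K.comult_closed] by (simp add: comult)
    also have "\<dots> = tensor_map K K (\<lambda>x. x) (\<lambda>x. x) (comult K k)"
      using k by (intro tensor_map_cong[OF I.algebra_pair_maps_axioms, symmetric]) (simp_all add: \<iota>_\<psi>)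
    also have "\<dots> = comult K k"
      using k by (intro tensor_map_id K.is_assoc_algebra) simp
    finally show "comult K (\<iota> d) = tensor_map K K \<iota> \<iota> (comult D d)"
      using k by (simp add: \<iota>_\<psi>)
  qed
  moreover have "bij_betw \<iota> (carrier D) (carrier K)"
    unfolding \<iota>_def by (rule bij_betw_inv_into[OF bij])
  ultimately show ?thesis
    using K by (auto simp: hopf_isomorphic_def)
qed

section \<open>Algebras given by generators and relations\<close>

lemma free_monoid_simps [simp]:
  "carrier free_monoid = UNIV" "monoid.mult free_monoid = (@)" "one free_monoid = []"
  by (simp_all add: free_monoid_def)

lemma monoid_free_monoid: "monoid free_monoid"
  by unfold_locales auto

lemma free_algebra_simps [simp]:
  "carrier free_algebra = UNIV" "one free_algebra = Poly_Mapping.single [] 1"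
  "ring.zero free_algebra = 0" "add free_algebra = (+)" "module.smult free_algebra = fm_scale"
  by (simp_all add: free_algebra_def)

lemma free_algebra_mult_single [simp]:
  "Poly_Mapping.single u c \<otimes>\<^bsub>free_algebra\<^esub> Poly_Mapping.single w d = Poly_Mapping.single (u @ w) (c * d)"
  by (simp add: free_algebra_def)

lemma free_assoc_algebra: "assoc_algebra (free_algebra :: ('k::field, _) module)"
  unfolding free_algebra_def by (rule monoid.monoid_algebra_assoc_algebra[OF monoid_free_monoid])

lemma word_value_simps [simp]:
  "word_value B v [] = \<one>\<^bsub>B\<^esub>" "word_value B v (g # w) = v g \<otimes>\<^bsub>B\<^esub> word_value B v w"
  by (simp_all add: word_value_def)

text \<open>The defining relations read in an arbitrary algebra; under this condition on the images
  of the generators \<open>hom_by_generators\<close> is well defined on the quotient.\<close>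

definition satisfies_radford ::
    "('k::field, 'b, 'm) module_scheme \<Rightarrow> 'k \<Rightarrow> nat \<Rightarrow> nat \<Rightarrow> (generator \<Rightarrow> 'b) \<Rightarrow> bool"
  where "satisfies_radford B q N \<nu> v \<longleftrightarrow> v Gen_a \<in> carrier B \<and> v Gen_x \<in> carrier B \<and>
    v Gen_a [^]\<^bsub>B\<^esub> N = \<one>\<^bsub>B\<^esub> \<and> v Gen_x [^]\<^bsub>B\<^esub> mult_order (q ^ \<nu>) = \<zero>\<^bsub>B\<^esub> \<and>
    v Gen_x \<otimes>\<^bsub>B\<^esub> v Gen_a = q \<odot>\<^bsub>B\<^esub> (v Gen_a \<otimes>\<^bsub>B\<^esub> v Gen_x)"

context assoc_algebra
begin

context
  fixes v :: "generator \<Rightarrow> 'a" assumes v: "v Gen_a \<in> carrier A" "v Gen_x \<in> carrier A"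
begin

lemma gen_closed: "v g \<in> carrier A"
  using v by (cases g) simp_all

lemma word_value_closed: "word_value A v w \<in> carrier A"
  by (induction w) (simp_all add: gen_closed)

lemma word_value_append: "word_value A v (u @ w) = word_value A v u \<otimes> word_value A v w"
  by (induction u) (simp_all add: gen_closed word_value_closed m_assoc)

lemma word_value_replicate: "word_value A v (replicate n g) = v g [^] n"
proof (induction n)
  case (Suc n)
  have "v g \<otimes> v g [^] n = v g [^] n \<otimes> v g"
    using nat_pow_comm[of "v g" 1 n] by (simp add: gen_closed)
  then show ?case
    using Suc by simp
qed simp

lemma word_value_hom: "lin_ext A (word_value A v) \<in> algebra_homs free_algebra A"
  unfolding free_algebra_def
  by (rule lin_ext_hom[OF monoid_free_monoid]) (simp_all add: word_value_closed word_value_append)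

end

end

abbreviation gen_list :: "generator list \<Rightarrow> 'k \<Rightarrow> (generator list \<Rightarrow>\<^sub>0 'k::field)"
  where "gen_list \<equiv> Poly_Mapping.single"

section \<open>The presented algebra and its universal property\<close>

locale radford =
  fixes q :: "'k::field" and N \<nu> :: nat
begin

abbreviation R :: "('k, (generator list \<Rightarrow>\<^sub>0 'k) set) module" where "R \<equiv> radford_algebra q N \<nu>"
abbreviation I :: "(generator list \<Rightarrow>\<^sub>0 'k) set" where "I \<equiv> radford_ideal q N \<nu>"
abbreviation F :: "('k, generator list \<Rightarrow>\<^sub>0 'k) module" where "F \<equiv> free_algebra"
abbreviation a where "a \<equiv> generator_class q N \<nu> Gen_a"
abbreviation x where "x \<equiv> generator_class q N \<nu> Gen_x"
abbreviation r where "r \<equiv> mult_order (q ^ \<nu>)"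

interpretation F: assoc_algebra F by (rule free_assoc_algebra)

lemma ideal_I: "ideal I F"
  unfolding radford_ideal_def by (rule F.genideal_ideal) simp

interpretation quot: algebra_ideal I F
  by (intro algebra_ideal.intro ideal_I F.is_assoc_algebra)

lemma radford_eq: "R = quot_algebra F I"
  by (simp add: radford_algebra_def)

lemma class_eq: "generator_class q N \<nu> g = I +>\<^bsub>F\<^esub> gen_list [g] 1"
  by (simp add: generator_class_def)

lemma assoc_algebra_R: "assoc_algebra R"
  unfolding radford_eq by (rule quot.quot_assoc_algebra)

interpretation R: assoc_algebra R by (rule assoc_algebra_R)

lemma class_closed [simp, intro]: "generator_class q N \<nu> g \<in> carrier R"
  unfolding class_eq radford_eq by (rule quot.quot_coset_closed) simp

lemma coset_hom: "(+>\<^bsub>F\<^esub>) I \<in> algebra_homs F R"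
  unfolding radford_eq by (rule quot.coset_algebra_hom)

lemma coset_word: "I +>\<^bsub>F\<^esub> gen_list w 1 = word_value R (generator_class q N \<nu>) w"
proof (induction w)
  case Nil
  then show ?case using algebra_hom_one[OF coset_hom] by simp
next
  case (Cons g w)
  have "I +>\<^bsub>F\<^esub> (gen_list [g] 1 \<otimes>\<^bsub>F\<^esub> gen_list w 1) =
    (I +>\<^bsub>F\<^esub> gen_list [g] 1) \<otimes>\<^bsub>R\<^esub> (I +>\<^bsub>F\<^esub> gen_list w 1)"
    by (rule algebra_hom_mult[OF coset_hom]) simp_all
  then show ?case
    using Cons by (simp add: class_eq)
qed

text \<open>Words grow by prefixing letters, so generators need to act only from the left. This
  matches the recursion in the antipode axioms and the left translations of functionals.\<close>

lemma radford_induct [consumes 1, case_names one gen add scale]: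
  assumes "h \<in> carrier R" and one: "P \<one>\<^bsub>R\<^esub>"
    and gen: "\<And>g h. h \<in> carrier R \<Longrightarrow> P h \<Longrightarrow> P (generator_class q N \<nu> g \<otimes>\<^bsub>R\<^esub> h)"
    and add: "\<And>h h'. h \<in> carrier R \<Longrightarrow> h' \<in> carrier R \<Longrightarrow> P h \<Longrightarrow> P h' \<Longrightarrow> P (h \<oplus>\<^bsub>R\<^esub> h')"
    and scale: "\<And>c h. h \<in> carrier R \<Longrightarrow> P h \<Longrightarrow> P (c \<odot>\<^bsub>R\<^esub> h)"
  shows "P h"
proof -
  obtain p where p: "h = I +>\<^bsub>F\<^esub> p"
    using assms(1) by (auto simp: radford_eq quot.carrier_quot)
  have closed: "I +>\<^bsub>F\<^esub> p \<in> carrier R" for p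
    using algebra_hom_closed[OF coset_hom] by simp
  have word: "P (word_value R (generator_class q N \<nu>) w)" for w
    by (induction w) (simp_all add: one gen R.word_value_closed)
  have "Poly_Mapping.keys p \<subseteq> UNIV"
    by simp
  then have "P (I +>\<^bsub>F\<^esub> p)"
  proof (induction rule: fm_induct)
    case zero
    have "I +>\<^bsub>F\<^esub> 0 = 0 \<odot>\<^bsub>R\<^esub> \<one>\<^bsub>R\<^esub>"
      using linear_zero[OF F.is_assoc_algebra R.is_assoc_algebra algebra_hom_linear[OF coset_hom]] by simp
    then show ?case
      using scale[OF R.one_closed one, of 0] by simp
  next
    case (single w)
    then show ?case
      by (simp add: coset_word word)
  next
    case (add p p')
    then show ?case
      using algebra_hom_add[OF coset_hom, of p p'] closed assms(4) by simp
  next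
    case (scale c p)
    then show ?case
      using algebra_hom_smult[OF coset_hom, of p c] closed assms(5) by simp
  qed
  then show ?thesis
    using p by simp
qed

lemma radford_hom_eq:
  assumes "assoc_algebra B" "f \<in> algebra_homs R B" "g \<in> algebra_homs R B"
    and "f a = g a" "f x = g x" "h \<in> carrier R"
  shows "f h = g h"
proof -
  interpret B: assoc_algebra B by fact
  have gen: "f (generator_class q N \<nu> u) = g (generator_class q N \<nu> u)" for u
    using assms(4,5) by (cases u) simp_all
  show ?thesis
    using assms(6)
    by (induction rule: radford_induct)
      (simp_all add: gen algebra_hom_one[OF assms(2)] algebra_hom_one[OF assms(3)]
        algebra_hom_mult[OF assms(2)] algebra_hom_mult[OF assms(3)]
        algebra_hom_add[OF assms(2)] algebra_hom_add[OF assms(3)]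
        algebra_hom_smult[OF assms(2)] algebra_hom_smult[OF assms(3)])
qed

text \<open>The map on the free algebra kills the three relations. Its kernel is an ideal, hence
  contains the ideal they generate, and the map descends to cosets.\<close>

lemma hom_by_generators_hom:
  assumes B: "assoc_algebra B" and v: "satisfies_radford B q N \<nu> v"
  shows "hom_by_generators B v \<in> algebra_homs R B"
    and "hom_by_generators B v (generator_class q N \<nu> g) = v g"
proof -
  interpret B: assoc_algebra B by fact
  have v': "v Gen_a \<in> carrier B" "v Gen_x \<in> carrier B"
    using v by (simp_all add: satisfies_radford_def)
  let ?f = "lin_ext B (word_value B v)"
  note hom = B.word_value_hom[OF v']
  note closed = B.word_value_closed[OF v'] B.gen_closed[OF v']
  have single: "?f (gen_list w c) = c \<odot>\<^bsub>B\<^esub> word_value B v w" for w c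
    by (rule B.lin_ext_single) (rule closed)
  interpret ring_hom_ring F B ?f
    by (rule ring_hom_ringI2[OF F.ring_axioms B.ring_axioms algebra_hom_ring[OF hom]])
  have diff: "?f (p - p') = ?f p \<ominus>\<^bsub>B\<^esub> ?f p'" for p p'
  proof -
    have "?f (p + fm_scale (-1) p') = ?f p \<oplus>\<^bsub>B\<^esub> (-1) \<odot>\<^bsub>B\<^esub> ?f p'"
      using algebra_hom_add[OF hom, of p "fm_scale (-1) p'"] algebra_hom_smult[OF hom, of p' "-1"] by simp
    then show ?thesis
      using algebra_hom_closed[OF hom, of p'] by (simp add: B.smult_minus_1 a_minus_def)
  qed
  have "?f p = \<zero>\<^bsub>B\<^esub>" if "p \<in> radford_relations q N \<nu>" for p
    using that v closed
    by (auto simp: radford_relations_def diff single B.word_value_replicate[OF v'] satisfies_radford_def)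
  then have "radford_relations q N \<nu> \<subseteq> a_kernel F B ?f"
    unfolding a_kernel_def' by (intro subsetI CollectI conjI) simp_all
  then have "I \<subseteq> a_kernel F B ?f"
    unfolding radford_ideal_def by (rule F.genideal_minimal[OF kernel_is_ideal])
  then have vanish: "?f i = \<zero>\<^bsub>B\<^esub>" if "i \<in> I" for i
    using that unfolding a_kernel_def' by blast
  show "hom_by_generators B v \<in> algebra_homs R B"
    unfolding hom_by_generators_def radford_eq
    by (rule quot.on_cosets_hom[OF B algebra_hom_linear[OF hom] vanish hom])
  show "hom_by_generators B v (generator_class q N \<nu> g) = v g"
    unfolding hom_by_generators_def class_eq
    using quot.on_cosets_coset[OF B algebra_hom_linear[OF hom] vanish, of "gen_list [g] 1"] closed
    by (simp add: single)
qed

lemma radford_relations_hold: "satisfies_radford R q N \<nu> (generator_class q N \<nu>)"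
proof -
  have sub: "radford_relations q N \<nu> \<subseteq> I"
    unfolding radford_ideal_def by (rule F.genideal_self) simp
  have eq: "I +>\<^bsub>F\<^esub> p = I +>\<^bsub>F\<^esub> p'" if "p - p' \<in> radford_relations q N \<nu>" for p p'
  proof -
    have "p \<ominus>\<^bsub>F\<^esub> p' = p - p'"
      using F.smult_minus_1[of p'] by (simp add: a_minus_def)
    then show ?thesis
      using that sub by (subst quot.coset_eq_iff) auto
  qed
  have smult: "I +>\<^bsub>F\<^esub> gen_list w c = c \<odot>\<^bsub>R\<^esub> (I +>\<^bsub>F\<^esub> gen_list w 1)" for w c
    using algebra_hom_smult[OF coset_hom, of "gen_list w 1" c] by simp
  have "I +>\<^bsub>F\<^esub> gen_list (replicate N Gen_a) 1 = I +>\<^bsub>F\<^esub> gen_list [] 1"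
    by (rule eq) (simp add: radford_relations_def)
  moreover have "I +>\<^bsub>F\<^esub> gen_list (replicate r Gen_x) 1 = I +>\<^bsub>F\<^esub> 0"
    by (rule eq) (simp add: radford_relations_def)
  moreover have "I +>\<^bsub>F\<^esub> gen_list [Gen_x, Gen_a] 1 = I +>\<^bsub>F\<^esub> gen_list [Gen_a, Gen_x] q"
    by (rule eq) (simp add: radford_relations_def)
  moreover have "I +>\<^bsub>F\<^esub> 0 = \<zero>\<^bsub>R\<^esub>"
    using linear_zero[OF F.is_assoc_algebra R.is_assoc_algebra algebra_hom_linear[OF coset_hom]] by simp
  ultimately show ?thesis
    by (simp add: satisfies_radford_def coset_word smult[of _ q] R.word_value_replicate)
qed

lemma a_pow_N: "a [^]\<^bsub>R\<^esub> N = \<one>\<^bsub>R\<^esub>"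
  and x_pow_r: "x [^]\<^bsub>R\<^esub> r = \<zero>\<^bsub>R\<^esub>"
  and x_a: "x \<otimes>\<^bsub>R\<^esub> a = q \<odot>\<^bsub>R\<^esub> (a \<otimes>\<^bsub>R\<^esub> x)"
  using radford_relations_hold by (simp_all add: satisfies_radford_def)

end

text \<open>An antihomomorphism is a homomorphism into the opposite algebra, where words are
  multiplied in reverse. This makes the universal property available for the antipode.\<close>

definition op_algebra :: "('k::field, 'b, 'm) module_scheme \<Rightarrow> ('k, 'b, 'm) module_scheme"
  where "op_algebra B = B\<lparr>monoid.mult := \<lambda>x y. y \<otimes>\<^bsub>B\<^esub> x\<rparr>"

lemma op_algebra_simps [simp]:
  "carrier (op_algebra B) = carrier B" "one (op_algebra B) = one B"
  "x \<otimes>\<^bsub>op_algebra B\<^esub> y = y \<otimes>\<^bsub>B\<^esub> x"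
  "ring.zero (op_algebra B) = ring.zero B" "add (op_algebra B) = add B"
  "module.smult (op_algebra B) = module.smult B"
  by (simp_all add: op_algebra_def)

context assoc_algebra
begin

lemma op_assoc_algebra: "assoc_algebra (op_algebra A)"
  by (rule assoc_algebraI)
    (simp_all add: m_assoc a_ac l_distr r_distr smult_add_left smult_add_right smult_smult
       smult_mult_left smult_mult_right)

lemma op_pow: "y \<in> carrier A \<Longrightarrow> y [^]\<^bsub>op_algebra A\<^esub> (n::nat) = y [^] n"
proof (induction n)
  case (Suc n)
  then show ?case
    using nat_pow_comm[of y 1 n] by (simp add: nat_pow_def)
qed (simp add: nat_pow_def)

lemma antihom_by_generators_eq:
  assumes "v Gen_a \<in> carrier A" "v Gen_x \<in> carrier A"
  shows "antihom_by_generators A v = hom_by_generators (op_algebra A) v"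
proof -
  have "word_value (op_algebra A) v w = word_value A v (rev w)" for w
    by (induction w) (simp_all add: word_value_append[OF assms] gen_closed[OF assms])
  then have "word_value (op_algebra A) v = (\<lambda>w. word_value A v (rev w))"
    by blast
  moreover have "lin_ext (op_algebra A) f = lin_ext A f" for f :: "generator list \<Rightarrow> 'a"
    by (simp add: fun_eq_iff lin_ext_def finsum_def)
  ultimately show ?thesis
    by (simp add: antihom_by_generators_def hom_by_generators_def)
qed

end

section \<open>Powers of a sum of \<open>q\<close>-commuting elements\<close>

text \<open>The \<open>q\<close>-Pascal rule defines the coefficients without division, so they make
  sense at roots of unity, where the factorials in the usual quotient vanish.\<close>

fun gauss_binomial :: "'k::field \<Rightarrow> nat \<Rightarrow> nat \<Rightarrow> 'k" where
  "gauss_binomial Q 0 0 = 1"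
| "gauss_binomial Q 0 (Suc k) = 0"
| "gauss_binomial Q (Suc n) 0 = 1"
| "gauss_binomial Q (Suc n) (Suc k) = gauss_binomial Q n k + Q ^ Suc k * gauss_binomial Q n (Suc k)"

text \<open>The quotient of \<open>Q ^ n - 1\<close> by \<open>Q - 1\<close>, written as a sum so
  that it is meaningful at \<open>Q = 1\<close>, where it equals \<open>n\<close>. That case occurs
  in \<open>root_orthogonality\<close>.\<close>

definition gauss_number :: "'k::field \<Rightarrow> nat \<Rightarrow> 'k" where "gauss_number Q n = (\<Sum>i<n. Q ^ i)"

definition gauss_fact :: "'k::field \<Rightarrow> nat \<Rightarrow> 'k" where "gauss_fact Q n = (\<Prod>i=1..n. gauss_number Q i)"

lemma gauss_number_Suc: "gauss_number Q (Suc n) = 1 + Q * gauss_number Q n"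
  unfolding gauss_number_def by (subst sum.lessThan_Suc_shift) (simp add: sum_distrib_left)

lemma gauss_number_add: "gauss_number Q (m + n) = gauss_number Q m + Q ^ m * gauss_number Q n"
  by (induction m) (simp_all add: gauss_number_Suc algebra_simps, simp add: gauss_number_def)

lemma gauss_fact_Suc: "gauss_fact Q (Suc n) = gauss_fact Q n * gauss_number Q (Suc n)"
  by (simp add: gauss_fact_def)

lemma gauss_fact_0 [simp]: "gauss_fact Q 0 = 1"
  by (simp add: gauss_fact_def)

lemma gauss_binomial_0 [simp]: "gauss_binomial Q n 0 = 1"
  by (cases n) simp_all

lemma gauss_binomial_gt: "n < k \<Longrightarrow> gauss_binomial Q n k = 0"
  by (induction Q n k rule: gauss_binomial.induct) auto

lemma gauss_binomial_self: "gauss_binomial Q n n = 1"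
  by (induction n) (simp_all add: gauss_binomial_gt)

text \<open>Induction by the \<open>q\<close>-Pascal rule: after extracting the factorial of
  \<open>n\<close>, the two terms combine by the addition formula
  \<open>[k + m] = [k] + Q^k [m]\<close> for Gaussian numbers.\<close>

lemma gauss_binomial_fact:
  "gauss_binomial Q (m + k) k * (gauss_fact Q k * gauss_fact Q m) = gauss_fact Q (m + k)"
proof (induction "m + k" arbitrary: m k)
  case (Suc n)
  show ?case
  proof (cases k)
    case (Suc k')
    have 1: "gauss_binomial Q n k' * (gauss_fact Q k' * gauss_fact Q m) = gauss_fact Q n"
      using Suc.hyps(1)[of m k'] Suc.hyps(2) Suc by simp
    \<comment> \<open>For \<open>m = 0\<close> the lower index exceeds the upper one by one, and
      both sides are zero; the induction hypothesis covers only the other case.\<close>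
    have 2: "gauss_binomial Q n k * gauss_fact Q k * gauss_fact Q m = gauss_fact Q n * gauss_number Q m"
    proof (cases m)
      case 0
      then show ?thesis
        using Suc.hyps(2) Suc by (simp add: gauss_binomial_gt gauss_number_def)
    next
      case (Suc m')
      then show ?thesis
        using Suc.hyps(1)[of m' k] Suc.hyps(2) by (simp add: gauss_fact_Suc algebra_simps)
    qed
    have "gauss_binomial Q (m + k) k * (gauss_fact Q k * gauss_fact Q m) =
      (gauss_binomial Q n k' * (gauss_fact Q k' * gauss_fact Q m)) * gauss_number Q k +
      Q ^ k * (gauss_binomial Q n k * gauss_fact Q k * gauss_fact Q m)"
      using Suc.hyps(2) Suc by (simp add: gauss_fact_Suc algebra_simps flip: Suc.hyps(2))
    also have "\<dots> = gauss_fact Q n * gauss_number Q (k + m)"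
      unfolding 1 2 by (simp add: gauss_number_add algebra_simps)
    also have "\<dots> = gauss_fact Q (m + k)"
      by (metis Suc.hyps(2) add.commute gauss_fact_Suc)
    finally show ?thesis .
  qed simp
qed simp

lemma primitive_root_power_eq_1:
  assumes "primitive_root_of_unity n Q" "Q ^ m = 1" shows "n dvd m"
proof -
  have "Q ^ (m mod n) = 1"
    using assms unfolding primitive_root_of_unity_def
    by (metis mult.left_neutral mult_div_mod_eq power_add power_mult power_one)
  moreover have "m mod n < n"
    using assms(1) by (simp add: primitive_root_of_unity_def)
  ultimately have "m mod n = 0"
    using assms(1) by (auto simp: primitive_root_of_unity_def)
  then show ?thesis
    by auto
qed

lemma gauss_number_eq: "(Q - 1) * gauss_number Q n = Q ^ n - 1"
  by (induction n) (simp_all add: gauss_number_def algebra_simps)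

lemma gauss_number_nonzero:
  assumes "primitive_root_of_unity n Q" "0 < k" "k < n" shows "gauss_number Q k \<noteq> 0"
  using assms gauss_number_eq[of Q k] by (auto simp: primitive_root_of_unity_def)

lemma gauss_number_zero:
  assumes "primitive_root_of_unity n Q" "1 < n" shows "gauss_number Q n = 0"
proof -
  have "Q \<noteq> 1"
    using assms by (auto simp: primitive_root_of_unity_def)
  then show ?thesis
    using assms gauss_number_eq[of Q n] by (auto simp: primitive_root_of_unity_def)
qed

lemma gauss_fact_nonzero:
  assumes "primitive_root_of_unity n Q" "k < n" shows "gauss_fact Q k \<noteq> 0"
  using assms gauss_number_nonzero[OF assms(1)] by (auto simp: gauss_fact_def)

text \<open>The factorial of \<open>n\<close> contains the factor \<open>[n] = 0\<close>, while the
  factorials of \<open>k\<close> and \<open>n - k\<close> are nonzero, so the coefficient relating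
  them must vanish.\<close>

lemma gauss_binomial_zero:
  assumes "primitive_root_of_unity n Q" "0 < k" "k < n" shows "gauss_binomial Q n k = 0"
proof -
  have "gauss_fact Q n = 0"
    using assms gauss_number_zero[OF assms(1)] by (cases n) (auto simp: gauss_fact_Suc)
  then show ?thesis
    using gauss_binomial_fact[of Q "n - k" k] assms gauss_fact_nonzero[OF assms(1)] by auto
qed

context assoc_algebra
begin

context
  fixes u v Q assumes u: "u \<in> carrier A" and v: "v \<in> carrier A" and vu: "v \<otimes> u = Q \<odot> (u \<otimes> v)"
begin

lemma q_commute_pow: "v \<otimes> u [^] k = Q ^ k \<odot> (u [^] k \<otimes> v)"
proof (induction k)
  case (Suc k)
  have "v \<otimes> u [^] Suc k = Q ^ k \<odot> (u [^] k \<otimes> (v \<otimes> u))"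
    using u v Suc by (simp add: smult_mult_left flip: m_assoc)
  also have "\<dots> = Q ^ Suc k \<odot> (u [^] Suc k \<otimes> v)"
    using u v by (simp add: vu smult_mult_right smult_smult m_assoc mult.commute)
  finally show ?case .
qed (use v in simp)

text \<open>Multiplying from the left by \<open>u\<close> raises the exponent of \<open>u\<close>,
  while moving \<open>v\<close> past \<open>u^k\<close> costs the factor \<open>Q^k\<close>. The
  coefficients of equal monomials then add up by the \<open>q\<close>-Pascal rule.\<close>

lemma q_binomial:
  "(u \<oplus> v) [^] n = (\<Oplus>k\<in>{..n}. gauss_binomial Q n k \<odot> (u [^] k \<otimes> v [^] (n - k)))"
proof (induction n)
  case (Suc n)
  define t where "t k = u [^] k \<otimes> v [^] (Suc n - k)" for k
  define g where "g = gauss_binomial Q"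
  have t [simp]: "t k \<in> carrier A" for k
    using u v by (simp add: t_def)
  have S: "(\<lambda>k. g n k \<odot> (u [^] k \<otimes> v [^] (n - k))) \<in> {..n} \<rightarrow> carrier A"
    using u v by auto
  have "(u \<oplus> v) [^] Suc n = (u \<oplus> v) \<otimes> (\<Oplus>k\<in>{..n}. g n k \<odot> (u [^] k \<otimes> v [^] (n - k)))"
    using u v nat_pow_comm[of "u \<oplus> v" 1 n] Suc by (simp add: g_def)
  also have "\<dots> = u \<otimes> (\<Oplus>k\<in>{..n}. g n k \<odot> (u [^] k \<otimes> v [^] (n - k))) \<oplus>
     v \<otimes> (\<Oplus>k\<in>{..n}. g n k \<odot> (u [^] k \<otimes> v [^] (n - k)))"
    using u v S by (intro l_distr finsum_closed)
  also have "u \<otimes> (\<Oplus>k\<in>{..n}. g n k \<odot> (u [^] k \<otimes> v [^] (n - k))) =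
     (\<Oplus>k\<in>{..n}. u \<otimes> (g n k \<odot> (u [^] k \<otimes> v [^] (n - k))))"
    using u S by (intro finsum_rdistr) simp_all
  also have "\<dots> = (\<Oplus>k\<in>{..n}. g n k \<odot> t (Suc k))"
  proof (rule add.finprod_cong')
    fix k assume "k \<in> {..n}"
    have "u \<otimes> u [^] k = u [^] Suc k"
      using u nat_pow_comm[of u 1 k] by simp
    then have "u \<otimes> (u [^] k \<otimes> v [^] (n - k)) = t (Suc k)"
      using u v by (simp add: t_def flip: m_assoc)
    then show "u \<otimes> (g n k \<odot> (u [^] k \<otimes> v [^] (n - k))) = g n k \<odot> t (Suc k)"
      using u v by (simp add: smult_mult_right)
  qed auto
  also have "v \<otimes> (\<Oplus>k\<in>{..n}. g n k \<odot> (u [^] k \<otimes> v [^] (n - k))) =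
     (\<Oplus>k\<in>{..n}. v \<otimes> (g n k \<odot> (u [^] k \<otimes> v [^] (n - k))))"
    using v S by (intro finsum_rdistr) simp_all
  also have "\<dots> = (\<Oplus>k\<in>{..n}. (Q ^ k * g n k) \<odot> t k)"
  proof (rule add.finprod_cong')
    fix k assume k: "k \<in> {..n}"
    have "v \<otimes> (u [^] k \<otimes> v [^] (n - k)) = Q ^ k \<odot> (u [^] k \<otimes> (v \<otimes> v [^] (n - k)))"
      using u v q_commute_pow[of k] by (simp add: smult_mult_left m_assoc flip: m_assoc[of v])
    also have "v \<otimes> v [^] (n - k) = v [^] (Suc n - k)"
      using k v nat_pow_comm[of v 1 "n - k"] by (simp add: Suc_diff_le)
    finally show "v \<otimes> (g n k \<odot> (u [^] k \<otimes> v [^] (n - k))) = (Q ^ k * g n k) \<odot> t k"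
      using u v by (simp add: smult_mult_right smult_smult t_def mult.commute)
  qed auto
  \<comment> \<open>The range is extended by the index \<open>Suc n\<close>, whose coefficient is
    zero. Splitting off the index \<open>0\<close> then aligns this sum with the shifted
    one.\<close>
  also have "(\<Oplus>k\<in>{..n}. (Q ^ k * g n k) \<odot> t k) = (\<Oplus>k\<in>{..Suc n}. (Q ^ k * g n k) \<odot> t k)"
    by (subst finsum_Suc) (auto simp: g_def gauss_binomial_gt)
  also have "\<dots> = (\<Oplus>k\<in>{..n}. (Q ^ Suc k * g n (Suc k)) \<odot> t (Suc k)) \<oplus> t 0"
    by (subst finsum_Suc2) (auto simp: g_def)
  also have "(\<Oplus>k\<in>{..n}. g n k \<odot> t (Suc k)) \<oplus> ((\<Oplus>k\<in>{..n}. (Q ^ Suc k * g n (Suc k)) \<odot> t (Suc k)) \<oplus> t 0) =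
    (\<Oplus>k\<in>{..n}. g n k \<odot> t (Suc k) \<oplus> (Q ^ Suc k * g n (Suc k)) \<odot> t (Suc k)) \<oplus> t 0"
    by (subst finsum_addf) (auto simp: a_assoc)
  also have "\<dots> = (\<Oplus>k\<in>{..n}. g (Suc n) (Suc k) \<odot> t (Suc k)) \<oplus> t 0"
    by (simp add: g_def smult_add_left)
  also have "\<dots> = (\<Oplus>k\<in>{..Suc n}. g (Suc n) k \<odot> t k)"
    using finsum_Suc2[of "\<lambda>k. g (Suc n) k \<odot> t k" n] by (simp add: g_def)
  finally show ?case
    by (simp add: t_def g_def)
qed simp

text \<open>All inner Gaussian coefficients vanish at a primitive \<open>n\<close>th root of unity.
  This makes the relation \<open>x^r = 0\<close> compatible with the comultiplication.\<close>

lemma q_freshman: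
  assumes "primitive_root_of_unity n Q"
  shows "(u \<oplus> v) [^] n = u [^] n \<oplus> v [^] n"
proof (cases n)
  case (Suc m)
  have "(u \<oplus> v) [^] n = (\<Oplus>k\<in>{..n}. gauss_binomial Q n k \<odot> (u [^] k \<otimes> v [^] (n - k)))"
    by (rule q_binomial)
  also have "\<dots> = (\<Oplus>k\<in>{0, n}. gauss_binomial Q n k \<odot> (u [^] k \<otimes> v [^] (n - k)))"
    using u v by (intro add.finprod_mono_neutral_cong_right) (auto simp: gauss_binomial_zero[OF assms])
  also have "\<dots> = v [^] n \<oplus> gauss_binomial Q n n \<odot> u [^] n"
    using u v Suc by simp
  also have "gauss_binomial Q n n = 1"
    by (rule gauss_binomial_self)
  finally show ?thesis
    using u v by (simp add: a_comm)
qed (use assms in \<open>simp add: primitive_root_of_unity_def\<close>)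

end

end

text \<open>The order of the library satisfies \<open>c ^ m = 1\<close> iff it divides
  \<open>m\<close>, and is \<open>0\<close> for elements of infinite order. The exponent
  \<open>M\<close> excludes that value.\<close>

lemma mult_order_primitive:
  fixes c :: "'k::field"
  assumes "c ^ M = 1" "0 < M"
  shows "primitive_root_of_unity (mult_order c) c"
proof -
  let ?R = "ring_of_type_algebra :: 'k ring"
  interpret R: field ?R
    by (rule field_from_type_algebra)
  \<comment> \<open>Two constants named \<open>mult_of\<close> are in scope; unfolding both
    definitions identifies them.\<close>
  interpret G: group "mult_of ?R"
    using R.field_mult_group by (simp add: Ring_Divisibility.mult_of_def Multiplicative_Group.mult_of_def)
  have "c \<noteq> 0"
    using assms by (auto simp: power_0_left)
  then have c: "c \<in> carrier (mult_of ?R)"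
    by simp
  have pow: "c [^]\<^bsub>mult_of ?R\<^esub> m = c ^ m" for m :: nat
    by (induction m) simp_all
  have iff: "c ^ m = 1 \<longleftrightarrow> mult_order c dvd m" for m
    using G.pow_eq_id[OF c, of m] by (simp add: pow mult_order_def)
  show ?thesis
    unfolding primitive_root_of_unity_def using iff assms
    by (metis dvd_0_left dvd_imp_le dvd_refl gr0I leD)
qed

section \<open>The Hopf structure of \<open>H\<^bsub>n,q,N,\<nu>\<^esub>\<close>\<close>

lemma radford_hopf_simps [simp]:
  "carrier (radford_hopf n q N \<nu>) = carrier (radford_algebra q N \<nu>)"
  "monoid.mult (radford_hopf n q N \<nu>) = monoid.mult (radford_algebra q N \<nu>)"
  "one (radford_hopf n q N \<nu>) = one (radford_algebra q N \<nu>)"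
  "ring.zero (radford_hopf n q N \<nu>) = ring.zero (radford_algebra q N \<nu>)"
  "add (radford_hopf n q N \<nu>) = add (radford_algebra q N \<nu>)"
  "module.smult (radford_hopf n q N \<nu>) = module.smult (radford_algebra q N \<nu>)"
  by (simp_all add: radford_hopf_def Let_def)

text \<open>The structure maps take values in tensor products of the underlying algebras, which
  coincide with those of the Hopf algebras.\<close>

lemma tensor_radford_hopf [simp]:
  "tensor (radford_hopf n q N \<nu>) B = tensor (radford_algebra q N \<nu>) B"
  "tensor B (radford_hopf n q N \<nu>) = tensor B (radford_algebra q N \<nu>)"
  by (simp_all add: tensor_def bilinearity_def DirProd_def)

lemma pure_tensor_radford_hopf [simp]:
  "pure_tensor (radford_hopf n q N \<nu>) B = pure_tensor (radford_algebra q N \<nu>) B"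
  "pure_tensor B (radford_hopf n q N \<nu>) = pure_tensor B (radford_algebra q N \<nu>)"
  by (simp_all add: pure_tensor_def bilinearity_def DirProd_def fun_eq_iff)

lemma linear_maps_radford_hopf [simp]:
  "linear_maps (radford_hopf n q N \<nu>) B = linear_maps (radford_algebra q N \<nu>) B"
  "linear_maps B (radford_hopf n q N \<nu>) = linear_maps B (radford_algebra q N \<nu>)"
  by (simp_all add: linear_maps_def)

lemma algebra_homs_radford_hopf [simp]:
  "algebra_homs (radford_hopf n q N \<nu>) B = algebra_homs (radford_algebra q N \<nu>) B"
  "algebra_homs B (radford_hopf n q N \<nu>) = algebra_homs B (radford_algebra q N \<nu>)"
  by (simp_all add: algebra_homs_def ring_hom_def)

lemma tensor_lift_radford_hopf [simp]:
  "tensor_lift (radford_hopf n q N \<nu>) \<beta> = tensor_lift (radford_algebra q N \<nu>) \<beta>"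
  by (simp add: tensor_lift_def lin_ext_def[abs_def] finsum_def finprod_def)

lemma tensor_map_radford_hopf [simp]:
  "tensor_map (radford_hopf n q N \<nu>) B = tensor_map (radford_algebra q N \<nu>) B"
  "tensor_map B (radford_hopf n q N \<nu>) = tensor_map B (radford_algebra q N \<nu>)"
  by (simp_all add: tensor_map_def fun_eq_iff)

lemma tensor_assoc_radford_hopf [simp]:
  "tensor_assoc (radford_hopf n q N \<nu>) (radford_hopf n q N \<nu>) (radford_hopf n q N \<nu>) =
    tensor_assoc (radford_algebra q N \<nu>) (radford_algebra q N \<nu>) (radford_algebra q N \<nu>)"
  by (simp add: tensor_assoc_def)

text \<open>Both \<open>H\<close> and its candidate dual are instances, with roots \<open>q\<close>
  and \<open>\<omega> ^ \<nu>\<close>. The assumptions are what the two have in common.\<close>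

locale radford_root = radford q N \<nu> for q :: "'k::field" and N \<nu> :: nat +
  assumes q_pow_N: "q ^ N = 1" and N_pos: "0 < N"
begin

interpretation R: assoc_algebra R by (rule assoc_algebra_R)
interpretation RRR: algebra_triple R R R ..

lemma q_nonzero: "q \<noteq> 0"
  using q_pow_N N_pos by (auto simp: power_0_left)

lemma primitive_r: "primitive_root_of_unity r (q ^ \<nu>)"
proof (rule mult_order_primitive)
  show "(q ^ \<nu>) ^ N = 1"
    using q_pow_N by (metis mult.commute power_mult power_one)
qed (rule N_pos)

lemma r_pos: "0 < r"
  using primitive_r by (simp add: primitive_root_of_unity_def)

definition b where "b = inv\<^bsub>R\<^esub> a"

lemma a_unit: "a \<in> Units R"
proof -
  obtain M where M: "N = Suc M"
    using N_pos gr0_implies_Suc by blast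
  then have "a [^]\<^bsub>R\<^esub> M \<otimes>\<^bsub>R\<^esub> a = \<one>\<^bsub>R\<^esub>"
    using a_pow_N by simp
  moreover from this have "a \<otimes>\<^bsub>R\<^esub> a [^]\<^bsub>R\<^esub> M = \<one>\<^bsub>R\<^esub>"
    using R.nat_pow_comm[of a 1 M] by simp
  ultimately show ?thesis
    unfolding Units_def using R.nat_pow_closed[of a M] by auto
qed

lemma b_closed [simp, intro]: "b \<in> carrier R"
  and a_b [simp]: "a \<otimes>\<^bsub>R\<^esub> b = \<one>\<^bsub>R\<^esub>"
  and b_a [simp]: "b \<otimes>\<^bsub>R\<^esub> a = \<one>\<^bsub>R\<^esub>"
  using a_unit by (simp_all add: b_def)

lemma a_pow_b_pow: "a [^]\<^bsub>R\<^esub> (k::nat) \<otimes>\<^bsub>R\<^esub> b [^]\<^bsub>R\<^esub> k = \<one>\<^bsub>R\<^esub>"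
  "b [^]\<^bsub>R\<^esub> k \<otimes>\<^bsub>R\<^esub> a [^]\<^bsub>R\<^esub> k = \<one>\<^bsub>R\<^esub>"
proof -
  have "a \<otimes>\<^bsub>R\<^esub> b = b \<otimes>\<^bsub>R\<^esub> a"
    by simp
  then show "a [^]\<^bsub>R\<^esub> k \<otimes>\<^bsub>R\<^esub> b [^]\<^bsub>R\<^esub> k = \<one>\<^bsub>R\<^esub>" "b [^]\<^bsub>R\<^esub> k \<otimes>\<^bsub>R\<^esub> a [^]\<^bsub>R\<^esub> k = \<one>\<^bsub>R\<^esub>"
    using R.pow_mult_distrib[of a b k, symmetric] R.pow_mult_distrib[of b a k, symmetric] by auto
qed

lemma b_pow_N: "b [^]\<^bsub>R\<^esub> N = \<one>\<^bsub>R\<^esub>"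
  using a_pow_b_pow(1)[of N] by (simp add: a_pow_N)

lemma x_a_pow: "x \<otimes>\<^bsub>R\<^esub> a [^]\<^bsub>R\<^esub> k = q ^ k \<odot>\<^bsub>R\<^esub> (a [^]\<^bsub>R\<^esub> k \<otimes>\<^bsub>R\<^esub> x)"
  by (rule R.q_commute_pow) (simp_all add: x_a)

lemma b_x: "b \<otimes>\<^bsub>R\<^esub> x = q \<odot>\<^bsub>R\<^esub> (x \<otimes>\<^bsub>R\<^esub> b)"
proof -
  have "b \<otimes>\<^bsub>R\<^esub> x = b \<otimes>\<^bsub>R\<^esub> (x \<otimes>\<^bsub>R\<^esub> a) \<otimes>\<^bsub>R\<^esub> b"
    by (simp add: R.m_assoc)
  also have "\<dots> = q \<odot>\<^bsub>R\<^esub> ((b \<otimes>\<^bsub>R\<^esub> a) \<otimes>\<^bsub>R\<^esub> x \<otimes>\<^bsub>R\<^esub> b)"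
    by (simp add: x_a R.smult_mult_left R.smult_mult_right R.m_assoc del: b_a)
  finally show ?thesis
    by simp
qed

lemma x_b: "x \<otimes>\<^bsub>R\<^esub> b = inverse q \<odot>\<^bsub>R\<^esub> (b \<otimes>\<^bsub>R\<^esub> x)"
  using q_nonzero by (simp add: b_x R.smult_smult)

lemma x_b_pow: "x \<otimes>\<^bsub>R\<^esub> b [^]\<^bsub>R\<^esub> k = inverse q ^ k \<odot>\<^bsub>R\<^esub> (b [^]\<^bsub>R\<^esub> k \<otimes>\<^bsub>R\<^esub> x)"
  by (rule R.q_commute_pow) (simp_all add: x_b)

definition y where "y = (- inverse (q ^ \<nu>)) \<odot>\<^bsub>R\<^esub> (b [^]\<^bsub>R\<^esub> \<nu> \<otimes>\<^bsub>R\<^esub> x)"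

lemma y_closed [simp, intro]: "y \<in> carrier R"
  by (simp add: y_def)

text \<open>This and \<open>x_b_pow_y\<close> are the antipode axioms at \<open>x\<close>: applied
  to the two summands of the comultiplication of \<open>x\<close>, the left axiom reads
  \<open>s(x) a^\<nu> + x = 0\<close> and the right one \<open>x b^\<nu> + s(x) = 0\<close>. The
  scalar in \<open>y\<close> undoes the factor from commuting \<open>x\<close> with
  \<open>a^\<nu>\<close>.\<close>

lemma y_a_pow: "y \<otimes>\<^bsub>R\<^esub> a [^]\<^bsub>R\<^esub> \<nu> \<oplus>\<^bsub>R\<^esub> x = \<zero>\<^bsub>R\<^esub>"
proof -
  have "y \<otimes>\<^bsub>R\<^esub> a [^]\<^bsub>R\<^esub> \<nu> = (- 1) \<odot>\<^bsub>R\<^esub> ((b [^]\<^bsub>R\<^esub> \<nu> \<otimes>\<^bsub>R\<^esub> a [^]\<^bsub>R\<^esub> \<nu>) \<otimes>\<^bsub>R\<^esub> x)"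
    using q_nonzero by (simp add: y_def R.smult_mult_left R.smult_mult_right R.m_assoc x_a_pow R.smult_smult)
  then show ?thesis
    by (simp add: a_pow_b_pow R.smult_minus_1 R.l_neg)
qed

lemma x_b_pow_y: "x \<otimes>\<^bsub>R\<^esub> b [^]\<^bsub>R\<^esub> \<nu> \<oplus>\<^bsub>R\<^esub> y = \<zero>\<^bsub>R\<^esub>"
proof -
  let ?z = "inverse (q ^ \<nu>) \<odot>\<^bsub>R\<^esub> (b [^]\<^bsub>R\<^esub> \<nu> \<otimes>\<^bsub>R\<^esub> x)"
  have "y = (- 1) \<odot>\<^bsub>R\<^esub> ?z"
    by (simp add: y_def R.smult_smult)
  then have "y = \<ominus>\<^bsub>R\<^esub> ?z"
    by (simp add: R.smult_minus_1)
  then show ?thesis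
    by (simp add: x_b_pow power_inverse R.r_neg)
qed

text \<open>The use is at exponent \<open>r\<close>, where \<open>x^r = 0\<close> kills the
  right-hand side whatever the scalar is; hence the scalar stays existential.\<close>

lemma y_pow: "\<exists>c. y [^]\<^bsub>R\<^esub> k = c \<odot>\<^bsub>R\<^esub> (b [^]\<^bsub>R\<^esub> (\<nu> * k) \<otimes>\<^bsub>R\<^esub> x [^]\<^bsub>R\<^esub> k)"
proof (induction k)
  case (Suc k)
  then obtain c where c: "y [^]\<^bsub>R\<^esub> k = c \<odot>\<^bsub>R\<^esub> (b [^]\<^bsub>R\<^esub> (\<nu> * k) \<otimes>\<^bsub>R\<^esub> x [^]\<^bsub>R\<^esub> k)"
    by blast
  have xb: "x [^]\<^bsub>R\<^esub> k \<otimes>\<^bsub>R\<^esub> b [^]\<^bsub>R\<^esub> \<nu> = (inverse q ^ \<nu>) ^ k \<odot>\<^bsub>R\<^esub> (b [^]\<^bsub>R\<^esub> \<nu> \<otimes>\<^bsub>R\<^esub> x [^]\<^bsub>R\<^esub> k)" for k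
  proof (induction k)
    case (Suc k)
    have "x [^]\<^bsub>R\<^esub> Suc k \<otimes>\<^bsub>R\<^esub> b [^]\<^bsub>R\<^esub> \<nu> = inverse q ^ \<nu> \<odot>\<^bsub>R\<^esub> (x [^]\<^bsub>R\<^esub> k \<otimes>\<^bsub>R\<^esub> b [^]\<^bsub>R\<^esub> \<nu> \<otimes>\<^bsub>R\<^esub> x)"
      by (simp add: R.m_assoc x_b_pow R.smult_mult_right)
    then show ?case
      by (simp add: Suc R.smult_mult_left R.smult_smult R.m_assoc)
  qed simp
  have "y [^]\<^bsub>R\<^esub> Suc k = (c * - inverse (q ^ \<nu>)) \<odot>\<^bsub>R\<^esub>
    (b [^]\<^bsub>R\<^esub> (\<nu> * k) \<otimes>\<^bsub>R\<^esub> (x [^]\<^bsub>R\<^esub> k \<otimes>\<^bsub>R\<^esub> b [^]\<^bsub>R\<^esub> \<nu>) \<otimes>\<^bsub>R\<^esub> x)"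
    by (simp add: c, simp add: y_def R.smult_mult_left R.smult_mult_right R.smult_smult R.m_assoc mult.commute)
  also have "\<dots> = (c * - inverse (q ^ \<nu>) * (inverse q ^ \<nu>) ^ k) \<odot>\<^bsub>R\<^esub>
    ((b [^]\<^bsub>R\<^esub> (\<nu> * k) \<otimes>\<^bsub>R\<^esub> b [^]\<^bsub>R\<^esub> \<nu>) \<otimes>\<^bsub>R\<^esub> x [^]\<^bsub>R\<^esub> Suc k)"
    by (simp add: xb R.smult_mult_left R.smult_mult_right R.smult_smult R.m_assoc)
  also have "b [^]\<^bsub>R\<^esub> (\<nu> * k) \<otimes>\<^bsub>R\<^esub> b [^]\<^bsub>R\<^esub> \<nu> = b [^]\<^bsub>R\<^esub> (\<nu> * Suc k)"
    by (simp add: R.nat_pow_mult add.commute)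
  finally show ?case
    by blast
qed (use R.smult_1[of "\<one>\<^bsub>R\<^esub>"] in \<open>auto intro!: exI[of _ 1]\<close>)

section \<open>Comultiplication, counit and antipode defined on generators\<close>

abbreviation RR where "RR \<equiv> tensor R R"
abbreviation pt where "pt \<equiv> pure_tensor R R"
abbreviation \<Delta>x where "\<Delta>x \<equiv> pt x (a [^]\<^bsub>R\<^esub> \<nu>) \<oplus>\<^bsub>RR\<^esub> pt \<one>\<^bsub>R\<^esub> x"
abbreviation \<Delta> where "\<Delta> \<equiv> hom_by_generators RR (case_generator (pt a a) \<Delta>x)"
abbreviation \<epsilon> :: "(generator list \<Rightarrow>\<^sub>0 'k) set \<Rightarrow> 'k" where "\<epsilon> \<equiv> hom_by_generators scalars (case_generator 1 0)"
abbreviation s where "s \<equiv> antihom_by_generators R (case_generator b y)"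

lemma RR_algebra: "assoc_algebra RR"
  by (rule RRR.AB.tensor_assoc_algebra)

text \<open>The delicate relation is the nilpotency of \<open>\<Delta>x\<close>: its two summands
  commute up to \<open>q ^ \<nu>\<close>, a primitive \<open>r\<close>th root of unity, so its
  \<open>r\<close>th power is the sum of their \<open>r\<close>th powers, both of which contain
  \<open>x^r\<close>.\<close>

lemma comult_relations: "satisfies_radford RR q N \<nu> (case_generator (pt a a) \<Delta>x)"
proof -
  have "pt a a [^]\<^bsub>RR\<^esub> N = \<one>\<^bsub>RR\<^esub>"
    by (simp add: RRR.AB.pt_pow a_pow_N RRR.AB.tensor_one)
  moreover have "\<Delta>x [^]\<^bsub>RR\<^esub> r = \<zero>\<^bsub>RR\<^esub>"
  proof -
    have "pt \<one>\<^bsub>R\<^esub> x \<otimes>\<^bsub>RR\<^esub> pt x (a [^]\<^bsub>R\<^esub> \<nu>) = q ^ \<nu> \<odot>\<^bsub>RR\<^esub> (pt x (a [^]\<^bsub>R\<^esub> \<nu>) \<otimes>\<^bsub>RR\<^esub> pt \<one>\<^bsub>R\<^esub> x)"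
      by (simp add: RRR.AB.pt_mult x_a_pow RRR.AB.pt_smult_right)
    then have "\<Delta>x [^]\<^bsub>RR\<^esub> r = pt x (a [^]\<^bsub>R\<^esub> \<nu>) [^]\<^bsub>RR\<^esub> r \<oplus>\<^bsub>RR\<^esub> pt \<one>\<^bsub>R\<^esub> x [^]\<^bsub>RR\<^esub> r"
      by (intro RRR.AB.T.q_freshman[OF _ _ _ primitive_r]) simp_all
    then show ?thesis
      by (simp add: RRR.AB.pt_pow x_pow_r RRR.AB.pt_zero)
  qed
  moreover have "\<Delta>x \<otimes>\<^bsub>RR\<^esub> pt a a = q \<odot>\<^bsub>RR\<^esub> (pt a a \<otimes>\<^bsub>RR\<^esub> \<Delta>x)"
  proof -
    have "a \<otimes>\<^bsub>R\<^esub> a [^]\<^bsub>R\<^esub> \<nu> = a [^]\<^bsub>R\<^esub> \<nu> \<otimes>\<^bsub>R\<^esub> a"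
      using R.nat_pow_comm[of a 1 \<nu>] by simp
    then show ?thesis
      by (simp add: RRR.AB.T.l_distr RRR.AB.T.r_distr RRR.AB.pt_mult x_a RRR.AB.pt_smult_left
          RRR.AB.pt_smult_right RRR.AB.T.smult_add_right)
  qed
  ultimately show ?thesis
    by (simp add: satisfies_radford_def)
qed

lemma comult_hom: "\<Delta> \<in> algebra_homs R RR"
  and comult_gen: "\<Delta> a = pt a a" "\<Delta> x = \<Delta>x"
  using hom_by_generators_hom[OF RR_algebra comult_relations] by simp_all

lemma counit_relations: "satisfies_radford scalars q N \<nu> (case_generator 1 0)"
proof -
  interpret S: assoc_algebra "scalars :: ('k, 'k) module" by simp
  have "c [^]\<^bsub>scalars\<^esub> k = c ^ k" for c :: 'k and k :: nat
    by (induction k) simp_all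
  then show ?thesis
    using r_pos by (simp add: satisfies_radford_def)
qed

lemma counit_hom: "\<epsilon> \<in> algebra_homs R scalars"
  and counit_gen: "\<epsilon> a = 1" "\<epsilon> x = 0"
  using hom_by_generators_hom[OF scalars_algebra counit_relations] by simp_all

text \<open>In the opposite algebra the commutation relation becomes \<open>b y = q y b\<close>. It
  holds because \<open>b\<close> commutes with the power of \<open>b\<close> inside \<open>y\<close>
  and passes \<open>x\<close> at the cost of \<open>q\<close>.\<close>

lemma antipode_relations: "satisfies_radford (op_algebra R) q N \<nu> (case_generator b y)"
proof -
  have "b [^]\<^bsub>R\<^esub> \<nu> \<otimes>\<^bsub>R\<^esub> b = b \<otimes>\<^bsub>R\<^esub> b [^]\<^bsub>R\<^esub> \<nu>"
    using R.nat_pow_comm[of b 1 \<nu>] by simp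
  then have "b \<otimes>\<^bsub>R\<^esub> y = (- inverse (q ^ \<nu>)) \<odot>\<^bsub>R\<^esub> (b [^]\<^bsub>R\<^esub> \<nu> \<otimes>\<^bsub>R\<^esub> (b \<otimes>\<^bsub>R\<^esub> x))"
    by (simp add: y_def R.smult_mult_right flip: R.m_assoc)
  also have "\<dots> = q \<odot>\<^bsub>R\<^esub> (y \<otimes>\<^bsub>R\<^esub> b)"
    by (simp add: b_x y_def R.smult_mult_left R.smult_mult_right R.smult_smult R.m_assoc mult.commute)
  finally have "b \<otimes>\<^bsub>R\<^esub> y = q \<odot>\<^bsub>R\<^esub> (y \<otimes>\<^bsub>R\<^esub> b)" .
  moreover have "y [^]\<^bsub>R\<^esub> r = \<zero>\<^bsub>R\<^esub>"
    using y_pow[of r] by (auto simp: x_pow_r)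
  ultimately show ?thesis
    by (simp add: satisfies_radford_def R.op_pow b_pow_N)
qed

lemma antipode_eq: "s = hom_by_generators (op_algebra R) (case_generator b y)"
  by (rule R.antihom_by_generators_eq) simp_all

lemma antipode_hom: "s \<in> algebra_homs R (op_algebra R)"
  and antipode_gen: "s a = b" "s x = y"
  using hom_by_generators_hom[OF R.op_assoc_algebra antipode_relations] by (simp_all add: antipode_eq)

lemma antipode_linear: "s \<in> linear_maps R R"
  using algebra_hom_linear[OF antipode_hom] by (simp add: linear_maps_def)

lemma antipode_mult: "g \<in> carrier R \<Longrightarrow> h \<in> carrier R \<Longrightarrow> s (g \<otimes>\<^bsub>R\<^esub> h) = s h \<otimes>\<^bsub>R\<^esub> s g"
  using algebra_hom_mult[OF antipode_hom] by simp

lemma antipode_one: "s \<one>\<^bsub>R\<^esub> = \<one>\<^bsub>R\<^esub>"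
  using algebra_hom_one[OF antipode_hom] by simp

lemma antipode_closed: "h \<in> carrier R \<Longrightarrow> s h \<in> carrier R"
  by (rule linear_closed[OF antipode_linear])

lemma antipode_pow: "s (a [^]\<^bsub>R\<^esub> (k::nat)) = b [^]\<^bsub>R\<^esub> k"
  using algebra_hom_pow[OF R.is_assoc_algebra R.op_assoc_algebra antipode_hom, of a k]
  by (simp add: antipode_gen R.op_pow)

lemma comult_pow: "\<Delta> (a [^]\<^bsub>R\<^esub> (k::nat)) = pt (a [^]\<^bsub>R\<^esub> k) (a [^]\<^bsub>R\<^esub> k)"
  using algebra_hom_pow[OF R.is_assoc_algebra RR_algebra comult_hom, of a k]
  by (simp add: comult_gen RRR.AB.pt_pow)

lemma counit_pow: "\<epsilon> (a [^]\<^bsub>R\<^esub> (k::nat)) = 1"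
  by (induction k) (simp_all add: algebra_hom_one[OF counit_hom] algebra_hom_mult[OF counit_hom] counit_gen)

text \<open>Both sides are homomorphisms into the triple tensor product. At \<open>a\<close> each is
  the triple tensor of \<open>a\<close>; at \<open>x\<close> each is a sum of three pure tensors,
  differing only in bracketing.\<close>

lemma coassoc_R:
  assumes "h \<in> carrier R"
  shows "tensor_assoc R R R (tensor_map RR R \<Delta> id (\<Delta> h)) = tensor_map R RR id \<Delta> (\<Delta> h)"
proof -
  note \<Delta>_lin = algebra_hom_linear[OF comult_hom]
  interpret F1: algebra_pair_maps R R RR R \<Delta> id
    by unfold_locales (simp_all add: \<Delta>_lin linear_id)
  interpret F2: algebra_pair_maps R R R RR id \<Delta>
    by unfold_locales (simp_all add: \<Delta>_lin linear_id)
  note hom1 = F1.tensor_map_hom[OF comult_hom algebra_hom_id]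
  note hom2 = F2.tensor_map_hom[OF algebra_hom_id comult_hom]
  note simps = comult_gen comult_pow algebra_hom_one[OF comult_hom] RRR.AB.tensor_one
    F1.tensor_map_pure F2.tensor_map_pure algebra_hom_add[OF hom1] algebra_hom_add[OF hom2]
    RRR.tensor_assoc_pure algebra_hom_add[OF RRR.tensor_assoc_hom] RRR.ABC1.pt_add_left RRR.ABC2.pt_add_right
    RRR.ABC2.T.a_assoc
  show ?thesis
    by (rule radford_hom_eq[OF RRR.ABC2.tensor_assoc_algebra
        algebra_hom_comp[OF comult_hom algebra_hom_comp[OF hom1 RRR.tensor_assoc_hom]]
        algebra_hom_comp[OF comult_hom hom2] _ _ assms]) (simp_all add: simps)
qed

text \<open>Since the counit has values in the ground field, contracting a tensor factor with it is
  multiplicative. The axiom therefore compares two algebra homomorphisms and is tested on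
  generators.\<close>

lemma counit_left_R:
  assumes "h \<in> carrier R" shows "tensor_lift R (\<lambda>g h. \<epsilon> g \<odot>\<^bsub>R\<^esub> h) (\<Delta> h) = h"
proof -
  let ?L = "tensor_lift R (\<lambda>g h. \<epsilon> g \<odot>\<^bsub>R\<^esub> h)"
  have bil: "(\<lambda>g h. \<epsilon> g \<odot>\<^bsub>R\<^esub> h) \<in> bilinear_maps R R R"
    by (intro R.bilinear_scalar_smult algebra_hom_linear[OF counit_hom] linear_id)
  note pure = RRR.AB.tensor_lift_pure[OF R.is_assoc_algebra bil]
  note counit = algebra_hom_one[OF counit_hom] algebra_hom_mult[OF counit_hom] counit_gen counit_pow
  have hom: "?L \<in> algebra_homs RR R"
    by (rule RRR.AB.tensor_hom[OF R.is_assoc_algebra RRR.AB.tensor_lift_linear[OF R.is_assoc_algebra bil]])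
      (simp_all add: pure counit R.smult_mult_left R.smult_mult_right R.smult_smult mult.commute)
  have "?L (\<Delta> h) = id h"
    by (rule radford_hom_eq[OF R.is_assoc_algebra algebra_hom_comp[OF comult_hom hom] algebra_hom_id _ _ assms])
      (simp_all add: comult_gen pure counit algebra_hom_add[OF hom])
  then show ?thesis by simp
qed

lemma counit_right_R:
  assumes "h \<in> carrier R" shows "tensor_lift R (\<lambda>g h. \<epsilon> h \<odot>\<^bsub>R\<^esub> g) (\<Delta> h) = h"
proof -
  let ?L = "tensor_lift R (\<lambda>g h. \<epsilon> h \<odot>\<^bsub>R\<^esub> g)"
  have bil: "(\<lambda>g h. \<epsilon> h \<odot>\<^bsub>R\<^esub> g) \<in> bilinear_maps R R R"
    by (intro R.bilinear_scalar_smult algebra_hom_linear[OF counit_hom] linear_id)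
  note pure = RRR.AB.tensor_lift_pure[OF R.is_assoc_algebra bil]
  note counit = algebra_hom_one[OF counit_hom] algebra_hom_mult[OF counit_hom] counit_gen counit_pow
  have hom: "?L \<in> algebra_homs RR R"
    by (rule RRR.AB.tensor_hom[OF R.is_assoc_algebra RRR.AB.tensor_lift_linear[OF R.is_assoc_algebra bil]])
      (simp_all add: pure counit R.smult_mult_left R.smult_mult_right R.smult_smult mult.commute)
  have "?L (\<Delta> h) = id h"
    by (rule radford_hom_eq[OF R.is_assoc_algebra algebra_hom_comp[OF comult_hom hom] algebra_hom_id _ _ assms])
      (simp_all add: comult_gen pure counit algebra_hom_add[OF hom])
  then show ?thesis by simp
qed

text \<open>Multiplying the comultiplication of \<open>h\<close> from the left by that of a generator only changes
  \<open>\<Sum> s(h\<^sub>1) h\<^sub>2\<close> by an inner factor, and \<open>\<Sum> h\<^sub>1 s(h\<^sub>2)\<close> by outer factors.\<close>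

lemma antipode_left_R:
  assumes "h \<in> carrier R" shows "tensor_lift R (\<lambda>g h. s g \<otimes>\<^bsub>R\<^esub> h) (\<Delta> h) = \<epsilon> h \<odot>\<^bsub>R\<^esub> \<one>\<^bsub>R\<^esub>"
proof -
  let ?L = "tensor_lift R (\<lambda>g h. s g \<otimes>\<^bsub>R\<^esub> h)"
  have bil: "(\<lambda>g h. s g \<otimes>\<^bsub>R\<^esub> h) \<in> bilinear_maps R R R"
    by (rule bilinear_comp[OF R.bilinear_mult antipode_linear linear_id(1)])
  note pure = RRR.AB.tensor_lift_pure[OF R.is_assoc_algebra bil]
  note lin = RRR.AB.tensor_lift_linear[OF R.is_assoc_algebra bil]
  note closed = antipode_closed algebra_hom_closed[OF comult_hom]
  have L_a: "?L (pt a a \<otimes>\<^bsub>RR\<^esub> t) = ?L t" if "t \<in> carrier RR" for t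
  proof (rule RRR.AB.tensor_linear_eq[OF that linear_comp[OF RRR.AB.T.linear_maps_mult_left lin] lin])
    fix g h assume gh: "g \<in> carrier R" "h \<in> carrier R"
    have "s g \<otimes>\<^bsub>R\<^esub> b \<otimes>\<^bsub>R\<^esub> (a \<otimes>\<^bsub>R\<^esub> h) = s g \<otimes>\<^bsub>R\<^esub> (b \<otimes>\<^bsub>R\<^esub> a) \<otimes>\<^bsub>R\<^esub> h"
      using gh closed by (simp add: R.m_assoc del: b_a)
    then show "?L (pt a a \<otimes>\<^bsub>RR\<^esub> pt g h) = ?L (pt g h)"
      using gh closed by (simp add: RRR.AB.pt_mult pure antipode_mult antipode_gen)
  qed simp
  \<comment> \<open>The zero on the right is written as a multiple of \<open>?L t\<close> so that it
    is a linear map of \<open>t\<close> to which \<open>tensor_linear_eq\<close> applies.\<close>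
  have L_x: "?L (\<Delta>x \<otimes>\<^bsub>RR\<^esub> t) = 0 \<odot>\<^bsub>R\<^esub> ?L t" if "t \<in> carrier RR" for t
  proof (rule RRR.AB.tensor_linear_eq[OF that linear_comp[OF RRR.AB.T.linear_maps_mult_left lin] R.linear_maps_smult[OF lin]])
    fix g h assume gh: "g \<in> carrier R" "h \<in> carrier R"
    have "s g \<otimes>\<^bsub>R\<^esub> y \<otimes>\<^bsub>R\<^esub> (a [^]\<^bsub>R\<^esub> \<nu> \<otimes>\<^bsub>R\<^esub> h) \<oplus>\<^bsub>R\<^esub> s g \<otimes>\<^bsub>R\<^esub> (x \<otimes>\<^bsub>R\<^esub> h) =
        s g \<otimes>\<^bsub>R\<^esub> (y \<otimes>\<^bsub>R\<^esub> a [^]\<^bsub>R\<^esub> \<nu> \<oplus>\<^bsub>R\<^esub> x) \<otimes>\<^bsub>R\<^esub> h"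
      using gh closed by (simp add: R.m_assoc R.l_distr R.r_distr)
    then show "?L (\<Delta>x \<otimes>\<^bsub>RR\<^esub> pt g h) = 0 \<odot>\<^bsub>R\<^esub> ?L (pt g h)"
      using gh closed
      by (simp add: RRR.AB.T.l_distr RRR.AB.pt_mult linear_add[OF lin] pure antipode_mult antipode_gen y_a_pow)
  qed simp
  show ?thesis
    using assms
  proof (induction rule: radford_induct)
    case one
    then show ?case
      by (simp add: algebra_hom_one[OF comult_hom] algebra_hom_one[OF counit_hom] RRR.AB.tensor_one pure antipode_one)
  next
    case (gen g h)
    have "?L (\<Delta> (generator_class q N \<nu> g) \<otimes>\<^bsub>RR\<^esub> \<Delta> h) = (\<epsilon> (generator_class q N \<nu> g) * \<epsilon> h) \<odot>\<^bsub>R\<^esub> \<one>\<^bsub>R\<^esub>"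
      using gen closed by (cases g) (simp_all add: comult_gen counit_gen L_a L_x)
    then show ?case
      using gen by (simp add: algebra_hom_mult[OF comult_hom] algebra_hom_mult[OF counit_hom])
  next
    case (add h h')
    then show ?case
      using closed by (simp add: algebra_hom_add[OF comult_hom] algebra_hom_add[OF counit_hom] linear_add[OF lin] R.smult_add_left)
  next
    case (scale c h)
    then show ?case
      using closed by (simp add: algebra_hom_smult[OF comult_hom] algebra_hom_smult[OF counit_hom] linear_smult[OF lin] R.smult_smult)
  qed
qed

lemma antipode_right_R:
  assumes "h \<in> carrier R" shows "tensor_lift R (\<lambda>g h. g \<otimes>\<^bsub>R\<^esub> s h) (\<Delta> h) = \<epsilon> h \<odot>\<^bsub>R\<^esub> \<one>\<^bsub>R\<^esub>"
proof -
  let ?L = "tensor_lift R (\<lambda>g h. g \<otimes>\<^bsub>R\<^esub> s h)"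
  have bil: "(\<lambda>g h. g \<otimes>\<^bsub>R\<^esub> s h) \<in> bilinear_maps R R R"
    by (rule bilinear_comp[OF R.bilinear_mult linear_id(1) antipode_linear])
  note pure = RRR.AB.tensor_lift_pure[OF R.is_assoc_algebra bil]
  note lin = RRR.AB.tensor_lift_linear[OF R.is_assoc_algebra bil]
  note closed = antipode_closed algebra_hom_closed[OF comult_hom]
  have L_a: "?L (pt a a \<otimes>\<^bsub>RR\<^esub> t) = a \<otimes>\<^bsub>R\<^esub> ?L t \<otimes>\<^bsub>R\<^esub> b" if "t \<in> carrier RR" for t
    by (rule RRR.AB.tensor_linear_eq[OF that linear_comp[OF RRR.AB.T.linear_maps_mult_left lin]
      linear_comp[OF linear_comp[OF lin R.linear_maps_mult_left] R.linear_maps_mult_right]])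
      (simp_all add: closed RRR.AB.pt_mult pure antipode_mult antipode_gen R.m_assoc)
  have L_x: "?L (\<Delta>x \<otimes>\<^bsub>RR\<^esub> t) = x \<otimes>\<^bsub>R\<^esub> ?L t \<otimes>\<^bsub>R\<^esub> b [^]\<^bsub>R\<^esub> \<nu> \<oplus>\<^bsub>R\<^esub> ?L t \<otimes>\<^bsub>R\<^esub> y" if "t \<in> carrier RR" for t
    by (rule RRR.AB.tensor_linear_eq[OF that linear_comp[OF RRR.AB.T.linear_maps_mult_left lin]
      R.linear_maps_add[OF RR_algebra linear_comp[OF linear_comp[OF lin R.linear_maps_mult_left] R.linear_maps_mult_right]
        linear_comp[OF lin R.linear_maps_mult_right]]])
      (simp_all add: closed RRR.AB.T.l_distr RRR.AB.pt_mult linear_add[OF lin] pure antipode_mult antipode_gen antipode_pow R.m_assoc)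
  show ?thesis
    using assms
  proof (induction rule: radford_induct)
    case one
    then show ?case
      by (simp add: algebra_hom_one[OF comult_hom] algebra_hom_one[OF counit_hom] RRR.AB.tensor_one pure antipode_one)
  next
    case (gen g h)
    have "?L (\<Delta> (generator_class q N \<nu> g) \<otimes>\<^bsub>RR\<^esub> \<Delta> h) = (\<epsilon> (generator_class q N \<nu> g) * \<epsilon> h) \<odot>\<^bsub>R\<^esub> \<one>\<^bsub>R\<^esub>"
    proof (cases g)
      case Gen_a
      then show ?thesis
        using gen closed by (simp add: comult_gen counit_gen L_a R.smult_mult_left R.smult_mult_right)
    next
      case Gen_x
      have "x \<otimes>\<^bsub>R\<^esub> (\<epsilon> h \<odot>\<^bsub>R\<^esub> \<one>\<^bsub>R\<^esub>) \<otimes>\<^bsub>R\<^esub> b [^]\<^bsub>R\<^esub> \<nu> \<oplus>\<^bsub>R\<^esub> \<epsilon> h \<odot>\<^bsub>R\<^esub> \<one>\<^bsub>R\<^esub> \<otimes>\<^bsub>R\<^esub> y =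
          \<epsilon> h \<odot>\<^bsub>R\<^esub> (x \<otimes>\<^bsub>R\<^esub> b [^]\<^bsub>R\<^esub> \<nu> \<oplus>\<^bsub>R\<^esub> y)"
        by (simp add: R.smult_mult_left R.smult_mult_right R.smult_add_right)
      then show ?thesis
        using Gen_x gen closed by (simp add: comult_gen counit_gen L_x x_b_pow_y)
    qed
    then show ?case
      using gen by (simp add: algebra_hom_mult[OF comult_hom] algebra_hom_mult[OF counit_hom])
  next
    case (add h h')
    then show ?case
      using closed by (simp add: algebra_hom_add[OF comult_hom] algebra_hom_add[OF counit_hom] linear_add[OF lin] R.smult_add_left)
  next
    case (scale c h)
    then show ?case
      using closed by (simp add: algebra_hom_smult[OF comult_hom] algebra_hom_smult[OF counit_hom] linear_smult[OF lin] R.smult_smult)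
  qed
qed

lemma structure_maps:
  "comult (radford_hopf n q N \<nu>) = \<Delta>" "counit (radford_hopf n q N \<nu>) = \<epsilon>"
  "antipode (radford_hopf n q N \<nu>) = s"
  by (simp_all add: radford_hopf_def Let_def b_def y_def)

lemma radford_hopf_assoc_algebra: "assoc_algebra (radford_hopf n q N \<nu>)"
  by (rule assoc_algebraI)
    (simp_all add: R.m_assoc R.a_ac R.l_distr R.r_distr R.smult_add_left R.smult_add_right R.smult_smult
       R.smult_mult_left R.smult_mult_right)

theorem radford_hopf_algebra: "hopf_algebra (radford_hopf n q N \<nu>)"
  by (intro hopf_algebra.intro hopf_algebra_axioms.intro radford_hopf_assoc_algebra)
    (simp_all add: structure_maps comult_hom counit_hom antipode_linear coassoc_R
      counit_left_R counit_right_R antipode_left_R antipode_right_R)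

end

section \<open>The dual of a Hopf algebra\<close>

lemma linear_scalars_mult: "(\<lambda>x. c * x) \<in> linear_maps scalars scalars" "(\<lambda>x. x * c) \<in> linear_maps scalars scalars"
  by (auto intro!: linear_mapsI simp: algebra_simps)

context hopf_algebra
begin

abbreviation D :: "('k, 'a \<Rightarrow> 'k) module" where "D \<equiv> dual_algebra H"

lemma dual_simps:
  "carrier D = linear_maps H scalars \<inter> extensional (carrier H)"
  "f \<otimes>\<^bsub>D\<^esub> g = (\<lambda>h\<in>carrier H. sw scalars (\<lambda>a b. f a * g b) h)"
  "\<one>\<^bsub>D\<^esub> = restrict (counit H) (carrier H)"
  "\<zero>\<^bsub>D\<^esub> = (\<lambda>h\<in>carrier H. 0)"
  "f \<oplus>\<^bsub>D\<^esub> g = (\<lambda>h\<in>carrier H. f h + g h)"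
  "c \<odot>\<^bsub>D\<^esub> f = (\<lambda>h\<in>carrier H. c * f h)"
  by (simp_all add: dual_algebra_def)

lemma dual_linear: "f \<in> carrier D \<Longrightarrow> f \<in> linear_maps H scalars"
  by (simp add: dual_simps)

lemma dualI:
  assumes "f \<in> linear_maps H scalars" shows "restrict f (carrier H) \<in> carrier D"
  unfolding dual_simps by (intro IntI linear_cong[OF assms _ is_assoc_algebra]) auto

lemma dual_eqI:
  assumes "f \<in> carrier D" "g \<in> carrier D" "\<And>h. h \<in> carrier H \<Longrightarrow> f h = g h"
  shows "f = g"
  using assms by (auto simp: dual_simps intro: extensionalityI[of _ "carrier H"])

lemma dual_apply:
  assumes "h \<in> carrier H"
  shows "(f \<otimes>\<^bsub>D\<^esub> g) h = sw scalars (\<lambda>a b. f a * g b) h" "\<one>\<^bsub>D\<^esub> h = counit H h" "\<zero>\<^bsub>D\<^esub> h = 0"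
    "(f \<oplus>\<^bsub>D\<^esub> g) h = f h + g h" "(c \<odot>\<^bsub>D\<^esub> f) h = c * f h"
  using assms by (simp_all add: dual_simps)

lemma dual_bilinear: "f \<in> carrier D \<Longrightarrow> g \<in> carrier D \<Longrightarrow> (\<lambda>a b. f a * g b) \<in> bilinear_maps H H scalars"
  by (intro bilinear_scalars dual_linear)

lemma dual_mult_closed: "f \<in> carrier D \<Longrightarrow> g \<in> carrier D \<Longrightarrow> f \<otimes>\<^bsub>D\<^esub> g \<in> carrier D"
  unfolding dual_simps(2) by (intro dualI sw_linear scalars_algebra dual_bilinear)

lemma dual_add: "f \<in> carrier D \<Longrightarrow> g \<in> carrier H \<Longrightarrow> h \<in> carrier H \<Longrightarrow> f (g \<oplus> h) = f g + f h"
  and dual_smult: "f \<in> carrier D \<Longrightarrow> h \<in> carrier H \<Longrightarrow> f (c \<odot> h) = c * f h"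
  using linear_add[OF dual_linear] linear_smult[OF dual_linear] by auto

lemma sw_scalars_add:
  assumes "\<beta> \<in> bilinear_maps H H scalars" "\<gamma> \<in> bilinear_maps H H scalars" "h \<in> carrier H"
  shows "sw scalars (\<lambda>a b. \<beta> a b + \<gamma> a b) h = sw scalars \<beta> h + sw scalars \<gamma> h"
proof -
  interpret S: assoc_algebra "scalars :: ('k, 'k) module" by simp
  note lin = HHH.AB.tensor_lift_linear[OF scalars_algebra]
  have bil: "(\<lambda>a b. \<beta> a b + \<gamma> a b) \<in> bilinear_maps H H scalars"
    using S.linear_maps_add[OF is_assoc_algebra bilinear_left[OF assms(1)] bilinear_left[OF assms(2)]]
      S.linear_maps_add[OF is_assoc_algebra bilinear_right[OF assms(1)] bilinear_right[OF assms(2)]]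
    by (intro bilinear_mapsI) simp_all
  have "(\<lambda>t. tensor_lift scalars \<beta> t + tensor_lift scalars \<gamma> t) \<in> linear_maps (tensor H H) scalars"
    using S.linear_maps_add[OF HHH.AB.tensor_assoc_algebra lin[OF assms(1)] lin[OF assms(2)]] by simp
  then show ?thesis
    using assms bil
    by (intro HHH.AB.tensor_linear_eq[OF comult_closed lin]) (simp_all add: HHH.AB.tensor_lift_pure[OF scalars_algebra])
qed

lemma sw_scalars_mult:
  assumes "\<beta> \<in> bilinear_maps H H scalars" "h \<in> carrier H"
  shows "sw scalars (\<lambda>a b. c * \<beta> a b) h = c * sw scalars \<beta> h"
    and "sw scalars (\<lambda>a b. \<beta> a b * c) h = sw scalars \<beta> h * c"
  using sw_post[OF scalars_algebra scalars_algebra assms(1) linear_scalars_mult(1) assms(2), of c]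
    sw_post[OF scalars_algebra scalars_algebra assms(1) linear_scalars_mult(2) assms(2), of c] by simp_all

text \<open>Associativity of convolution is coassociativity of \<open>H\<close>, applied to the
  trilinear product of the three functionals.\<close>

lemma dual_mult_assoc:
  assumes f: "f \<in> carrier D" and g: "g \<in> carrier D" and k: "k \<in> carrier D"
  shows "f \<otimes>\<^bsub>D\<^esub> g \<otimes>\<^bsub>D\<^esub> k = f \<otimes>\<^bsub>D\<^esub> (g \<otimes>\<^bsub>D\<^esub> k)"
proof (rule dual_eqI)
  fix h assume h: "h \<in> carrier H"
  have "(f \<otimes>\<^bsub>D\<^esub> (g \<otimes>\<^bsub>D\<^esub> k)) h = sw scalars (\<lambda>a b. sw scalars (\<lambda>b1 b2. f a * (g b1 * k b2)) b) h"
    unfolding dual_apply(1)[OF h]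
    by (rule sw_cong[OF scalars_algebra dual_bilinear[OF f dual_mult_closed[OF g k]] h])
      (simp add: dual_apply sw_scalars_mult(1)[OF dual_bilinear[OF g k]])
  also have "\<dots> = sw scalars (\<lambda>a b. sw scalars (\<lambda>a1 a2. f a1 * (g a2 * k b)) a) h"
    using dual_add[OF f] dual_add[OF g] dual_add[OF k] dual_smult[OF f] dual_smult[OF g] dual_smult[OF k]
    by (intro sw_assoc[OF scalars_algebra h] linear_mapsI) (simp_all add: algebra_simps)
  also have "\<dots> = (f \<otimes>\<^bsub>D\<^esub> g \<otimes>\<^bsub>D\<^esub> k) h"
    unfolding dual_apply(1)[OF h]
    by (rule sw_cong[OF scalars_algebra dual_bilinear[OF dual_mult_closed[OF f g] k] h, symmetric])
      (simp add: dual_apply sw_scalars_mult(2)[OF dual_bilinear[OF f g], symmetric] mult.assoc)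
  finally show "(f \<otimes>\<^bsub>D\<^esub> g \<otimes>\<^bsub>D\<^esub> k) h = (f \<otimes>\<^bsub>D\<^esub> (g \<otimes>\<^bsub>D\<^esub> k)) h" ..
qed (intro dual_mult_closed assms)+

lemma dual_assoc_algebra: "assoc_algebra D"
proof (rule assoc_algebraI)
  interpret S: assoc_algebra "scalars :: ('k, 'k) module" by simp
  fix f g k c d
  assume f: "f \<in> carrier D"
  note lin = dual_linear[OF f]
  show smult: "c \<odot>\<^bsub>D\<^esub> f \<in> carrier D" for c
    unfolding dual_simps(6) using S.linear_maps_smult[OF lin] by (intro dualI) simp
  show "(c + d) \<odot>\<^bsub>D\<^esub> f = c \<odot>\<^bsub>D\<^esub> f \<oplus>\<^bsub>D\<^esub> d \<odot>\<^bsub>D\<^esub> f" "(c * d) \<odot>\<^bsub>D\<^esub> f = c \<odot>\<^bsub>D\<^esub> (d \<odot>\<^bsub>D\<^esub> f)"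
    "0 \<odot>\<^bsub>D\<^esub> f = \<zero>\<^bsub>D\<^esub>"
    by (auto simp: dual_simps fun_eq_iff algebra_simps)
  have one: "\<one>\<^bsub>D\<^esub> \<in> carrier D"
    unfolding dual_simps(3) by (intro dualI counit_linear)
  show "1 \<odot>\<^bsub>D\<^esub> f = f"
    by (rule dual_eqI[OF smult f]) (simp add: dual_apply)
  show "\<one>\<^bsub>D\<^esub> \<otimes>\<^bsub>D\<^esub> f = f"
  proof (rule dual_eqI[OF dual_mult_closed[OF one f] f])
    fix h assume h: "h \<in> carrier H"
    have "(\<one>\<^bsub>D\<^esub> \<otimes>\<^bsub>D\<^esub> f) h = sw scalars (\<lambda>a b. counit H a * f b) h"
      unfolding dual_apply(1)[OF h]
      by (rule sw_cong[OF scalars_algebra dual_bilinear[OF one f] h]) (simp add: dual_apply)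
    then show "(\<one>\<^bsub>D\<^esub> \<otimes>\<^bsub>D\<^esub> f) h = f h"
      using sw_counit_left[OF scalars_algebra lin h] by simp
  qed
  show "f \<otimes>\<^bsub>D\<^esub> \<one>\<^bsub>D\<^esub> = f"
  proof (rule dual_eqI[OF dual_mult_closed[OF f one] f])
    fix h assume h: "h \<in> carrier H"
    have "(f \<otimes>\<^bsub>D\<^esub> \<one>\<^bsub>D\<^esub>) h = sw scalars (\<lambda>a b. counit H b * f a) h"
      unfolding dual_apply(1)[OF h]
      by (rule sw_cong[OF scalars_algebra dual_bilinear[OF f one] h]) (simp add: dual_apply mult.commute)
    then show "(f \<otimes>\<^bsub>D\<^esub> \<one>\<^bsub>D\<^esub>) h = f h"
      using sw_counit_right[OF scalars_algebra lin h] by simp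
  qed
  have zero: "\<zero>\<^bsub>D\<^esub> \<in> carrier D"
    unfolding dual_simps(4) by (intro dualI linear_mapsI) simp_all
  have add: "f \<oplus>\<^bsub>D\<^esub> g \<in> carrier D" if "f \<in> carrier D" "g \<in> carrier D" for f g
    unfolding dual_simps(5)
    using S.linear_maps_add[OF is_assoc_algebra dual_linear[OF that(1)] dual_linear[OF that(2)]]
    by (intro dualI) simp
  show "\<zero>\<^bsub>D\<^esub> \<oplus>\<^bsub>D\<^esub> f = f"
    by (rule dual_eqI[OF add[OF zero f] f]) (simp add: dual_apply)
  assume g: "g \<in> carrier D"
  show "f \<oplus>\<^bsub>D\<^esub> g \<in> carrier D" "f \<otimes>\<^bsub>D\<^esub> g \<in> carrier D"
    using f g by (auto intro: add dual_mult_closed)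
  show "f \<oplus>\<^bsub>D\<^esub> g = g \<oplus>\<^bsub>D\<^esub> f" "c \<odot>\<^bsub>D\<^esub> (f \<oplus>\<^bsub>D\<^esub> g) = c \<odot>\<^bsub>D\<^esub> f \<oplus>\<^bsub>D\<^esub> c \<odot>\<^bsub>D\<^esub> g"
    by (auto simp: dual_simps fun_eq_iff algebra_simps)
  have scale: "c \<odot>\<^bsub>D\<^esub> f \<in> carrier D" if "f \<in> carrier D" for c f
    unfolding dual_simps(6) using S.linear_maps_smult[OF dual_linear[OF that]] by (intro dualI) simp
  show "c \<odot>\<^bsub>D\<^esub> f \<otimes>\<^bsub>D\<^esub> g = c \<odot>\<^bsub>D\<^esub> (f \<otimes>\<^bsub>D\<^esub> g)"
  proof (rule dual_eqI)
    fix h assume h: "h \<in> carrier H"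
    have "(c \<odot>\<^bsub>D\<^esub> f \<otimes>\<^bsub>D\<^esub> g) h = sw scalars (\<lambda>a b. c * (f a * g b)) h"
      unfolding dual_apply(1)[OF h]
      by (rule sw_cong[OF scalars_algebra dual_bilinear[OF scale[OF f] g] h]) (simp add: dual_apply)
    then show "(c \<odot>\<^bsub>D\<^esub> f \<otimes>\<^bsub>D\<^esub> g) h = (c \<odot>\<^bsub>D\<^esub> (f \<otimes>\<^bsub>D\<^esub> g)) h"
      using h by (simp add: dual_apply sw_scalars_mult(1)[OF dual_bilinear[OF f g]])
  qed (use f g in \<open>auto intro: scale dual_mult_closed\<close>)
  show "f \<otimes>\<^bsub>D\<^esub> (c \<odot>\<^bsub>D\<^esub> g) = c \<odot>\<^bsub>D\<^esub> (f \<otimes>\<^bsub>D\<^esub> g)"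
  proof (rule dual_eqI)
    fix h assume h: "h \<in> carrier H"
    have "(f \<otimes>\<^bsub>D\<^esub> (c \<odot>\<^bsub>D\<^esub> g)) h = sw scalars (\<lambda>a b. c * (f a * g b)) h"
      unfolding dual_apply(1)[OF h]
      by (rule sw_cong[OF scalars_algebra dual_bilinear[OF f scale[OF g]] h]) (simp add: dual_apply)
    then show "(f \<otimes>\<^bsub>D\<^esub> (c \<odot>\<^bsub>D\<^esub> g)) h = (c \<odot>\<^bsub>D\<^esub> (f \<otimes>\<^bsub>D\<^esub> g)) h"
      using h by (simp add: dual_apply sw_scalars_mult(1)[OF dual_bilinear[OF f g]])
  qed (use f g in \<open>auto intro: scale dual_mult_closed\<close>)
  assume k: "k \<in> carrier D"
  show "f \<oplus>\<^bsub>D\<^esub> g \<oplus>\<^bsub>D\<^esub> k = f \<oplus>\<^bsub>D\<^esub> (g \<oplus>\<^bsub>D\<^esub> k)"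
    by (auto simp: dual_simps fun_eq_iff)
  show "f \<otimes>\<^bsub>D\<^esub> g \<otimes>\<^bsub>D\<^esub> k = f \<otimes>\<^bsub>D\<^esub> (g \<otimes>\<^bsub>D\<^esub> k)"
    by (rule dual_mult_assoc[OF f g k])
  show "(f \<oplus>\<^bsub>D\<^esub> g) \<otimes>\<^bsub>D\<^esub> k = f \<otimes>\<^bsub>D\<^esub> k \<oplus>\<^bsub>D\<^esub> g \<otimes>\<^bsub>D\<^esub> k"
  proof (rule dual_eqI)
    fix h assume h: "h \<in> carrier H"
    have "((f \<oplus>\<^bsub>D\<^esub> g) \<otimes>\<^bsub>D\<^esub> k) h = sw scalars (\<lambda>a b. f a * k b + g a * k b) h"
      unfolding dual_apply(1)[OF h]
      by (rule sw_cong[OF scalars_algebra dual_bilinear[OF add[OF f g] k] h]) (simp add: dual_apply algebra_simps)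
    then show "((f \<oplus>\<^bsub>D\<^esub> g) \<otimes>\<^bsub>D\<^esub> k) h = (f \<otimes>\<^bsub>D\<^esub> k \<oplus>\<^bsub>D\<^esub> g \<otimes>\<^bsub>D\<^esub> k) h"
      using h by (simp add: dual_apply sw_scalars_add dual_bilinear f g k)
  qed (use f g k in \<open>auto intro: add dual_mult_closed\<close>)
  show "k \<otimes>\<^bsub>D\<^esub> (f \<oplus>\<^bsub>D\<^esub> g) = k \<otimes>\<^bsub>D\<^esub> f \<oplus>\<^bsub>D\<^esub> k \<otimes>\<^bsub>D\<^esub> g"
  proof (rule dual_eqI)
    fix h assume h: "h \<in> carrier H"
    have "(k \<otimes>\<^bsub>D\<^esub> (f \<oplus>\<^bsub>D\<^esub> g)) h = sw scalars (\<lambda>a b. k a * f b + k a * g b) h"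
      unfolding dual_apply(1)[OF h]
      by (rule sw_cong[OF scalars_algebra dual_bilinear[OF k add[OF f g]] h]) (simp add: dual_apply algebra_simps)
    then show "(k \<otimes>\<^bsub>D\<^esub> (f \<oplus>\<^bsub>D\<^esub> g)) h = (k \<otimes>\<^bsub>D\<^esub> f \<oplus>\<^bsub>D\<^esub> k \<otimes>\<^bsub>D\<^esub> g) h"
      using h by (simp add: dual_apply sw_scalars_add dual_bilinear f g k)
  qed (use f g k in \<open>auto intro: add dual_mult_closed\<close>)
next
  show "\<one>\<^bsub>D\<^esub> \<in> carrier D"
    unfolding dual_simps(3) by (intro dualI counit_linear)
  show "\<zero>\<^bsub>D\<^esub> \<in> carrier D"
    unfolding dual_simps(4) by (intro dualI linear_mapsI) simp_all
qed

sublocale DD: algebra_pair D D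
  by (intro algebra_pair.intro dual_assoc_algebra)

section \<open>The comultiplication of the dual as a relation\<close>

lemma ev_linear: "h \<in> carrier H \<Longrightarrow> (\<lambda>f. f h) \<in> linear_maps D scalars"
  by (intro linear_mapsI) (simp_all add: dual_apply)

text \<open>The functional on the tensor square of \<open>H\<close> that corresponds to a tensor of
  functionals, evaluated at the pure tensor of \<open>h\<close> and \<open>h'\<close>.\<close>

abbreviation ev :: "'a \<Rightarrow> 'a \<Rightarrow> (('a \<Rightarrow> 'k) \<times> ('a \<Rightarrow> 'k) \<Rightarrow>\<^sub>0 'k) set \<Rightarrow> 'k"
  where "ev h h' \<equiv> tensor_lift scalars (\<lambda>f g. f h * g h')"

lemma ev_bilinear:
  "h \<in> carrier H \<Longrightarrow> h' \<in> carrier H \<Longrightarrow> (\<lambda>f g. f h * g h') \<in> bilinear_maps D D scalars"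
  by (intro bilinear_scalars ev_linear)

lemma ev_tensor_linear:
  "h \<in> carrier H \<Longrightarrow> h' \<in> carrier H \<Longrightarrow> ev h h' \<in> linear_maps (tensor D D) scalars"
  by (intro DD.tensor_lift_linear scalars_algebra ev_bilinear)

lemma ev_pure:
  "h \<in> carrier H \<Longrightarrow> h' \<in> carrier H \<Longrightarrow> f \<in> carrier D \<Longrightarrow> g \<in> carrier D \<Longrightarrow>
    ev h h' (pure_tensor D D f g) = f h * g h'"
  by (intro DD.tensor_lift_pure scalars_algebra ev_bilinear)

lemma ev_param_bilinear:
  assumes "t \<in> carrier (tensor D D)" shows "(\<lambda>h h'. ev h h' t) \<in> bilinear_maps H H scalars"
  using assms
  by (intro bilinear_mapsI DD.tensor_lift_param scalars_algebra is_assoc_algebra ev_bilinear)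
    (auto intro!: linear_mapsI simp: dual_add dual_smult algebra_simps)

text \<open>The property singled out by the description in \<open>hopf_dual\<close>, kept as a
  relation so that it can be combined by algebra operations before a tensor is known to exist for
  every functional.\<close>

definition represents :: "(('a \<Rightarrow> 'k) \<times> ('a \<Rightarrow> 'k) \<Rightarrow>\<^sub>0 'k) set \<Rightarrow> ('a \<Rightarrow> 'k) \<Rightarrow> bool"
  where "represents t f \<longleftrightarrow> t \<in> carrier (tensor D D) \<and> f \<in> carrier D \<and>
    (\<forall>h\<in>carrier H. \<forall>h'\<in>carrier H. ev h h' t = f (h \<otimes> h'))"

text \<open>The embedding into functionals on the tensor square of \<open>H\<close> is
  multiplicative for convolution. Both sides are linear in \<open>s\<close> and in \<open>t\<close>;
  on pure tensors the double sum splits into a product of two convolutions.\<close>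

lemma ev_mult:
  assumes s: "s \<in> carrier (tensor D D)" and t: "t \<in> carrier (tensor D D)"
    and h: "h \<in> carrier H" and h': "h' \<in> carrier H"
  shows "ev h h' (s \<otimes>\<^bsub>tensor D D\<^esub> t) =
    sw scalars (\<lambda>h1 h2. sw scalars (\<lambda>h1' h2'. ev h1 h1' s * ev h2 h2' t) h') h"
proof -
  have bil: "(\<lambda>h1' h2'. ev h1 h1' s * ev h2 h2' t) \<in> bilinear_maps H H scalars"
    if "h1 \<in> carrier H" "h2 \<in> carrier H" "s \<in> carrier (tensor D D)" "t \<in> carrier (tensor D D)" for h1 h2 s t
    using that by (intro bilinear_scalars bilinear_left[OF ev_param_bilinear])
  have bil': "(\<lambda>h1 h2. sw scalars (\<lambda>h1' h2'. ev h1 h1' s * ev h2 h2' t) h') \<in> bilinear_maps H H scalars"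
    if s: "s \<in> carrier (tensor D D)" and t: "t \<in> carrier (tensor D D)" for s t
  proof (rule bilinear_mapsI)
    fix h1 assume h1: "h1 \<in> carrier H"
    show "(\<lambda>h2. sw scalars (\<lambda>h1' h2'. ev h1 h1' s * ev h2 h2' t) h') \<in> linear_maps H scalars"
      using h1 s t h'
      by (intro sw_param scalars_algebra is_assoc_algebra bil
          linear_comp[OF bilinear_right[OF ev_param_bilinear] linear_scalars_mult(1)])
  next
    fix h2 assume h2: "h2 \<in> carrier H"
    show "(\<lambda>h1. sw scalars (\<lambda>h1' h2'. ev h1 h1' s * ev h2 h2' t) h') \<in> linear_maps H scalars"
      using h2 s t h'
      by (intro sw_param scalars_algebra is_assoc_algebra bil
          linear_comp[OF bilinear_right[OF ev_param_bilinear] linear_scalars_mult(2)])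
  qed
  note lin = ev_tensor_linear[OF h h']
  have linR: "(\<lambda>t. sw scalars (\<lambda>h1 h2. sw scalars (\<lambda>h1' h2'. ev h1 h1' s * ev h2 h2' t) h') h)
      \<in> linear_maps (tensor D D) scalars" if s: "s \<in> carrier (tensor D D)" for s
    using s h h'
    by (intro sw_param scalars_algebra DD.tensor_assoc_algebra bil' bil
        linear_comp[OF ev_tensor_linear linear_scalars_mult(1)])
  have linL: "(\<lambda>s. sw scalars (\<lambda>h1 h2. sw scalars (\<lambda>h1' h2'. ev h1 h1' s * ev h2 h2' t) h') h)
      \<in> linear_maps (tensor D D) scalars"
    using t h h'
    by (intro sw_param scalars_algebra DD.tensor_assoc_algebra bil' bil
        linear_comp[OF ev_tensor_linear linear_scalars_mult(2)])
  show ?thesis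
  proof (rule DD.tensor_linear_eq[OF s linear_comp[OF DD.T.linear_maps_mult_right[OF t] lin] linL])
    fix f g assume fg: "f \<in> carrier D" "g \<in> carrier D"
    then have pfg: "pure_tensor D D f g \<in> carrier (tensor D D)"
      by simp
    show "ev h h' (pure_tensor D D f g \<otimes>\<^bsub>tensor D D\<^esub> t) =
      sw scalars (\<lambda>h1 h2. sw scalars (\<lambda>h1' h2'. ev h1 h1' (pure_tensor D D f g) * ev h2 h2' t) h') h"
    proof (rule DD.tensor_linear_eq[OF t linear_comp[OF DD.T.linear_maps_mult_left[OF pfg] lin] linR[OF pfg]])
      fix f' g' assume fg': "f' \<in> carrier D" "g' \<in> carrier D"
      then have pfg': "pure_tensor D D f' g' \<in> carrier (tensor D D)"
        by simp
      have "sw scalars (\<lambda>h1 h2. sw scalars (\<lambda>h1' h2'. ev h1 h1' (pure_tensor D D f g) * ev h2 h2' (pure_tensor D D f' g')) h') h =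
        sw scalars (\<lambda>h1 h2. (f h1 * f' h2) * (g \<otimes>\<^bsub>D\<^esub> g') h') h"
      proof (rule sw_cong[OF scalars_algebra bil'[OF pfg pfg'] h])
        fix h1 h2 assume hs: "h1 \<in> carrier H" "h2 \<in> carrier H"
        have "sw scalars (\<lambda>h1' h2'. ev h1 h1' (pure_tensor D D f g) * ev h2 h2' (pure_tensor D D f' g')) h' =
          sw scalars (\<lambda>h1' h2'. (f h1 * f' h2) * (g h1' * g' h2')) h'"
          using hs fg fg'
          by (intro sw_cong[OF scalars_algebra bil[OF hs pfg pfg'] h']) (simp add: ev_pure algebra_simps)
        then show "sw scalars (\<lambda>h1' h2'. ev h1 h1' (pure_tensor D D f g) * ev h2 h2' (pure_tensor D D f' g')) h' =
          (f h1 * f' h2) * (g \<otimes>\<^bsub>D\<^esub> g') h'"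
          using h' fg fg' by (simp add: dual_apply sw_scalars_mult(1)[OF dual_bilinear])
      qed
      also have "\<dots> = (f \<otimes>\<^bsub>D\<^esub> f') h * (g \<otimes>\<^bsub>D\<^esub> g') h'"
        using h fg fg' by (simp add: dual_apply(1)[OF h] sw_scalars_mult(2)[OF dual_bilinear])
      also have "\<dots> = ev h h' (pure_tensor D D f g \<otimes>\<^bsub>tensor D D\<^esub> pure_tensor D D f' g')"
        using h h' fg fg' by (simp add: DD.pt_mult ev_pure dual_mult_closed)
      finally show "ev h h' (pure_tensor D D f g \<otimes>\<^bsub>tensor D D\<^esub> pure_tensor D D f' g') =
        sw scalars (\<lambda>h1 h2. sw scalars (\<lambda>h1' h2'. ev h1 h1' (pure_tensor D D f g) * ev h2 h2' (pure_tensor D D f' g')) h') h" ..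
    qed
  qed
qed

text \<open>Multiplicativity of the comultiplication of \<open>H\<close> turns the convolution of
  \<open>f\<close> and \<open>g\<close> at \<open>h \<otimes> h'\<close> into a double Sweedler sum,
  which \<open>ev_mult\<close> recognizes as evaluation of the product tensor.\<close>

lemma represents_mult:
  assumes "represents s f" "represents t g"
  shows "represents (s \<otimes>\<^bsub>tensor D D\<^esub> t) (f \<otimes>\<^bsub>D\<^esub> g)"
proof -
  have s: "s \<in> carrier (tensor D D)" "f \<in> carrier D" "\<And>h h'. h \<in> carrier H \<Longrightarrow> h' \<in> carrier H \<Longrightarrow> ev h h' s = f (h \<otimes> h')"
    and t: "t \<in> carrier (tensor D D)" "g \<in> carrier D" "\<And>h h'. h \<in> carrier H \<Longrightarrow> h' \<in> carrier H \<Longrightarrow> ev h h' t = g (h \<otimes> h')"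
    using assms by (auto simp: represents_def)
  have "ev h h' (s \<otimes>\<^bsub>tensor D D\<^esub> t) = (f \<otimes>\<^bsub>D\<^esub> g) (h \<otimes> h')" if h: "h \<in> carrier H" "h' \<in> carrier H" for h h'
  proof -
    have "(f \<otimes>\<^bsub>D\<^esub> g) (h \<otimes> h') =
      sw scalars (\<lambda>h1 h2. sw scalars (\<lambda>h1' h2'. f (h1 \<otimes> h1') * g (h2 \<otimes> h2')) h') h"
      using h s t by (simp add: dual_apply sw_mult[OF scalars_algebra dual_bilinear])
    also have "\<dots> = sw scalars (\<lambda>h1 h2. sw scalars (\<lambda>h1' h2'. ev h1 h1' s * ev h2 h2' t) h') h"
    proof (rule sw_cong[OF scalars_algebra _ h(1)])
      have bil: "(\<lambda>h1' h2'. f (h1 \<otimes> h1') * g (h2 \<otimes> h2')) \<in> bilinear_maps H H scalars"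
        if "h1 \<in> carrier H" "h2 \<in> carrier H" for h1 h2
        using that s t by (intro bilinear_scalars linear_comp[OF linear_maps_mult_left dual_linear])
      show "sw scalars (\<lambda>h1' h2'. f (h1 \<otimes> h1') * g (h2 \<otimes> h2')) h' =
          sw scalars (\<lambda>h1' h2'. ev h1 h1' s * ev h2 h2' t) h'" if "h1 \<in> carrier H" "h2 \<in> carrier H" for h1 h2
        by (rule sw_cong[OF scalars_algebra bil[OF that] h(2)]) (simp add: s(3) t(3) that)
      show "(\<lambda>h1 h2. sw scalars (\<lambda>h1' h2'. f (h1 \<otimes> h1') * g (h2 \<otimes> h2')) h') \<in> bilinear_maps H H scalars"
      proof (rule bilinear_mapsI)
        fix h1 assume "h1 \<in> carrier H"
        then show "(\<lambda>h2. sw scalars (\<lambda>h1' h2'. f (h1 \<otimes> h1') * g (h2 \<otimes> h2')) h') \<in> linear_maps H scalars"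
          using h s t
          by (intro sw_param scalars_algebra is_assoc_algebra bil
              linear_comp[OF linear_comp[OF linear_maps_mult_right dual_linear] linear_scalars_mult(1)])
      next
        fix h2 assume "h2 \<in> carrier H"
        then show "(\<lambda>h1. sw scalars (\<lambda>h1' h2'. f (h1 \<otimes> h1') * g (h2 \<otimes> h2')) h') \<in> linear_maps H scalars"
          using h s t
          by (intro sw_param scalars_algebra is_assoc_algebra bil
              linear_comp[OF linear_comp[OF linear_maps_mult_right dual_linear] linear_scalars_mult(2)])
      qed
    qed
    finally show ?thesis
      unfolding ev_mult[OF s(1) t(1) h] by simp
  qed
  then show ?thesis
    using s t by (simp add: represents_def dual_mult_closed)
qed

lemma represents_one: "represents \<one>\<^bsub>tensor D D\<^esub> \<one>\<^bsub>D\<^esub>"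
  using algebra_hom_mult[OF counit_hom]
  by (simp add: represents_def DD.tensor_one ev_pure dual_apply)

lemma represents_add:
  assumes "represents s f" "represents t g" shows "represents (s \<oplus>\<^bsub>tensor D D\<^esub> t) (f \<oplus>\<^bsub>D\<^esub> g)"
  using assms linear_add[OF ev_tensor_linear] by (simp add: represents_def dual_apply)

lemma represents_smult:
  assumes "represents t f" shows "represents (c \<odot>\<^bsub>tensor D D\<^esub> t) (c \<odot>\<^bsub>D\<^esub> f)"
  using assms linear_smult[OF ev_tensor_linear] by (simp add: represents_def dual_apply)

text \<open>The difference of the two tensors is annihilated by every pair of evaluations.
  Evaluations at elements of \<open>H\<close> separate functionals, so
  \<open>tensor_separating\<close> makes it zero. Hence the description in \<open>hopf_dual\<close>
  is unambiguous.\<close>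

lemma represents_unique:
  assumes "represents s f" "represents t f" shows "s = t"
proof -
  have st: "s \<in> carrier (tensor D D)" "t \<in> carrier (tensor D D)"
    using assms by (auto simp: represents_def)
  have "s \<ominus>\<^bsub>tensor D D\<^esub> t = \<zero>\<^bsub>tensor D D\<^esub>"
  proof (rule DD.tensor_separating[where evA = "\<lambda>f h. f h" and evB = "\<lambda>f h. f h"])
    fix h h' assume h: "h \<in> carrier H" "h' \<in> carrier H"
    have "ev h h' (s \<ominus>\<^bsub>tensor D D\<^esub> t) = ev h h' s + (- 1) * ev h h' t"
      using st linear_add[OF ev_tensor_linear[OF h], of s "\<ominus>\<^bsub>tensor D D\<^esub> t"]
        linear_smult[OF ev_tensor_linear[OF h], of t "- 1"]
      by (simp add: a_minus_def DD.T.smult_minus_1)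
    then show "ev h h' (s \<ominus>\<^bsub>tensor D D\<^esub> t) = 0"
      using assms h by (simp add: represents_def)
  next
    show "f = \<zero>\<^bsub>D\<^esub>" if "f \<in> carrier D" "\<And>h. h \<in> carrier H \<Longrightarrow> f h = 0" for f
      using that by (intro dual_eqI) (simp_all add: dual_apply)
    then show "f = \<zero>\<^bsub>D\<^esub>" if "f \<in> carrier D" "\<And>h. h \<in> carrier H \<Longrightarrow> f h = 0" for f
      using that by blast
  qed (use st in \<open>simp_all add: ev_linear\<close>)
  then show ?thesis
    using st by (simp add: DD.T.r_right_minus_eq)
qed

lemma comult_dual: "represents t f \<Longrightarrow> comult (hopf_dual H) f = t"
  unfolding hopf_dual_def hopf.simps
  by (rule the_equality) (simp_all add: represents_def represents_unique[of _ f t])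

lemma hopf_dual_simps:
  "carrier (hopf_dual H) = carrier D" "monoid.mult (hopf_dual H) = monoid.mult D"
  "one (hopf_dual H) = one D" "ring.zero (hopf_dual H) = ring.zero D"
  "add (hopf_dual H) = add D" "module.smult (hopf_dual H) = module.smult D"
  by (simp_all add: hopf_dual_def)

lemma hopf_dual_assoc_algebra: "assoc_algebra (hopf_dual H)"
  by (rule assoc_algebraI; simp only: hopf_dual_simps)
    (simp_all add: DD.A.m_assoc DD.A.a_ac DD.A.l_distr DD.A.r_distr DD.A.smult_add_left DD.A.smult_add_right
       DD.A.smult_smult DD.A.smult_mult_left DD.A.smult_mult_right)

lemma tensor_hopf_dual: "tensor (hopf_dual H) (hopf_dual H) = tensor D D"
  by (simp add: tensor_def bilinearity_def DirProd_def hopf_dual_simps)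

lemma pure_tensor_hopf_dual: "pure_tensor (hopf_dual H) (hopf_dual H) = pure_tensor D D"
  by (simp add: pure_tensor_def bilinearity_def DirProd_def hopf_dual_simps fun_eq_iff)

lemma tensor_map_hopf_dual: "tensor_map (hopf_dual H) (hopf_dual H) = tensor_map D D"
  by (simp add: tensor_map_def tensor_hopf_dual pure_tensor_hopf_dual fun_eq_iff)

lemma algebra_homs_hopf_dual: "algebra_homs B (hopf_dual H) = algebra_homs B D"
  by (simp add: algebra_homs_def linear_maps_def ring_hom_def hopf_dual_simps)

section \<open>The antipode of the dual\<close>

definition transpose_antipode :: "('a \<Rightarrow> 'k) \<Rightarrow> 'a \<Rightarrow> 'k"
  where "transpose_antipode f = (\<lambda>h\<in>carrier H. f (antipode H h))"

lemma antipode_hopf_dual: "antipode (hopf_dual H) = transpose_antipode"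
  by (simp add: hopf_dual_def transpose_antipode_def fun_eq_iff)

lemma counit_hopf_dual: "counit (hopf_dual H) f = f \<one>"
  by (simp add: hopf_dual_def)

lemma transpose_antipode_linear: "transpose_antipode \<in> linear_maps D D"
proof (rule linear_mapsI)
  show "transpose_antipode f \<in> carrier D" if "f \<in> carrier D" for f
    unfolding transpose_antipode_def
    by (intro dualI linear_comp[OF antipode_linear dual_linear[OF that]])
qed (auto simp: transpose_antipode_def dual_simps fun_eq_iff)

text \<open>Evaluated at \<open>h\<close>, the left side is the sum of
  \<open>f (h\<^sub>1 s(h\<^sub>2))\<close>, which the antipode axiom of \<open>H\<close> turns into
  \<open>f \<one>\<close> times the counit of \<open>h\<close>. This is the shape required by
  \<open>antipode_unique\<close>.\<close>

lemma transpose_antipode_right: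
  assumes "represents t f"
  shows "tensor_lift D (\<lambda>f g. f \<otimes>\<^bsub>D\<^esub> transpose_antipode g) t = f \<one> \<odot>\<^bsub>D\<^esub> \<one>\<^bsub>D\<^esub>"
proof -
  let ?\<beta> = "\<lambda>f g. f \<otimes>\<^bsub>D\<^esub> transpose_antipode g"
  have t: "t \<in> carrier (tensor D D)" and f: "f \<in> carrier D"
    using assms by (auto simp: represents_def)
  have rep: "ev h h' t = f (h \<otimes> h')" if "h \<in> carrier H" "h' \<in> carrier H" for h h'
    using assms that by (auto simp: represents_def)
  have bil: "?\<beta> \<in> bilinear_maps D D D"
    by (rule bilinear_comp[OF DD.A.bilinear_mult linear_id(1) transpose_antipode_linear])
  note lin = DD.tensor_lift_linear[OF dual_assoc_algebra bil]
  show ?thesis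
  proof (rule dual_eqI)
    show "tensor_lift D ?\<beta> t \<in> carrier D"
      using t by (rule linear_closed[OF lin])
    show "f \<one> \<odot>\<^bsub>D\<^esub> \<one>\<^bsub>D\<^esub> \<in> carrier D"
      by simp
    fix h assume h: "h \<in> carrier H"
    have bil2: "(\<lambda>h1 h2. ev h1 (antipode H h2) t) \<in> bilinear_maps H H scalars" if "t \<in> carrier (tensor D D)" for t
      by (rule bilinear_comp[OF ev_param_bilinear[OF that] linear_id(1) antipode_linear])
    have "(\<lambda>t. sw scalars (\<lambda>h1 h2. ev h1 (antipode H h2) t) h) \<in> linear_maps (tensor D D) scalars"
      using h by (intro sw_param scalars_algebra DD.tensor_assoc_algebra bil2 ev_tensor_linear) simp_all
    then have "tensor_lift D ?\<beta> t h = sw scalars (\<lambda>h1 h2. ev h1 (antipode H h2) t) h"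
    proof (rule DD.tensor_linear_eq[OF t linear_comp[OF lin ev_linear[OF h]]])
      fix f g assume fg: "f \<in> carrier D" "g \<in> carrier D"
      then have pfg: "pure_tensor D D f g \<in> carrier (tensor D D)" "transpose_antipode g \<in> carrier D"
        by (simp_all add: linear_closed[OF transpose_antipode_linear])
      have "tensor_lift D ?\<beta> (pure_tensor D D f g) h = sw scalars (\<lambda>h1 h2. f h1 * transpose_antipode g h2) h"
        using fg h by (simp add: DD.tensor_lift_pure[OF dual_assoc_algebra bil] dual_apply)
      also have "\<dots> = sw scalars (\<lambda>h1 h2. ev h1 (antipode H h2) (pure_tensor D D f g)) h"
        using fg pfg h
        by (intro sw_cong[OF scalars_algebra dual_bilinear]) (simp_all add: ev_pure, simp add: transpose_antipode_def)
      finally show "tensor_lift D ?\<beta> (pure_tensor D D f g) h = sw scalars (\<lambda>h1 h2. ev h1 (antipode H h2) (pure_tensor D D f g)) h" .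
    qed
    also have "\<dots> = sw scalars (\<lambda>h1 h2. f (h1 \<otimes> antipode H h2)) h"
      using h by (intro sw_cong[OF scalars_algebra bil2[OF t]]) (simp_all add: rep)
    also have "\<dots> = f (sw H (\<lambda>h1 h2. h1 \<otimes> antipode H h2) h)"
      by (rule sw_post[OF is_assoc_algebra scalars_algebra
        bilinear_comp[OF bilinear_mult linear_id(1) antipode_linear] dual_linear[OF f] h, symmetric])
    also have "\<dots> = (f \<one> \<odot>\<^bsub>D\<^esub> \<one>\<^bsub>D\<^esub>) h"
      using h f by (simp add: antipode_right dual_smult dual_apply mult.commute)
    finally show "tensor_lift D ?\<beta> t h = (f \<one> \<odot>\<^bsub>D\<^esub> \<one>\<^bsub>D\<^esub>) h" .
  qed
qed

end

text \<open>Compatibility with antipodes is not a premise. Pulled back along \<open>\<psi>\<close>,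
  the transposed antipode of \<open>H\<close> becomes a right convolution inverse \<open>S\<close>
  of the identity of \<open>K\<close>, and therefore equals the antipode of
  \<open>K\<close>.\<close>

theorem hopf_dual_isomorphicI:
  fixes H :: "('k::field, 'a, 'm) hopf_scheme" and K :: "('k, 'b, 'n) hopf_scheme"
  assumes H: "hopf_algebra H" and K: "hopf_algebra K"
    and \<psi>: "\<psi> \<in> algebra_homs K (dual_algebra H)" and bij: "bij_betw \<psi> (carrier K) (carrier (dual_algebra H))"
    and rep: "\<And>k. k \<in> carrier K \<Longrightarrow>
      hopf_algebra.represents H (tensor_map (dual_algebra H) (dual_algebra H) \<psi> \<psi> (comult K k)) (\<psi> k)"
    and counit: "\<And>k. k \<in> carrier K \<Longrightarrow> \<psi> k \<one>\<^bsub>H\<^esub> = counit K k"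
  shows "hopf_isomorphic (hopf_dual H) K"
proof -
  interpret H: hopf_algebra H by fact
  interpret K: hopf_algebra K by fact
  note lin = algebra_hom_linear[OF \<psi>]
  interpret P: algebra_pair_maps K K H.D H.D \<psi> \<psi>
    by unfold_locales (simp_all add: lin)
  define S where "S k = inv_into (carrier K) \<psi> (H.transpose_antipode (\<psi> k))" for k
  have inv: "inv_into (carrier K) \<psi> (\<psi> k) = k" if "k \<in> carrier K" for k
    using bij that by (simp add: bij_betw_def)
  have ex: "\<exists>k\<in>carrier K. f = \<psi> k" if "f \<in> carrier H.D" for f
    using bij that by (auto simp: bij_betw_def)
  have \<psi>_closed: "\<psi> k \<in> carrier H.D" if "k \<in> carrier K" for k
    using that by (rule linear_closed[OF lin])
  have T_closed: "H.transpose_antipode (\<psi> k) \<in> carrier H.D" if "k \<in> carrier K" for k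
    using that \<psi>_closed linear_closed[OF H.transpose_antipode_linear] by blast
  have S_closed: "S k \<in> carrier K" and \<psi>_S: "\<psi> (S k) = H.transpose_antipode (\<psi> k)" if "k \<in> carrier K" for k
    using ex[OF T_closed[OF that]] inv by (auto simp: S_def)
  have inj: "k = l" if "\<psi> k = \<psi> l" "k \<in> carrier K" "l \<in> carrier K" for k l
    using that inv by metis
  note T_lin = H.transpose_antipode_linear
  have S_lin: "S \<in> linear_maps K K"
    by (intro linear_mapsI; (rule inj)?)
      (simp_all add: S_closed \<psi>_S \<psi>_closed linear_add[OF lin] linear_smult[OF lin] linear_add[OF T_lin] linear_smult[OF T_lin])
  have S: "S k = antipode K k" if k: "k \<in> carrier K" for k
  proof (rule K.antipode_unique[OF S_lin _ k])
    fix k assume k: "k \<in> carrier K"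
    have bilS: "(\<lambda>a b. a \<otimes>\<^bsub>K\<^esub> S b) \<in> bilinear_maps K K K"
      by (rule bilinear_comp[OF K.bilinear_mult linear_id(1) S_lin])
    have bilT: "(\<lambda>f g. f \<otimes>\<^bsub>H.D\<^esub> H.transpose_antipode g) \<in> bilinear_maps H.D H.D H.D"
      by (rule bilinear_comp[OF H.DD.A.bilinear_mult linear_id(1) T_lin])
    show "K.sw K (\<lambda>a b. a \<otimes>\<^bsub>K\<^esub> S b) k = counit K k \<odot>\<^bsub>K\<^esub> \<one>\<^bsub>K\<^esub>"
    proof (rule inj)
      have "\<psi> (K.sw K (\<lambda>a b. a \<otimes>\<^bsub>K\<^esub> S b) k) = K.sw H.D (\<lambda>a b. \<psi> (a \<otimes>\<^bsub>K\<^esub> S b)) k"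
        by (rule K.sw_post[OF K.is_assoc_algebra H.dual_assoc_algebra bilS lin k])
      also have "\<dots> = K.sw H.D (\<lambda>a b. \<psi> a \<otimes>\<^bsub>H.D\<^esub> H.transpose_antipode (\<psi> b)) k"
        by (rule K.sw_cong[OF H.dual_assoc_algebra bilinear_post[OF bilS lin] k])
          (simp add: algebra_hom_mult[OF \<psi>] S_closed \<psi>_S)
      also have "\<dots> = tensor_lift H.D (\<lambda>f g. f \<otimes>\<^bsub>H.D\<^esub> H.transpose_antipode g) (tensor_map H.D H.D \<psi> \<psi> (comult K k))"
        using k by (intro P.tensor_lift_map[OF H.dual_assoc_algebra bilT, symmetric]) simp
      also have "\<dots> = counit K k \<odot>\<^bsub>H.D\<^esub> \<one>\<^bsub>H.D\<^esub>"
        using H.transpose_antipode_right[OF rep[OF k]] counit[OF k] by simp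
      also have "\<dots> = \<psi> (counit K k \<odot>\<^bsub>K\<^esub> \<one>\<^bsub>K\<^esub>)"
        by (simp add: linear_smult[OF lin] algebra_hom_one[OF \<psi>])
      finally show "\<psi> (K.sw K (\<lambda>a b. a \<otimes>\<^bsub>K\<^esub> S b) k) = \<psi> (counit K k \<odot>\<^bsub>K\<^esub> \<one>\<^bsub>K\<^esub>)" .
      show "K.sw K (\<lambda>a b. a \<otimes>\<^bsub>K\<^esub> S b) k \<in> carrier K"
        by (rule linear_closed[OF K.sw_linear[OF K.is_assoc_algebra bilS] k])
    qed simp
  qed
  show ?thesis
  proof (rule hopf_isomorphic_transport[OF K H.hopf_dual_assoc_algebra])
    show "\<psi> \<in> algebra_homs K (hopf_dual H)"
      by (simp add: H.algebra_homs_hopf_dual \<psi>)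
    show "bij_betw \<psi> (carrier K) (carrier (hopf_dual H))"
      by (simp add: H.hopf_dual_simps bij)
    fix k assume k: "k \<in> carrier K"
    show "comult (hopf_dual H) (\<psi> k) = tensor_map (hopf_dual H) (hopf_dual H) \<psi> \<psi> (comult K k)"
      using H.comult_dual[OF rep[OF k]] by (simp add: H.tensor_map_hopf_dual)
    show "counit (hopf_dual H) (\<psi> k) = counit K k"
      using counit[OF k] by (simp add: H.counit_hopf_dual)
    show "antipode (hopf_dual H) (\<psi> k) = \<psi> (antipode K k)"
      using \<psi>_S[OF k] S[OF k] by (simp add: H.antipode_hopf_dual)
  qed
qed

section \<open>Roots of unity\<close>

lemma primitive_rootD: "primitive_root_of_unity n \<omega> \<Longrightarrow> 0 < m \<Longrightarrow> m < n \<Longrightarrow> \<omega> ^ m \<noteq> 1"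
  by (simp add: primitive_root_of_unity_def)

lemma primitive_root_power_inj:
  assumes "primitive_root_of_unity n \<omega>" "i < n" "j < n" "\<omega> ^ i = \<omega> ^ j" shows "i = j"
proof -
  have nz: "\<omega> \<noteq> 0"
    using assms(1) by (auto simp: primitive_root_of_unity_def power_0_left)
  have "i' = j'" if le: "i' \<le> j'" and lt: "j' < n" and eq: "\<omega> ^ i' = \<omega> ^ j'" for i' j'
  proof -
    have "\<omega> ^ j' = \<omega> ^ i' * \<omega> ^ (j' - i')"
      using le by (simp flip: power_add)
    then have "\<omega> ^ (j' - i') = 1"
      using eq nz by simp
    moreover have "j' - i' < n"
      using lt by simp
    ultimately have "\<not> 0 < j' - i'"
      using primitive_rootD[OF assms(1), of "j' - i'"] by blast
    then show ?thesis
      using le by simp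
  qed
  then show ?thesis
    using assms(2-4) by (metis nat_le_linear)
qed

text \<open>The \<open>n\<close> distinct powers of \<open>\<omega>\<close> are roots of
  \<open>X^n - 1\<close>, which has at most \<open>n\<close> roots, so \<open>q\<close> is among
  them.\<close>

lemma root_of_unity_power:
  assumes "primitive_root_of_unity n \<omega>" "q ^ n = 1"
  obtains i where "i < n" "q = \<omega> ^ i"
proof -
  have n: "0 < n"
    using assms(1) by (simp add: primitive_root_of_unity_def)
  let ?p = "monom 1 n - 1 :: 'a poly"
  have deg: "degree ?p \<le> n"
    by (intro degree_diff_le degree_monom_le) simp
  have "coeff ?p n = 1"
    using n by simp
  then have "?p \<noteq> 0"
    by (metis coeff_0 zero_neq_one)
  then have fin: "finite {z. poly ?p z = 0}" and card: "card {z. poly ?p z = 0} \<le> n"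
    using poly_roots_finite[of ?p] card_poly_roots_bound[of ?p] deg by auto
  have "inj_on (\<lambda>i. \<omega> ^ i) {..<n}"
    using primitive_root_power_inj[OF assms(1)] by (auto intro: inj_onI)
  then have "card ((\<lambda>i. \<omega> ^ i) ` {..<n}) = n"
    by (simp add: card_image)
  moreover have sub: "(\<lambda>i. \<omega> ^ i) ` {..<n} \<subseteq> {z. poly ?p z = 0}"
  proof
    fix z assume "z \<in> (\<lambda>i. \<omega> ^ i) ` {..<n}"
    then obtain i where "z = \<omega> ^ i"
      by blast
    then have "z ^ n = (\<omega> ^ n) ^ i"
      by (metis mult.commute power_mult)
    then show "z \<in> {z. poly ?p z = 0}"
      using assms(1) by (simp add: poly_monom primitive_root_of_unity_def)
  qed
  ultimately have "(\<lambda>i. \<omega> ^ i) ` {..<n} = {z. poly ?p z = 0}"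
    using card_seteq[OF fin sub] card by simp
  moreover have "q \<in> {z. poly ?p z = 0}"
    using assms(2) by (simp add: poly_monom)
  ultimately show ?thesis
    using that by blast
qed

text \<open>If \<open>n\<close> were zero in the field, then \<open>1 + X + ... + X^(n-1)\<close>
  would vanish at all \<open>n\<close> powers of \<open>\<omega>\<close>, including
  \<open>1\<close>, where its value is \<open>n\<close>. Its degree is too small for that.\<close>

lemma primitive_root_of_nat_nonzero:
  assumes "primitive_root_of_unity n (\<omega> :: 'k::field)" shows "(of_nat n :: 'k) \<noteq> 0"
proof
  assume zero: "(of_nat n :: 'k) = 0"
  have n: "0 < n"
    using assms by (simp add: primitive_root_of_unity_def)
  let ?p = "\<Sum>i<n. monom 1 i :: 'k poly"
  have eval: "poly ?p z = gauss_number z n" for z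
    by (simp add: poly_sum poly_monom gauss_number_def)
  have "poly ?p (\<omega> ^ i) = 0" if "i < n" for i
  proof (cases "i = 0")
    case True
    then show ?thesis
      using zero by (simp add: eval gauss_number_def)
  next
    case False
    then have "\<omega> ^ i \<noteq> 1"
      using assms that by (auto simp: primitive_root_of_unity_def)
    moreover have "(\<omega> ^ i) ^ n = 1"
      using assms by (metis mult.commute power_mult power_one primitive_root_of_unity_def)
    ultimately show ?thesis
      using gauss_number_eq[of "\<omega> ^ i" n] by (simp add: eval)
  qed
  then have sub: "(\<lambda>i. \<omega> ^ i) ` {..<n} \<subseteq> {z. poly ?p z = 0}"
    by auto
  have coeff: "coeff ?p j = (if j < n then 1 else 0)" for j
    by (simp add: coeff_sum)
  have "?p \<noteq> 0"
    using coeff[of 0] n by (metis coeff_0 zero_neq_one)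
  moreover have "degree ?p < n"
    using n by (intro degree_lessI) (auto simp: coeff)
  moreover have "card ((\<lambda>i. \<omega> ^ i) ` {..<n}) = n"
    using primitive_root_power_inj[OF assms] by (subst card_image) (auto intro: inj_onI)
  ultimately show False
    using card_mono[OF poly_roots_finite sub] card_poly_roots_bound[of ?p] by simp
qed

text \<open>A geometric sum in the ratio \<open>\<omega>^(j - i)\<close>. The ratio is written with
  an inverse because the exponents are natural numbers; it is \<open>1\<close> only for
  \<open>i = j\<close>, and its \<open>n\<close>th power is always \<open>1\<close>.\<close>

lemma root_orthogonality:
  assumes \<omega>: "primitive_root_of_unity n \<omega>" and "i < n" "j < n"
  shows "(\<Sum>s<n. inverse (\<omega> ^ (i * s)) * \<omega> ^ (j * s)) = (if i = j then of_nat n else 0)"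
proof -
  have nz: "\<omega> \<noteq> 0"
    using \<omega> by (auto simp: primitive_root_of_unity_def power_0_left)
  let ?c = "inverse (\<omega> ^ i) * \<omega> ^ j"
  have "(\<Sum>s<n. inverse (\<omega> ^ (i * s)) * \<omega> ^ (j * s)) = gauss_number ?c n"
    unfolding gauss_number_def
    by (intro sum.cong) (simp_all add: power_mult_distrib power_mult power_inverse)
  also have "\<dots> = (if i = j then of_nat n else 0)"
  proof (cases "i = j")
    case True
    then show ?thesis
      using nz by (simp add: gauss_number_def)
  next
    case False
    have "?c \<noteq> 1"
      using nz primitive_root_power_inj[OF assms] False by (auto simp: field_simps)
    moreover have "?c ^ n = 1"
    proof -
      have "(\<omega> ^ i) ^ n = 1" "(\<omega> ^ j) ^ n = 1"
        using \<omega> by (metis mult.commute power_mult power_one primitive_root_of_unity_def)+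
      then show ?thesis
        by (simp add: power_mult_distrib power_inverse)
    qed
    ultimately show ?thesis
      using gauss_number_eq[of ?c n] False by simp
  qed
  finally show ?thesis .
qed

text \<open>This supplies the first index of the dual. If \<open>n\<close> divides
  \<open>k m\<close>, then \<open>n / (n, k)\<close> divides \<open>m\<close>, because it is coprime
  to \<open>k / (n, k)\<close>.\<close>

lemma primitive_root_power_gcd:
  assumes "primitive_root_of_unity n \<omega>"
  shows "primitive_root_of_unity (n div gcd n k) (\<omega> ^ k)"
  unfolding primitive_root_of_unity_def
proof (intro conjI allI impI)
  have n: "0 < n"
    using assms by (simp add: primitive_root_of_unity_def)
  show "0 < n div gcd n k"
    using n by (simp add: div_greater_zero_iff dvd_imp_le)
  have "k * (n div gcd n k) = n * (k div gcd n k)"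
    by (metis div_mult_swap dvd_div_mult gcd_dvd1 gcd_dvd2 mult.commute)
  then show "(\<omega> ^ k) ^ (n div gcd n k) = 1"
    using assms by (metis power_mult power_one primitive_root_of_unity_def)
  fix m assume m: "0 < m \<and> m < n div gcd n k"
  show "(\<omega> ^ k) ^ m \<noteq> 1"
  proof
    assume "(\<omega> ^ k) ^ m = 1"
    then have "n dvd k * m"
      using primitive_root_power_eq_1[OF assms] by (simp flip: power_mult)
    then have "n div gcd n k dvd (k div gcd n k) * m"
      by (metis div_dvd_div dvd_div_mult dvd_mult2 gcd_dvd1 gcd_dvd2)
    moreover have "coprime (n div gcd n k) (k div gcd n k)"
      using n by (intro div_gcd_coprime) simp
    ultimately have "n div gcd n k dvd m"
      using coprime_dvd_mult_right_iff by blast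
    then show False
      using m by (auto dest: dvd_imp_le)
  qed
qed

section \<open>The dual of \<open>H\<^bsub>n,q,N,\<nu>\<^esub>\<close>\<close>

text \<open>Upper triangular 2 by 2 matrices: \<open>p\<close> and \<open>s\<close> are the diagonal
  entries and \<open>u\<close> is the off-diagonal one.\<close>

definition triangular_algebra :: "('k::field, 'k \<times> 'k \<times> 'k) module"
  where "triangular_algebra =
    \<lparr>carrier = UNIV, monoid.mult = (\<lambda>(p, u, s) (p', u', s'). (p * p', p * u' + u * s', s * s')),
     one = (1, 0, 1), ring.zero = (0, 0, 0),
     add = (\<lambda>(p, u, s) (p', u', s'). (p + p', u + u', s + s')),
     module.smult = (\<lambda>c (p, u, s). (c * p, c * u, c * s))\<rparr>"

lemma triangular_simps [simp]:
  "carrier triangular_algebra = UNIV"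
  "(p, u, s) \<otimes>\<^bsub>triangular_algebra\<^esub> (p', u', s') = (p * p', p * u' + u * s', s * s')"
  "\<one>\<^bsub>triangular_algebra\<^esub> = (1, 0, 1)" "\<zero>\<^bsub>triangular_algebra\<^esub> = (0, 0, 0)"
  "(p, u, s) \<oplus>\<^bsub>triangular_algebra\<^esub> (p', u', s') = (p + p', u + u', s + s')"
  "c \<odot>\<^bsub>triangular_algebra\<^esub> (p, u, s) = (c * p, c * u, c * s)"
  by (simp_all add: triangular_algebra_def)

lemma triangular_assoc_algebra: "assoc_algebra triangular_algebra"
  by (rule assoc_algebraI) (auto simp: algebra_simps)

lemma (in assoc_algebra) linear_finsum:
  assumes "assoc_algebra B" "f \<in> linear_maps A B" "finite S" "g \<in> S \<rightarrow> carrier A"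
  shows "f (\<Oplus>i\<in>S. g i) = (\<Oplus>\<^bsub>B\<^esub>i\<in>S. f (g i))"
proof -
  interpret B: assoc_algebra B by fact
  show ?thesis
    using assms(3,4)
  proof (induction S)
    case empty
    then show ?case
      using linear_zero[OF is_assoc_algebra assms(1,2)] by simp
  next
    case (insert i S)
    then have "g i \<in> carrier A" "g \<in> S \<rightarrow> carrier A" "(\<lambda>i. f (g i)) \<in> S \<rightarrow> carrier B"
      using linear_closed[OF assms(2)] by auto
    then show ?case
      using insert linear_closed[OF assms(2)] by (simp add: linear_add[OF assms(2)])
  qed
qed

lemma finsum_scalars:
  assumes "finite S"
  shows "finsum (scalars :: ('k::field, 'k) module) f S = sum f S"
proof -
  interpret S: assoc_algebra "scalars :: ('k, 'k) module"
    by simp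
  show ?thesis
    using assms by (induction S) simp_all
qed

context radford_root
begin

interpretation R: assoc_algebra R by (rule assoc_algebra_R)

text \<open>Spanning by the monomials, phrased through linear maps, which is how it is used on
  \<open>H\<close> and on \<open>K\<close>. Left multiplication by a generator sends a monomial to a
  multiple of a monomial, so precomposing two maps that agree on monomials with it preserves the
  agreement.\<close>

lemma monomials_determine:
  assumes U: "assoc_algebra U" and f: "f \<in> linear_maps R U" and g: "g \<in> linear_maps R U"
    and eq: "\<And>i j. i < N \<Longrightarrow> j < r \<Longrightarrow>
      f (a [^]\<^bsub>R\<^esub> i \<otimes>\<^bsub>R\<^esub> x [^]\<^bsub>R\<^esub> j) = g (a [^]\<^bsub>R\<^esub> i \<otimes>\<^bsub>R\<^esub> x [^]\<^bsub>R\<^esub> j)"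
    and h: "h \<in> carrier R"
  shows "f h = g h"
proof -
  interpret U: assoc_algebra U by fact
  \<comment> \<open>Agreement is first extended to unrestricted exponents, by reducing the exponent
    of \<open>a\<close> modulo \<open>N\<close> and using that high powers of \<open>x\<close>
    vanish, since multiplying by a generator may leave the given ranges.\<close>
  have all: "f (a [^]\<^bsub>R\<^esub> i \<otimes>\<^bsub>R\<^esub> x [^]\<^bsub>R\<^esub> j) = g (a [^]\<^bsub>R\<^esub> i \<otimes>\<^bsub>R\<^esub> x [^]\<^bsub>R\<^esub> j)" for i j :: nat
  proof -
    have "a [^]\<^bsub>R\<^esub> i = (a [^]\<^bsub>R\<^esub> N) [^]\<^bsub>R\<^esub> (i div N) \<otimes>\<^bsub>R\<^esub> a [^]\<^bsub>R\<^esub> (i mod N)"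
      by (simp add: R.nat_pow_pow R.nat_pow_mult)
    then have i: "a [^]\<^bsub>R\<^esub> i = a [^]\<^bsub>R\<^esub> (i mod N)"
      by (simp add: a_pow_N)
    show ?thesis
    proof (cases "j < r")
      case True
      then show ?thesis
        unfolding i using eq[of "i mod N" j] N_pos by simp
    next
      case False
      then have "x [^]\<^bsub>R\<^esub> j = x [^]\<^bsub>R\<^esub> r \<otimes>\<^bsub>R\<^esub> x [^]\<^bsub>R\<^esub> (j - r)"
        by (simp add: R.nat_pow_mult)
      then have "x [^]\<^bsub>R\<^esub> j = \<zero>\<^bsub>R\<^esub>"
        by (simp add: x_pow_r)
      then show ?thesis
        using linear_zero[OF R.is_assoc_algebra U f] linear_zero[OF R.is_assoc_algebra U g] by simp
    qed
  qed
  \<comment> \<open>The maps are quantified inside the induction, because the generator case applies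
    the hypothesis to their compositions with a left multiplication.\<close>
  have "\<forall>f g. f \<in> linear_maps R U \<longrightarrow> g \<in> linear_maps R U \<longrightarrow>
    (\<forall>(i::nat) (j::nat). f (a [^]\<^bsub>R\<^esub> i \<otimes>\<^bsub>R\<^esub> x [^]\<^bsub>R\<^esub> j) = g (a [^]\<^bsub>R\<^esub> i \<otimes>\<^bsub>R\<^esub> x [^]\<^bsub>R\<^esub> j)) \<longrightarrow> f h = g h"
    using h
  proof (induction rule: radford_induct)
    case one
    show ?case
    proof (intro allI impI)
      fix f g assume "\<forall>i j. f (a [^]\<^bsub>R\<^esub> (i::nat) \<otimes>\<^bsub>R\<^esub> x [^]\<^bsub>R\<^esub> (j::nat)) = g (a [^]\<^bsub>R\<^esub> i \<otimes>\<^bsub>R\<^esub> x [^]\<^bsub>R\<^esub> j)"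
      from this[rule_format, of 0 0] show "f \<one>\<^bsub>R\<^esub> = g \<one>\<^bsub>R\<^esub>"
        by simp
    qed
  next
    case (gen u h)
    show ?case
    proof (intro allI impI)
      fix f g assume f: "f \<in> linear_maps R U" and g: "g \<in> linear_maps R U"
        and eq: "\<forall>i j. f (a [^]\<^bsub>R\<^esub> (i::nat) \<otimes>\<^bsub>R\<^esub> x [^]\<^bsub>R\<^esub> (j::nat)) = g (a [^]\<^bsub>R\<^esub> i \<otimes>\<^bsub>R\<^esub> x [^]\<^bsub>R\<^esub> j)"
      let ?u = "generator_class q N \<nu> u"
      have shift: "\<exists>c k l. ?u \<otimes>\<^bsub>R\<^esub> (a [^]\<^bsub>R\<^esub> i \<otimes>\<^bsub>R\<^esub> x [^]\<^bsub>R\<^esub> j) = c \<odot>\<^bsub>R\<^esub> (a [^]\<^bsub>R\<^esub> (k::nat) \<otimes>\<^bsub>R\<^esub> x [^]\<^bsub>R\<^esub> (l::nat))" for i j :: nat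
      proof (cases u)
        case Gen_a
        have "a \<otimes>\<^bsub>R\<^esub> (a [^]\<^bsub>R\<^esub> i \<otimes>\<^bsub>R\<^esub> x [^]\<^bsub>R\<^esub> j) = a [^]\<^bsub>R\<^esub> Suc i \<otimes>\<^bsub>R\<^esub> x [^]\<^bsub>R\<^esub> j"
          using R.nat_pow_comm[of a 1 i] by (simp flip: R.m_assoc)
        then show ?thesis
          using Gen_a by (intro exI[of _ 1] exI[of _ "Suc i"] exI[of _ j]) simp
      next
        case Gen_x
        have "x \<otimes>\<^bsub>R\<^esub> (a [^]\<^bsub>R\<^esub> i \<otimes>\<^bsub>R\<^esub> x [^]\<^bsub>R\<^esub> j) = q ^ i \<odot>\<^bsub>R\<^esub> (a [^]\<^bsub>R\<^esub> i \<otimes>\<^bsub>R\<^esub> (x \<otimes>\<^bsub>R\<^esub> x [^]\<^bsub>R\<^esub> j))"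
          by (simp add: x_a_pow R.smult_mult_left R.m_assoc flip: R.m_assoc[of x])
        also have "x \<otimes>\<^bsub>R\<^esub> x [^]\<^bsub>R\<^esub> j = x [^]\<^bsub>R\<^esub> Suc j"
          using R.nat_pow_comm[of x 1 j] by simp
        finally show ?thesis
          using Gen_x by blast
      qed
      have "f (?u \<otimes>\<^bsub>R\<^esub> (a [^]\<^bsub>R\<^esub> i \<otimes>\<^bsub>R\<^esub> x [^]\<^bsub>R\<^esub> j)) = g (?u \<otimes>\<^bsub>R\<^esub> (a [^]\<^bsub>R\<^esub> i \<otimes>\<^bsub>R\<^esub> x [^]\<^bsub>R\<^esub> j))" for i j :: nat
      proof -
        obtain c k l where "?u \<otimes>\<^bsub>R\<^esub> (a [^]\<^bsub>R\<^esub> i \<otimes>\<^bsub>R\<^esub> x [^]\<^bsub>R\<^esub> j) = c \<odot>\<^bsub>R\<^esub> (a [^]\<^bsub>R\<^esub> (k::nat) \<otimes>\<^bsub>R\<^esub> x [^]\<^bsub>R\<^esub> (l::nat))"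
          using shift by blast
        then show ?thesis
          using eq by (simp add: linear_smult[OF f] linear_smult[OF g])
      qed
      then show "f (?u \<otimes>\<^bsub>R\<^esub> h) = g (?u \<otimes>\<^bsub>R\<^esub> h)"
        using gen.IH[rule_format, OF linear_comp[OF R.linear_maps_mult_left f] linear_comp[OF R.linear_maps_mult_left g],
            of ?u ?u] by simp
    qed
  next
    case (add h h')
    show ?case
    proof (intro allI impI)
      fix f g assume f: "f \<in> linear_maps R U" and g: "g \<in> linear_maps R U"
        and eq: "\<forall>i j. f (a [^]\<^bsub>R\<^esub> (i::nat) \<otimes>\<^bsub>R\<^esub> x [^]\<^bsub>R\<^esub> (j::nat)) = g (a [^]\<^bsub>R\<^esub> i \<otimes>\<^bsub>R\<^esub> x [^]\<^bsub>R\<^esub> j)"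
      then show "f (h \<oplus>\<^bsub>R\<^esub> h') = g (h \<oplus>\<^bsub>R\<^esub> h')"
        using add.IH(1)[rule_format, OF f g] add.IH(2)[rule_format, OF f g] add.hyps
        by (simp add: linear_add[OF f] linear_add[OF g])
    qed
  next
    case (scale c h)
    show ?case
    proof (intro allI impI)
      fix f g assume f: "f \<in> linear_maps R U" and g: "g \<in> linear_maps R U"
        and eq: "\<forall>i j. f (a [^]\<^bsub>R\<^esub> (i::nat) \<otimes>\<^bsub>R\<^esub> x [^]\<^bsub>R\<^esub> (j::nat)) = g (a [^]\<^bsub>R\<^esub> i \<otimes>\<^bsub>R\<^esub> x [^]\<^bsub>R\<^esub> j)"
      then show "f (c \<odot>\<^bsub>R\<^esub> h) = g (c \<odot>\<^bsub>R\<^esub> h)"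
        using scale.IH[rule_format, OF f g] scale.hyps
        by (simp add: linear_smult[OF f] linear_smult[OF g])
    qed
  qed
  then show ?thesis
    using f g all by blast
qed

end

lemma bilinear_maps_radford_hopf [simp]:
  "bilinear_maps (radford_hopf n q N \<nu>) B U = bilinear_maps (radford_algebra q N \<nu>) B U"
  "bilinear_maps B (radford_hopf n q N \<nu>) U = bilinear_maps B (radford_algebra q N \<nu>) U"
  by (simp_all add: bilinear_maps_def)

locale radford_dual = radford_root q N \<nu> for q :: "'k::field" and N \<nu> :: nat +
  fixes n \<mu> :: nat and \<omega> :: 'k
  assumes \<omega>: "primitive_root_of_unity N \<omega>" and q_eq: "q = \<omega> ^ \<mu>" and r_gt_1: "1 < r"
begin

interpretation R: assoc_algebra R by (rule assoc_algebra_R)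
interpretation RRR: algebra_triple R R R ..
interpretation H: hopf_algebra "radford_hopf n q N \<nu>" by (rule radford_hopf_algebra)

text \<open>\<open>K\<close> is the candidate for the dual, with \<open>\<omega> ^ \<nu>\<close> and
  \<open>\<mu>\<close> in the roles of \<open>q\<close> and \<open>\<nu>\<close>.\<close>

sublocale K: radford_root "\<omega> ^ \<nu>" N \<mu>
proof
  show "(\<omega> ^ \<nu>) ^ N = 1"
    using \<omega> by (metis mult.commute power_mult power_one primitive_root_of_unity_def)
qed (rule N_pos)

interpretation KR: assoc_algebra K.R by (rule K.assoc_algebra_R)

abbreviation D :: "('k, (generator list \<Rightarrow>\<^sub>0 'k) set \<Rightarrow> 'k) module"
  where "D \<equiv> dual_algebra (radford_hopf n q N \<nu>)"

interpretation D: assoc_algebra D by (rule H.dual_assoc_algebra)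

text \<open>Consequently \<open>x\<close> has the same nilpotency exponent \<open>r\<close> in
  \<open>H\<close> and in \<open>K\<close>, and one system of Gaussian numbers serves both.\<close>

lemma Q_eq: "(\<omega> ^ \<nu>) ^ \<mu> = q ^ \<nu>"
  unfolding q_eq by (simp add: mult.commute flip: power_mult)

lemma dual_linear: "f \<in> carrier D \<Longrightarrow> f \<in> linear_maps R scalars"
  using H.dual_linear[of f] by simp

lemma dualI: "f \<in> linear_maps R scalars \<Longrightarrow> restrict f (carrier R) \<in> carrier D"
  using H.dualI[of f] by simp

lemma dual_eqI:
  "f \<in> carrier D \<Longrightarrow> g \<in> carrier D \<Longrightarrow> (\<And>h. h \<in> carrier R \<Longrightarrow> f h = g h) \<Longrightarrow> f = g"
  using H.dual_eqI[of f g] by simp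

lemma dual_mult_apply:
  "h \<in> carrier R \<Longrightarrow> (f \<otimes>\<^bsub>D\<^esub> g) h = tensor_lift scalars (\<lambda>u v. f u * g v) (\<Delta> h)"
  using H.dual_apply(1)[of h f g] by (simp add: structure_maps)

lemma dual_apply:
  assumes "h \<in> carrier R"
  shows "\<one>\<^bsub>D\<^esub> h = \<epsilon> h" "\<zero>\<^bsub>D\<^esub> h = 0" "(f \<oplus>\<^bsub>D\<^esub> g) h = f h + g h" "(c \<odot>\<^bsub>D\<^esub> f) h = c * f h"
  using assms H.dual_apply[of h] by (simp_all add: structure_maps)

lemma dual_bilinear: "f \<in> carrier D \<Longrightarrow> g \<in> carrier D \<Longrightarrow> (\<lambda>u v. f u * g v) \<in> bilinear_maps R R scalars"
  by (intro bilinear_scalars dual_linear)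

lemma dual_mult_one: "f \<in> carrier D \<Longrightarrow> g \<in> carrier D \<Longrightarrow> (f \<otimes>\<^bsub>D\<^esub> g) \<one>\<^bsub>R\<^esub> = f \<one>\<^bsub>R\<^esub> * g \<one>\<^bsub>R\<^esub>"
  by (simp add: dual_mult_apply algebra_hom_one[OF comult_hom] RRR.AB.tensor_one
      RRR.AB.tensor_lift_pure[OF scalars_algebra dual_bilinear])

lemma dual_one_one: "\<one>\<^bsub>D\<^esub> \<one>\<^bsub>R\<^esub> = 1"
  by (simp add: dual_apply algebra_hom_one[OF counit_hom])

section \<open>Left translations of functionals\<close>

definition L where "L u f = (\<lambda>h\<in>carrier R. f (u \<otimes>\<^bsub>R\<^esub> h))"

lemma L_apply: "h \<in> carrier R \<Longrightarrow> L u f h = f (u \<otimes>\<^bsub>R\<^esub> h)"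
  by (simp add: L_def)

lemma L_closed: "u \<in> carrier R \<Longrightarrow> f \<in> carrier D \<Longrightarrow> L u f \<in> carrier D"
  unfolding L_def by (intro dualI linear_comp[OF R.linear_maps_mult_left dual_linear])

lemma L_eqI:
  assumes "u \<in> carrier R" "f \<in> carrier D" "g \<in> carrier D"
    and "\<And>h. h \<in> carrier R \<Longrightarrow> f (u \<otimes>\<^bsub>R\<^esub> h) = g h"
  shows "L u f = g"
  using assms by (intro dual_eqI L_closed) (simp_all add: L_apply)

lemma L_smult: "u \<in> carrier R \<Longrightarrow> f \<in> carrier D \<Longrightarrow> L u (c \<odot>\<^bsub>D\<^esub> f) = c \<odot>\<^bsub>D\<^esub> L u f"
  by (intro L_eqI H.DD.A.smult_closed' L_closed) (simp_all add: dual_apply L_apply)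

lemma L_zero: "u \<in> carrier R \<Longrightarrow> L u \<zero>\<^bsub>D\<^esub> = \<zero>\<^bsub>D\<^esub>"
  by (intro L_eqI) (simp_all add: dual_apply)

lemma L_pow:
  assumes f: "f \<in> carrier D" "L a f = c \<odot>\<^bsub>D\<^esub> f" shows "L (a [^]\<^bsub>R\<^esub> (k::nat)) f = c ^ k \<odot>\<^bsub>D\<^esub> f"
proof (induction k)
  case 0
  show ?case
    using f by (intro L_eqI) (simp_all add: dual_apply)
next
  case (Suc k)
  show ?case
  proof (rule L_eqI)
    fix h assume h: "h \<in> carrier R"
    have "f (a [^]\<^bsub>R\<^esub> Suc k \<otimes>\<^bsub>R\<^esub> h) = L (a [^]\<^bsub>R\<^esub> k) f (a \<otimes>\<^bsub>R\<^esub> h)"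
      using h by (simp add: L_apply R.m_assoc)
    also have "\<dots> = c ^ k * L a f h"
      unfolding Suc using h by (simp add: dual_apply L_apply)
    finally show "f (a [^]\<^bsub>R\<^esub> Suc k \<otimes>\<^bsub>R\<^esub> h) = (c ^ Suc k \<odot>\<^bsub>D\<^esub> f) h"
      using h f by (simp add: dual_apply)
  qed (use f in simp_all)
qed

text \<open>Reason: \<open>a\<close> is group-like, so the comultiplication of \<open>a h\<close> is
  that of \<open>h\<close> with \<open>a\<close> multiplied into both factors.\<close>

lemma L_a_mult:
  assumes f: "f \<in> carrier D" and g: "g \<in> carrier D"
  shows "L a (f \<otimes>\<^bsub>D\<^esub> g) = L a f \<otimes>\<^bsub>D\<^esub> L a g"
proof (rule L_eqI)
  fix h assume h: "h \<in> carrier R"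
  then have \<Delta>h: "\<Delta> h \<in> carrier RR"
    by (rule algebra_hom_closed[OF comult_hom])
  note bil = dual_bilinear[OF f g] and bil' = dual_bilinear[OF L_closed[OF _ f] L_closed[OF _ g]]
  have "tensor_lift scalars (\<lambda>u v. f u * g v) (pt a a \<otimes>\<^bsub>RR\<^esub> \<Delta> h) =
    tensor_lift scalars (\<lambda>u v. L a f u * L a g v) (\<Delta> h)"
    by (rule RRR.AB.tensor_lift_eqI[OF scalars_algebra linear_comp[OF RRR.AB.T.linear_maps_mult_left
        RRR.AB.tensor_lift_linear[OF scalars_algebra bil]] bil' \<Delta>h])
      (simp_all add: RRR.AB.pt_mult RRR.AB.tensor_lift_pure[OF scalars_algebra bil] L_apply)
  then show "(f \<otimes>\<^bsub>D\<^esub> g) (a \<otimes>\<^bsub>R\<^esub> h) = (L a f \<otimes>\<^bsub>D\<^esub> L a g) h"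
    using h by (simp add: dual_mult_apply algebra_hom_mult[OF comult_hom] comult_gen)
qed (use f g in \<open>simp_all add: L_closed\<close>)

text \<open>The two summands of the comultiplication of \<open>x\<close> give the two terms of a
  twisted Leibniz rule; the twist by \<open>a [^] \<nu>\<close> comes from the first.\<close>

lemma L_x_mult:
  assumes f: "f \<in> carrier D" and g: "g \<in> carrier D"
  shows "L x (f \<otimes>\<^bsub>D\<^esub> g) = L x f \<otimes>\<^bsub>D\<^esub> L (a [^]\<^bsub>R\<^esub> \<nu>) g \<oplus>\<^bsub>D\<^esub> f \<otimes>\<^bsub>D\<^esub> L x g"
proof (rule L_eqI)
  fix h assume h: "h \<in> carrier R"
  then have \<Delta>h: "\<Delta> h \<in> carrier RR"
    by (rule algebra_hom_closed[OF comult_hom])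
  have pow: "a [^]\<^bsub>R\<^esub> \<nu> \<in> carrier R"
    by simp
  note bil = dual_bilinear[OF f g]
  have bil1: "(\<lambda>u v. L x f u * L (a [^]\<^bsub>R\<^esub> \<nu>) g v) \<in> bilinear_maps R R scalars"
    by (intro dual_bilinear L_closed f g) simp_all
  have bil2: "(\<lambda>u v. f u * L x g v) \<in> bilinear_maps R R scalars"
    by (intro dual_bilinear L_closed f g) simp_all
  note lin = RRR.AB.tensor_lift_linear[OF scalars_algebra bil]
  note pure = RRR.AB.tensor_lift_pure[OF scalars_algebra bil]
  have 1: "tensor_lift scalars (\<lambda>u v. f u * g v) (pt x (a [^]\<^bsub>R\<^esub> \<nu>) \<otimes>\<^bsub>RR\<^esub> \<Delta> h) =
    tensor_lift scalars (\<lambda>u v. L x f u * L (a [^]\<^bsub>R\<^esub> \<nu>) g v) (\<Delta> h)"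
    by (rule RRR.AB.tensor_lift_eqI[OF scalars_algebra linear_comp[OF RRR.AB.T.linear_maps_mult_left lin] bil1 \<Delta>h])
      (simp_all add: RRR.AB.pt_mult pure L_apply)
  have 2: "tensor_lift scalars (\<lambda>u v. f u * g v) (pt \<one>\<^bsub>R\<^esub> x \<otimes>\<^bsub>RR\<^esub> \<Delta> h) =
    tensor_lift scalars (\<lambda>u v. f u * L x g v) (\<Delta> h)"
    by (rule RRR.AB.tensor_lift_eqI[OF scalars_algebra linear_comp[OF RRR.AB.T.linear_maps_mult_left lin] bil2 \<Delta>h])
      (simp_all add: RRR.AB.pt_mult pure L_apply)
  show "(f \<otimes>\<^bsub>D\<^esub> g) (x \<otimes>\<^bsub>R\<^esub> h) = (L x f \<otimes>\<^bsub>D\<^esub> L (a [^]\<^bsub>R\<^esub> \<nu>) g \<oplus>\<^bsub>D\<^esub> f \<otimes>\<^bsub>D\<^esub> L x g) h"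
    using h \<Delta>h 1 2
    by (simp add: dual_mult_apply dual_apply algebra_hom_mult[OF comult_hom] comult_gen RRR.AB.T.l_distr linear_add[OF lin])
qed (use f g in \<open>simp_all add: L_closed\<close>)

text \<open>Every element arises from \<open>\<one>\<close> by left multiplications with generators,
  scaling and addition. A functional is therefore fixed by its value at \<open>\<one>\<close>, its
  eigenvalue under \<open>a\<close> and its translate by \<open>x\<close>, and identities between
  functionals reduce to these data.\<close>

lemma dual_eq_translates:
  assumes f: "f \<in> carrier D" and g: "g \<in> carrier D" and one: "f \<one>\<^bsub>R\<^esub> = g \<one>\<^bsub>R\<^esub>"
    and a: "L a f = c \<odot>\<^bsub>D\<^esub> f" "L a g = c \<odot>\<^bsub>D\<^esub> g" and x: "L x f = L x g"
  shows "f = g"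
proof (rule dual_eqI[OF f g])
  fix h assume "h \<in> carrier R"
  then show "f h = g h"
  proof (induction rule: radford_induct)
    case (gen u h)
    show ?case
    proof (cases u)
      case Gen_a
      have "L a f h = L a g h"
        unfolding a using gen by (simp add: dual_apply)
      then show ?thesis
        using Gen_a gen by (simp add: L_apply)
    next
      case Gen_x
      have "L x f h = L x g h"
        unfolding x ..
      then show ?thesis
        using Gen_x gen by (simp add: L_apply)
    qed
  qed (simp_all add: one linear_add[OF dual_linear[OF f]] linear_add[OF dual_linear[OF g]]
      linear_smult[OF dual_linear[OF f]] linear_smult[OF dual_linear[OF g]])
qed

lemma L_one: "L a \<one>\<^bsub>D\<^esub> = 1 \<odot>\<^bsub>D\<^esub> \<one>\<^bsub>D\<^esub>" "L x \<one>\<^bsub>D\<^esub> = \<zero>\<^bsub>D\<^esub>"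
  by (intro L_eqI; simp add: dual_apply algebra_hom_mult[OF counit_hom] counit_gen)+

section \<open>The group-like functional \<open>A\<close> and the skew-primitive functional
  \<open>\<xi>\<close>\<close>

definition A where "A = restrict (hom_by_generators scalars (case_generator \<omega> 0)) (carrier R)"

lemma A_hom: "hom_by_generators scalars (case_generator \<omega> 0) \<in> algebra_homs R scalars"
  and A_gen: "hom_by_generators scalars (case_generator \<omega> 0) a = \<omega>"
    "hom_by_generators scalars (case_generator \<omega> 0) x = 0"
proof -
  interpret S: assoc_algebra "scalars :: ('k, 'k) module"
    by simp
  have "c [^]\<^bsub>scalars\<^esub> k = c ^ k" for c :: 'k and k :: nat
    by (induction k) simp_all
  then have sat: "satisfies_radford scalars q N \<nu> (case_generator \<omega> 0)"
    using r_pos \<omega> by (simp add: satisfies_radford_def primitive_root_of_unity_def)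
  show "hom_by_generators scalars (case_generator \<omega> 0) \<in> algebra_homs R scalars"
    "hom_by_generators scalars (case_generator \<omega> 0) a = \<omega>"
    "hom_by_generators scalars (case_generator \<omega> 0) x = 0"
    using hom_by_generators_hom[OF scalars_algebra sat] by simp_all
qed

lemma A_closed [simp, intro]: "A \<in> carrier D"
  unfolding A_def by (intro dualI algebra_hom_linear[OF A_hom])

lemma A_mult: "g \<in> carrier R \<Longrightarrow> h \<in> carrier R \<Longrightarrow> A (g \<otimes>\<^bsub>R\<^esub> h) = A g * A h"
  by (simp add: A_def algebra_hom_mult[OF A_hom])

lemma A_one: "A \<one>\<^bsub>R\<^esub> = 1"
  by (simp add: A_def algebra_hom_one[OF A_hom])

lemma L_A: "L a A = \<omega> \<odot>\<^bsub>D\<^esub> A" "L x A = \<zero>\<^bsub>D\<^esub>"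
  by (intro L_eqI; simp add: dual_apply A_mult; simp add: A_def A_gen)+

lemma A_pow_one: "(A [^]\<^bsub>D\<^esub> (i::nat)) \<one>\<^bsub>R\<^esub> = 1"
  by (induction i) (simp_all add: dual_one_one dual_mult_one A_one)

lemma L_a_A_pow: "L a (A [^]\<^bsub>D\<^esub> (i::nat)) = \<omega> ^ i \<odot>\<^bsub>D\<^esub> A [^]\<^bsub>D\<^esub> i"
proof (induction i)
  case 0
  show ?case
    using L_one(1) by simp
next
  case (Suc i)
  then show ?case
    by (simp add: L_a_mult L_A H.DD.A.smult_mult_left H.DD.A.smult_mult_right H.DD.A.smult_smult)
qed

lemma L_x_A_pow: "L x (A [^]\<^bsub>D\<^esub> (i::nat)) = \<zero>\<^bsub>D\<^esub>"
  by (induction i) (simp_all add: L_one L_x_mult L_A L_closed)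

lemma A_pow_N: "A [^]\<^bsub>D\<^esub> N = \<one>\<^bsub>D\<^esub>"
proof (rule dual_eq_translates[where c = 1])
  show "L a (A [^]\<^bsub>D\<^esub> N) = 1 \<odot>\<^bsub>D\<^esub> A [^]\<^bsub>D\<^esub> N"
    using \<omega> by (simp add: L_a_A_pow primitive_root_of_unity_def)
qed (simp_all add: A_pow_one dual_one_one L_one L_x_A_pow)

text \<open>The triangular representation: \<open>a\<close> acts as the diagonal matrix with entries
  \<open>1\<close> and \<open>q\<close>, and \<open>x\<close> as the matrix unit above the
  diagonal.\<close>

definition \<Phi> where "\<Phi> = hom_by_generators triangular_algebra (case_generator (1, 0, q) (0, 1, 0))"

definition \<xi> where "\<xi> = restrict (\<lambda>h. fst (snd (\<Phi> h))) (carrier R)"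

lemma \<Phi>_hom: "\<Phi> \<in> algebra_homs R triangular_algebra"
  and \<Phi>_gen: "\<Phi> a = (1, 0, q)" "\<Phi> x = (0, 1, 0)"
proof -
  interpret S: assoc_algebra "triangular_algebra :: ('k, 'k \<times> 'k \<times> 'k) module"
    by (rule triangular_assoc_algebra)
  have diag: "(1, 0, q) [^]\<^bsub>triangular_algebra\<^esub> k = (1, 0, q ^ k)" for k :: nat
    by (induction k) (simp_all add: mult.commute)
  have nil: "(0, 1, 0) [^]\<^bsub>triangular_algebra\<^esub> Suc (Suc k) = (0, 0, 0)" for k :: nat
    by (induction k) simp_all
  \<comment> \<open>The matrix unit already squares to zero, so the relation for \<open>x\<close>
    holds because \<open>1 < r\<close>; here \<open>x \<noteq> 0\<close> enters.\<close>
  have "(0, 1, 0) [^]\<^bsub>triangular_algebra\<^esub> r = (0, 0, 0)"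
    using nil[of "r - 2"] r_gt_1 by (simp add: numeral_2_eq_2 Suc_diff_Suc del: nat_pow_Suc)
  then have sat: "satisfies_radford triangular_algebra q N \<nu> (case_generator (1, 0, q) (0, 1, 0))"
    by (simp add: satisfies_radford_def diag q_pow_N)
  show "\<Phi> \<in> algebra_homs R triangular_algebra" "\<Phi> a = (1, 0, q)" "\<Phi> x = (0, 1, 0)"
    using hom_by_generators_hom[OF triangular_assoc_algebra sat] by (simp_all add: \<Phi>_def)
qed

lemma triangular_projections:
  "fst \<in> linear_maps triangular_algebra scalars"
  "(\<lambda>t. fst (snd t)) \<in> linear_maps triangular_algebra scalars"
  "(\<lambda>t. snd (snd t)) \<in> linear_maps triangular_algebra scalars"
  by (auto intro!: linear_mapsI)

lemma X_closed [simp, intro]: "\<xi> \<in> carrier D"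
  unfolding \<xi>_def
  by (intro dualI linear_comp[OF algebra_hom_linear[OF \<Phi>_hom] triangular_projections(2)])

lemma \<Phi>_mult:
  assumes "g \<in> carrier R" "h \<in> carrier R"
  shows "fst (\<Phi> (g \<otimes>\<^bsub>R\<^esub> h)) = fst (\<Phi> g) * fst (\<Phi> h)"
    and "fst (snd (\<Phi> (g \<otimes>\<^bsub>R\<^esub> h))) = fst (\<Phi> g) * fst (snd (\<Phi> h)) + fst (snd (\<Phi> g)) * snd (snd (\<Phi> h))"
    and "snd (snd (\<Phi> (g \<otimes>\<^bsub>R\<^esub> h))) = snd (snd (\<Phi> g)) * snd (snd (\<Phi> h))"
  unfolding algebra_hom_mult[OF \<Phi>_hom assms]
  by (cases "\<Phi> g"; cases "\<Phi> h"; simp)+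

lemma \<Phi>_fst: assumes "h \<in> carrier R" shows "fst (\<Phi> h) = \<one>\<^bsub>D\<^esub> h"
proof -
  let ?E = "\<lambda>h\<in>carrier R. fst (\<Phi> h)"
  have E: "?E \<in> carrier D"
    by (intro dualI linear_comp[OF algebra_hom_linear[OF \<Phi>_hom] triangular_projections(1)])
  have "?E = \<one>\<^bsub>D\<^esub>"
  proof (rule dual_eq_translates[where c = 1, OF E H.DD.A.one_closed])
    show "L a ?E = 1 \<odot>\<^bsub>D\<^esub> ?E"
      using E by (intro L_eqI) (simp_all add: \<Phi>_mult \<Phi>_gen dual_apply)
    show "L x ?E = L x \<one>\<^bsub>D\<^esub>"
      unfolding L_one using E by (intro L_eqI) (simp_all add: \<Phi>_mult \<Phi>_gen dual_apply)
  qed (simp_all add: algebra_hom_one[OF \<Phi>_hom] dual_one_one L_one)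
  from fun_cong[OF this, of h] show ?thesis
    using assms by simp
qed

text \<open>The lower diagonal entry is the character with value \<open>q\<close> at
  \<open>a\<close> and \<open>0\<close> at \<open>x\<close>. Since
  \<open>q = \<omega> ^ \<mu>\<close> it is a power of \<open>A\<close>, and this is how
  \<open>\<mu>\<close> becomes the last parameter of the dual.\<close>

lemma \<Phi>_snd: assumes "h \<in> carrier R" shows "snd (snd (\<Phi> h)) = (A [^]\<^bsub>D\<^esub> \<mu>) h"
proof -
  let ?E = "\<lambda>h\<in>carrier R. snd (snd (\<Phi> h))"
  have E: "?E \<in> carrier D"
    by (intro dualI linear_comp[OF algebra_hom_linear[OF \<Phi>_hom] triangular_projections(3)])
  have "?E = A [^]\<^bsub>D\<^esub> \<mu>"
  proof (rule dual_eq_translates[where c = q, OF E])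
    show "L a ?E = q \<odot>\<^bsub>D\<^esub> ?E"
      using E by (intro L_eqI) (simp_all add: \<Phi>_mult \<Phi>_gen dual_apply)
    show "L x ?E = L x (A [^]\<^bsub>D\<^esub> \<mu>)"
      unfolding L_x_A_pow using E by (intro L_eqI) (simp_all add: \<Phi>_mult \<Phi>_gen dual_apply)
    show "L a (A [^]\<^bsub>D\<^esub> \<mu>) = q \<odot>\<^bsub>D\<^esub> A [^]\<^bsub>D\<^esub> \<mu>"
      using L_a_A_pow[of \<mu>] by (simp flip: q_eq)
  qed (simp_all add: algebra_hom_one[OF \<Phi>_hom] A_pow_one)
  from fun_cong[OF this, of h] show ?thesis
    using assms by simp
qed

lemma X_mult:
  "g \<in> carrier R \<Longrightarrow> h \<in> carrier R \<Longrightarrow> \<xi> (g \<otimes>\<^bsub>R\<^esub> h) = \<one>\<^bsub>D\<^esub> g * \<xi> h + \<xi> g * (A [^]\<^bsub>D\<^esub> \<mu>) h"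
  by (simp add: \<xi>_def \<Phi>_mult \<Phi>_fst \<Phi>_snd)

lemma X_one: "\<xi> \<one>\<^bsub>R\<^esub> = 0"
  by (simp add: \<xi>_def algebra_hom_one[OF \<Phi>_hom])

lemma L_X: "L a \<xi> = 1 \<odot>\<^bsub>D\<^esub> \<xi>" "L x \<xi> = A [^]\<^bsub>D\<^esub> \<mu>"
  by (intro L_eqI; simp add: dual_apply X_mult counit_gen; simp add: \<xi>_def \<Phi>_gen)+

text \<open>Both sides vanish at \<open>\<one>\<close> and have eigenvalue \<open>\<omega>\<close>
  under \<open>a\<close>. Translating by \<open>x\<close> leaves a power of \<open>A\<close> on each
  side, and the factor \<open>\<omega> ^ \<nu>\<close> is the eigenvalue of
  \<open>a [^] \<nu>\<close> on \<open>A\<close>, produced by the twist in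
  \<open>L_x_mult\<close>.\<close>

lemma X_A: "\<xi> \<otimes>\<^bsub>D\<^esub> A = \<omega> ^ \<nu> \<odot>\<^bsub>D\<^esub> (A \<otimes>\<^bsub>D\<^esub> \<xi>)"
proof (rule dual_eq_translates[where c = \<omega>])
  have "A \<otimes>\<^bsub>D\<^esub> A [^]\<^bsub>D\<^esub> \<mu> = A [^]\<^bsub>D\<^esub> \<mu> \<otimes>\<^bsub>D\<^esub> A"
    using H.DD.A.nat_pow_comm[of A 1 \<mu>] by simp
  then show "L x (\<xi> \<otimes>\<^bsub>D\<^esub> A) = L x (\<omega> ^ \<nu> \<odot>\<^bsub>D\<^esub> (A \<otimes>\<^bsub>D\<^esub> \<xi>))"
    by (simp add: L_smult L_x_mult L_X L_A L_closed L_pow[OF A_closed L_A(1)] H.DD.A.smult_mult_right)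
qed (simp_all add: dual_apply dual_mult_one X_one L_smult L_a_mult L_A L_X H.DD.A.smult_mult_left H.DD.A.smult_mult_right
    H.DD.A.smult_smult mult.commute)

lemma X_pow_one: "(\<xi> [^]\<^bsub>D\<^esub> (j::nat)) \<one>\<^bsub>R\<^esub> = (if j = 0 then 1 else 0)"
  by (induction j) (simp_all add: dual_one_one dual_mult_one X_one)

lemma L_a_X_pow: "L a (\<xi> [^]\<^bsub>D\<^esub> (j::nat)) = 1 \<odot>\<^bsub>D\<^esub> \<xi> [^]\<^bsub>D\<^esub> j"
  using L_one(1) L_X(1) by (induction j) (simp_all add: L_a_mult)

text \<open>A twisted power rule. Moving \<open>\<xi>\<close> past the power of \<open>A\<close>
  contributes \<open>q ^ \<nu>\<close>, and the coefficients accumulate through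
  \<open>[j + 1] = 1 + q^\<nu> [j]\<close>.\<close>

lemma L_x_X_pow:
  "L x (\<xi> [^]\<^bsub>D\<^esub> Suc j) = gauss_number (q ^ \<nu>) (Suc j) \<odot>\<^bsub>D\<^esub> (A [^]\<^bsub>D\<^esub> \<mu> \<otimes>\<^bsub>D\<^esub> \<xi> [^]\<^bsub>D\<^esub> j)"
proof (induction j)
  case 0
  show ?case
    by (simp add: L_X gauss_number_def)
next
  case (Suc j)
  have shift: "\<xi> \<otimes>\<^bsub>D\<^esub> \<xi> [^]\<^bsub>D\<^esub> k = \<xi> [^]\<^bsub>D\<^esub> Suc k" for k :: nat
    using H.DD.A.nat_pow_comm[of \<xi> 1 k] by simp
  have comm: "\<xi> \<otimes>\<^bsub>D\<^esub> A [^]\<^bsub>D\<^esub> \<mu> = q ^ \<nu> \<odot>\<^bsub>D\<^esub> (A [^]\<^bsub>D\<^esub> \<mu> \<otimes>\<^bsub>D\<^esub> \<xi>)"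
    using H.DD.A.q_commute_pow[OF A_closed X_closed X_A, of \<mu>] by (simp add: Q_eq)
  let ?g = "gauss_number (q ^ \<nu>) (Suc j)"
  \<comment> \<open>A factor is split off on the left, so that the new power of \<open>A\<close>
    already stands in front and the old one has to pass a single \<open>\<xi>\<close>.\<close>
  have "L x (\<xi> [^]\<^bsub>D\<^esub> Suc (Suc j)) = L x (\<xi> \<otimes>\<^bsub>D\<^esub> \<xi> [^]\<^bsub>D\<^esub> Suc j)"
    by (simp only: shift)
  also have "\<dots> = A [^]\<^bsub>D\<^esub> \<mu> \<otimes>\<^bsub>D\<^esub> \<xi> [^]\<^bsub>D\<^esub> Suc j \<oplus>\<^bsub>D\<^esub> \<xi> \<otimes>\<^bsub>D\<^esub> (?g \<odot>\<^bsub>D\<^esub> (A [^]\<^bsub>D\<^esub> \<mu> \<otimes>\<^bsub>D\<^esub> \<xi> [^]\<^bsub>D\<^esub> j))"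
    using L_pow[OF H.DD.A.nat_pow_closed[OF X_closed] L_a_X_pow, of \<nu> "Suc j"]
    by (simp only: L_x_mult X_closed H.DD.A.nat_pow_closed L_X Suc power_one H.DD.A.smult_1)
  also have "\<xi> \<otimes>\<^bsub>D\<^esub> (?g \<odot>\<^bsub>D\<^esub> (A [^]\<^bsub>D\<^esub> \<mu> \<otimes>\<^bsub>D\<^esub> \<xi> [^]\<^bsub>D\<^esub> j)) =
      (?g * q ^ \<nu>) \<odot>\<^bsub>D\<^esub> (A [^]\<^bsub>D\<^esub> \<mu> \<otimes>\<^bsub>D\<^esub> (\<xi> \<otimes>\<^bsub>D\<^esub> \<xi> [^]\<^bsub>D\<^esub> j))"
    by (simp add: H.DD.A.smult_mult_left H.DD.A.smult_mult_right H.DD.A.smult_smult comm H.DD.A.m_assoc flip: H.DD.A.m_assoc[of \<xi>])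
  also have "A [^]\<^bsub>D\<^esub> \<mu> \<otimes>\<^bsub>D\<^esub> \<xi> [^]\<^bsub>D\<^esub> Suc j \<oplus>\<^bsub>D\<^esub> (?g * q ^ \<nu>) \<odot>\<^bsub>D\<^esub> (A [^]\<^bsub>D\<^esub> \<mu> \<otimes>\<^bsub>D\<^esub> (\<xi> \<otimes>\<^bsub>D\<^esub> \<xi> [^]\<^bsub>D\<^esub> j)) =
      gauss_number (q ^ \<nu>) (Suc (Suc j)) \<odot>\<^bsub>D\<^esub> (A [^]\<^bsub>D\<^esub> \<mu> \<otimes>\<^bsub>D\<^esub> \<xi> [^]\<^bsub>D\<^esub> Suc j)"
    unfolding shift gauss_number_Suc[of _ "Suc j"] by (simp add: H.DD.A.smult_add_left mult.commute)
  finally show ?case .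
qed

text \<open>Its value at \<open>\<one>\<close> is zero, and its translate by \<open>x\<close>
  carries the Gaussian number of \<open>r\<close>, which vanishes because \<open>q ^ \<nu>\<close>
  is a primitive \<open>r\<close>th root of unity with \<open>r > 1\<close>.\<close>

lemma X_pow_r: "\<xi> [^]\<^bsub>D\<^esub> r = \<zero>\<^bsub>D\<^esub>"
proof (rule dual_eq_translates[where c = 1])
  show "L x (\<xi> [^]\<^bsub>D\<^esub> r) = L x \<zero>\<^bsub>D\<^esub>"
    using L_x_X_pow[of "r - 1"] gauss_number_zero[OF primitive_r r_gt_1] r_gt_1 by (simp add: L_zero)
  show "(\<xi> [^]\<^bsub>D\<^esub> r) \<one>\<^bsub>R\<^esub> = \<zero>\<^bsub>D\<^esub> \<one>\<^bsub>R\<^esub>"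
    using r_gt_1 by (simp add: X_pow_one dual_apply)
qed (simp_all add: L_a_X_pow L_zero)

section \<open>Values of the products of powers of \<open>A\<close> and \<open>\<xi>\<close> on
  monomials\<close>

abbreviation M where "M i j \<equiv> A [^]\<^bsub>D\<^esub> (i::nat) \<otimes>\<^bsub>D\<^esub> \<xi> [^]\<^bsub>D\<^esub> (j::nat)"

lemma L_x_M:
  "L x (M i 0) = \<zero>\<^bsub>D\<^esub>" "L x (M i (Suc j)) = gauss_number (q ^ \<nu>) (Suc j) \<odot>\<^bsub>D\<^esub> M (i + \<mu>) j"
proof -
  show "L x (M i 0) = \<zero>\<^bsub>D\<^esub>"
    by (simp add: L_x_A_pow)
  have "L x (M i (Suc j)) = A [^]\<^bsub>D\<^esub> i \<otimes>\<^bsub>D\<^esub> L x (\<xi> [^]\<^bsub>D\<^esub> Suc j)"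
    by (simp only: L_x_mult H.DD.A.nat_pow_closed A_closed X_closed L_x_A_pow L_closed class_closed R.nat_pow_closed
        H.DD.A.l_null H.DD.A.l_zero H.DD.A.m_closed)
  also have "\<dots> = gauss_number (q ^ \<nu>) (Suc j) \<odot>\<^bsub>D\<^esub> M (i + \<mu>) j"
    by (simp add: L_x_X_pow H.DD.A.smult_mult_right H.DD.A.nat_pow_mult flip: H.DD.A.m_assoc del: nat_pow_Suc H.DD.A.nat_pow_Suc)
  finally show "L x (M i (Suc j)) = gauss_number (q ^ \<nu>) (Suc j) \<odot>\<^bsub>D\<^esub> M (i + \<mu>) j" .
qed

text \<open>Each \<open>x\<close> removed from the argument lowers the exponent of
  \<open>\<xi>\<close> and contributes a Gaussian number. The exponent of \<open>A\<close> grows by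
  \<open>\<mu>\<close> meanwhile, hence the induction for all \<open>i\<close>; it does not affect
  the value at \<open>\<one>\<close>.\<close>

lemma M_x_pow: "M i j (x [^]\<^bsub>R\<^esub> (t::nat)) = (if t = j then gauss_fact (q ^ \<nu>) j else 0)"
proof (induction t arbitrary: i j)
  case 0
  then show ?case
    by (simp add: dual_mult_one A_pow_one X_pow_one)
next
  case (Suc t)
  have "x [^]\<^bsub>R\<^esub> Suc t = x \<otimes>\<^bsub>R\<^esub> x [^]\<^bsub>R\<^esub> t"
    using R.nat_pow_comm[of x 1 t] by simp
  then have "M i j (x [^]\<^bsub>R\<^esub> Suc t) = L x (M i j) (x [^]\<^bsub>R\<^esub> t)"
    by (simp add: L_apply)
  then show ?case
    using Suc by (cases j) (simp_all add: L_x_M dual_apply gauss_fact_Suc del: H.DD.A.nat_pow_Suc nat_pow_Suc, simp add: L_x_A_pow dual_apply)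
qed

lemma L_a_M: "L a (M i j) = \<omega> ^ i \<odot>\<^bsub>D\<^esub> M i j"
  by (simp add: L_a_mult L_a_A_pow L_a_X_pow H.DD.A.smult_mult_left)

lemma M_monomial:
  "M i j (a [^]\<^bsub>R\<^esub> (l::nat) \<otimes>\<^bsub>R\<^esub> x [^]\<^bsub>R\<^esub> (t::nat)) = \<omega> ^ (i * l) * (if t = j then gauss_fact (q ^ \<nu>) j else 0)"
proof -
  have "M i j (a [^]\<^bsub>R\<^esub> l \<otimes>\<^bsub>R\<^esub> x [^]\<^bsub>R\<^esub> t) = L (a [^]\<^bsub>R\<^esub> l) (M i j) (x [^]\<^bsub>R\<^esub> t)"
    by (simp add: L_apply)
  also have "\<dots> = (\<omega> ^ i) ^ l * M i j (x [^]\<^bsub>R\<^esub> t)"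
    by (subst L_pow[OF _ L_a_M]) (simp_all add: dual_apply)
  finally show ?thesis
    by (simp add: M_x_pow power_mult)
qed

section \<open>The homomorphism from \<open>K\<close> to the dual and its inverse\<close>

definition \<psi> where "\<psi> = hom_by_generators D (case_generator A \<xi>)"

lemma \<psi>_hom: "\<psi> \<in> algebra_homs K.R D" and \<psi>_gen: "\<psi> K.a = A" "\<psi> K.x = \<xi>"
proof -
  have "satisfies_radford D (\<omega> ^ \<nu>) N \<mu> (case_generator A \<xi>)"
    by (simp add: satisfies_radford_def A_pow_N X_A Q_eq X_pow_r)
  from K.hom_by_generators_hom[OF H.dual_assoc_algebra this]
  show "\<psi> \<in> algebra_homs K.R D" "\<psi> K.a = A" "\<psi> K.x = \<xi>"
    by (simp_all add: \<psi>_def)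
qed

lemma \<psi>_pow: "\<psi> (K.a [^]\<^bsub>K.R\<^esub> (i::nat)) = A [^]\<^bsub>D\<^esub> i" "\<psi> (K.x [^]\<^bsub>K.R\<^esub> i) = \<xi> [^]\<^bsub>D\<^esub> i"
  using algebra_hom_pow[OF KR.is_assoc_algebra H.dual_assoc_algebra \<psi>_hom] by (simp_all add: \<psi>_gen)

lemma \<psi>_monomial: "\<psi> (K.a [^]\<^bsub>K.R\<^esub> (i::nat) \<otimes>\<^bsub>K.R\<^esub> K.x [^]\<^bsub>K.R\<^esub> (j::nat)) = M i j"
  by (simp add: algebra_hom_mult[OF \<psi>_hom] \<psi>_pow)

text \<open>At the generators this is the multiplicativity of \<open>A\<close> and the product
  formula \<open>X_mult\<close>. The rest follows because \<open>represents\<close> respects unit,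
  product, sum and scalars.\<close>

lemma \<psi>_represents:
  assumes "k \<in> carrier K.R"
  shows "H.represents (tensor_map D D \<psi> \<psi> (K.\<Delta> k)) (\<psi> k)"
proof -
  interpret P: algebra_pair_maps K.R K.R D D \<psi> \<psi>
    by unfold_locales (simp_all add: algebra_hom_linear[OF \<psi>_hom])
  note hom = algebra_hom_comp[OF K.comult_hom P.tensor_map_hom[OF \<psi>_hom \<psi>_hom]]
  have rep_a: "H.represents (pure_tensor D D A A) A"
    by (simp add: H.represents_def H.ev_pure A_mult)
  have rep_x: "H.represents (pure_tensor D D \<xi> (A [^]\<^bsub>D\<^esub> \<mu>) \<oplus>\<^bsub>tensor D D\<^esub> pure_tensor D D \<one>\<^bsub>D\<^esub> \<xi>) \<xi>"
    by (simp add: H.represents_def linear_add[OF H.ev_tensor_linear] H.ev_pure X_mult)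
  have rep_gen: "H.represents (tensor_map D D \<psi> \<psi> (K.\<Delta> (generator_class (\<omega> ^ \<nu>) N \<mu> u))) (\<psi> (generator_class (\<omega> ^ \<nu>) N \<mu> u))" for u
    using rep_a rep_x
    by (cases u) (simp_all add: K.comult_gen \<psi>_gen P.tensor_map_pure linear_add[OF P.tensor_map_linear] \<psi>_pow
        algebra_hom_one[OF \<psi>_hom])
  show ?thesis
    using assms
    by (induction rule: K.radford_induct)
      (simp_all add: rep_gen algebra_hom_one[OF hom] algebra_hom_one[OF \<psi>_hom] H.represents_one
        algebra_hom_mult[OF hom] algebra_hom_mult[OF \<psi>_hom] H.represents_mult
        algebra_hom_add[OF hom] algebra_hom_add[OF \<psi>_hom] H.represents_add
        algebra_hom_smult[OF hom] algebra_hom_smult[OF \<psi>_hom] H.represents_smult)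
qed

text \<open>As \<open>\<one>\<close> is group-like, evaluation at it is a character of the dual, so
  two homomorphisms on \<open>K\<close> are compared at the generators.\<close>

lemma \<psi>_counit:
  assumes "k \<in> carrier K.R" shows "\<psi> k \<one>\<^bsub>R\<^esub> = K.\<epsilon> k"
proof (rule K.radford_hom_eq[OF scalars_algebra _ K.counit_hom _ _ assms])
  have "(\<lambda>f. f \<one>\<^bsub>R\<^esub>) \<in> algebra_homs D scalars"
    by (intro algebra_homsI linear_mapsI) (simp_all add: dual_apply dual_mult_one dual_one_one algebra_hom_one[OF counit_hom])
  then show "(\<lambda>k. \<psi> k \<one>\<^bsub>R\<^esub>) \<in> algebra_homs K.R scalars"
    by (rule algebra_hom_comp[OF \<psi>_hom])
qed (simp_all add: \<psi>_gen A_one X_one K.counit_gen)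

text \<open>The inverse of \<open>\<psi>\<close> is a discrete Fourier transform.\<close>

definition cf where "cf f i j =
  (\<Sum>l<N. inverse (\<omega> ^ (i * l)) * f (a [^]\<^bsub>R\<^esub> l \<otimes>\<^bsub>R\<^esub> x [^]\<^bsub>R\<^esub> j)) / (of_nat N * gauss_fact (q ^ \<nu>) j)"

definition \<rho> where "\<rho> f = (\<Oplus>\<^bsub>K.R\<^esub>p\<in>{..<N} \<times> {..<r}.
  cf f (fst p) (snd p) \<odot>\<^bsub>K.R\<^esub> (K.a [^]\<^bsub>K.R\<^esub> fst p \<otimes>\<^bsub>K.R\<^esub> K.x [^]\<^bsub>K.R\<^esub> snd p))"

lemma cf_linear: "(\<lambda>f. cf f i j) \<in> linear_maps D scalars"
  by (rule linear_mapsI)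
    (simp_all add: cf_def dual_apply sum.distrib sum_distrib_left algebra_simps add_divide_distrib)

text \<open>The values of \<open>M i' j'\<close> on monomials separate into a character in the
  exponent of \<open>a\<close> and a Kronecker symbol in that of \<open>x\<close>; orthogonality of
  roots of unity turns the former into a Kronecker symbol as well.\<close>

lemma cf_M:
  assumes "i < N" "i' < N" "j < r"
  shows "cf (M i' j') i j = (if i = i' \<and> j = j' then 1 else 0)"
proof -
  have "(\<Sum>l<N. inverse (\<omega> ^ (i * l)) * M i' j' (a [^]\<^bsub>R\<^esub> l \<otimes>\<^bsub>R\<^esub> x [^]\<^bsub>R\<^esub> j)) =
    (\<Sum>l<N. inverse (\<omega> ^ (i * l)) * \<omega> ^ (i' * l)) * (if j = j' then gauss_fact (q ^ \<nu>) j' else 0)"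
    by (simp add: M_monomial sum_distrib_right mult.assoc)
  then show ?thesis
    using assms gauss_fact_nonzero[OF primitive_r, of j] primitive_root_of_nat_nonzero[OF \<omega>]
    by (auto simp: cf_def root_orthogonality[OF \<omega>])
qed

text \<open>Fourier inversion: after the two sums are exchanged, orthogonality leaves only the term
  \<open>l' = l\<close>, and the denominator in \<open>cf\<close> cancels.\<close>

lemma sum_cf:
  assumes "l < N" "t < r"
  shows "(\<Sum>i<N. cf f i t * \<omega> ^ (i * l)) * gauss_fact (q ^ \<nu>) t = f (a [^]\<^bsub>R\<^esub> l \<otimes>\<^bsub>R\<^esub> x [^]\<^bsub>R\<^esub> t)"
proof -
  let ?F = "\<lambda>l. f (a [^]\<^bsub>R\<^esub> l \<otimes>\<^bsub>R\<^esub> x [^]\<^bsub>R\<^esub> t)" and ?d = "of_nat N * gauss_fact (q ^ \<nu>) t"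
  have nz: "of_nat N \<noteq> (0 :: 'k)" "gauss_fact (q ^ \<nu>) t \<noteq> 0"
    using gauss_fact_nonzero[OF primitive_r assms(2)] primitive_root_of_nat_nonzero[OF \<omega>] by simp_all
  have "(\<Sum>i<N. cf f i t * \<omega> ^ (i * l)) = (\<Sum>i<N. \<Sum>l'<N. inverse (\<omega> ^ (i * l')) * ?F l' * \<omega> ^ (i * l)) / ?d"
    by (simp add: cf_def sum_divide_distrib sum_distrib_right)
  also have "(\<Sum>i<N. \<Sum>l'<N. inverse (\<omega> ^ (i * l')) * ?F l' * \<omega> ^ (i * l)) =
    (\<Sum>l'<N. ?F l' * (\<Sum>i<N. inverse (\<omega> ^ (l' * i)) * \<omega> ^ (l * i)))"
    by (subst sum.swap) (simp add: sum_distrib_left sum_distrib_right mult_ac)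
  also have "\<dots> = (\<Sum>l'<N. if l' = l then ?F l' * of_nat N else 0)"
    using assms by (intro sum.cong) (simp_all add: root_orthogonality[OF \<omega>])
  also have "\<dots> = ?F l * of_nat N"
    using assms by simp
  finally show ?thesis
    using nz by simp
qed

lemma \<rho>_closed: "\<rho> f \<in> carrier K.R"
  unfolding \<rho>_def by (intro KR.finsum_closed) auto

lemma \<rho>_linear: "\<rho> \<in> linear_maps D K.R"
proof (rule linear_mapsI)
  fix f g assume fg: "f \<in> carrier D" "g \<in> carrier D"
  show "\<rho> (f \<oplus>\<^bsub>D\<^esub> g) = \<rho> f \<oplus>\<^bsub>K.R\<^esub> \<rho> g"
    unfolding \<rho>_def using fg linear_add[OF cf_linear]
    by (subst KR.finsum_addf[symmetric]) (auto simp: KR.smult_add_left intro!: KR.finsum_cong')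
next
  fix c f assume f: "f \<in> carrier D"
  show "\<rho> (c \<odot>\<^bsub>D\<^esub> f) = c \<odot>\<^bsub>K.R\<^esub> \<rho> f"
    unfolding \<rho>_def using f linear_smult[OF cf_linear]
    by (subst KR.finsum_smult) (auto simp: KR.smult_smult intro!: KR.finsum_cong')
qed (rule \<rho>_closed)

text \<open>The two functionals are compared on the monomials spanning \<open>H\<close>, where their
  agreement is Fourier inversion.\<close>

lemma \<psi>_\<rho>:
  assumes f: "f \<in> carrier D" shows "\<psi> (\<rho> f) = f"
proof -
  have \<psi>\<rho>: "\<psi> (\<rho> f) \<in> carrier D"
    by (rule algebra_hom_closed[OF \<psi>_hom \<rho>_closed])
  show ?thesis
  proof (rule dual_eqI[OF \<psi>\<rho> f], rule monomials_determine[OF scalars_algebra dual_linear[OF \<psi>\<rho>] dual_linear[OF f]])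
    fix l t assume st: "l < N" "t < r"
    let ?h = "a [^]\<^bsub>R\<^esub> l \<otimes>\<^bsub>R\<^esub> x [^]\<^bsub>R\<^esub> t"
    have "(\<lambda>f. f ?h) \<in> linear_maps D scalars"
      by (rule linear_mapsI) (simp_all add: dual_apply)
    then have lin: "(\<lambda>k. \<psi> k ?h) \<in> linear_maps K.R scalars"
      by (rule linear_comp[OF algebra_hom_linear[OF \<psi>_hom]])
    have "\<psi> (\<rho> f) ?h = (\<Sum>p\<in>{..<N} \<times> {..<r}. \<psi> (
        cf f (fst p) (snd p) \<odot>\<^bsub>K.R\<^esub> (K.a [^]\<^bsub>K.R\<^esub> fst p \<otimes>\<^bsub>K.R\<^esub> K.x [^]\<^bsub>K.R\<^esub> snd p)) ?h)"
      unfolding \<rho>_def by (subst KR.linear_finsum[OF scalars_algebra lin]) (auto simp: finsum_scalars)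
    also have "\<dots> = (\<Sum>(i, j)\<in>{..<N} \<times> {..<r}. cf f i j * (\<omega> ^ (i * l) * (if t = j then gauss_fact (q ^ \<nu>) j else 0)))"
      by (intro sum.cong) (auto simp: algebra_hom_smult[OF \<psi>_hom] \<psi>_monomial dual_apply M_monomial)
    also have "\<dots> = (\<Sum>i<N. \<Sum>j<r. cf f i j * (\<omega> ^ (i * l) * (if t = j then gauss_fact (q ^ \<nu>) j else 0)))"
      by (simp add: sum.cartesian_product)
    also have "\<dots> = (\<Sum>i<N. cf f i t * \<omega> ^ (i * l)) * gauss_fact (q ^ \<nu>) t"
    proof -
      have "(\<Sum>j<r. cf f i j * (\<omega> ^ (i * l) * (if t = j then gauss_fact (q ^ \<nu>) j else 0))) =
        cf f i t * \<omega> ^ (i * l) * gauss_fact (q ^ \<nu>) t" for i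
      proof -
        have "(\<Sum>j<r. cf f i j * (\<omega> ^ (i * l) * (if t = j then gauss_fact (q ^ \<nu>) j else 0))) =
          (\<Sum>j<r. if t = j then cf f i j * \<omega> ^ (i * l) * gauss_fact (q ^ \<nu>) j else 0)"
          by (intro sum.cong) simp_all
        then show ?thesis
          using st by simp
      qed
      then show ?thesis
        by (simp add: sum_distrib_right)
    qed
    finally show "\<psi> (\<rho> f) ?h = f ?h"
      using sum_cf[OF st] by simp
  qed
qed

text \<open>Now the monomials spanning \<open>K\<close> are used: \<open>\<psi>\<close> sends them
  to the functionals \<open>M i j\<close>, whose coefficients under \<open>cf\<close> are Kronecker
  symbols.\<close>

lemma \<rho>_\<psi>:
  assumes k: "k \<in> carrier K.R" shows "\<rho> (\<psi> k) = k"
proof (rule K.monomials_determine[OF KR.is_assoc_algebra linear_comp[OF algebra_hom_linear[OF \<psi>_hom] \<rho>_linear] linear_id(1) _ k])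
  fix i j assume ij: "i < N" "j < K.r"
  then have j: "j < r"
    by (simp add: Q_eq)
  let ?m = "\<lambda>(i, j). K.a [^]\<^bsub>K.R\<^esub> (i::nat) \<otimes>\<^bsub>K.R\<^esub> K.x [^]\<^bsub>K.R\<^esub> (j::nat)"
  \<comment> \<open>The coefficients are absorbed into an indicator of a single pair, the form in
    which \<open>finsum_singleton\<close> evaluates the sum.\<close>
  have "\<rho> (\<psi> (?m (i, j))) = (\<Oplus>\<^bsub>K.R\<^esub>p\<in>{..<N} \<times> {..<r}. if (i, j) = p then ?m p else \<zero>\<^bsub>K.R\<^esub>)"
    unfolding \<rho>_def prod.case \<psi>_monomial
  proof (rule KR.finsum_cong'[OF refl])
    fix p assume p: "p \<in> {..<N} \<times> {..<r}"
    show "cf (M i j) (fst p) (snd p) \<odot>\<^bsub>K.R\<^esub> (K.a [^]\<^bsub>K.R\<^esub> fst p \<otimes>\<^bsub>K.R\<^esub> K.x [^]\<^bsub>K.R\<^esub> snd p) =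
      (if (i, j) = p then case p of (i, j) \<Rightarrow> K.a [^]\<^bsub>K.R\<^esub> i \<otimes>\<^bsub>K.R\<^esub> K.x [^]\<^bsub>K.R\<^esub> j else \<zero>\<^bsub>K.R\<^esub>)"
    proof (cases "(i, j) = p")
      case True
      then show ?thesis
        using p ij by (auto simp: cf_M simp del: set_eq_iff)
    next
      case False
      then have "\<not> (fst p = i \<and> snd p = j)"
        by auto
      then have "cf (M i j) (fst p) (snd p) = 0"
        using p ij by (auto simp: cf_M)
      then show ?thesis
        using False by simp
    qed
  qed auto
  also have "\<dots> = ?m (i, j)"
    using ij j by (intro KR.finsum_singleton) auto
  finally show "\<rho> (\<psi> (K.a [^]\<^bsub>K.R\<^esub> i \<otimes>\<^bsub>K.R\<^esub> K.x [^]\<^bsub>K.R\<^esub> j)) = K.a [^]\<^bsub>K.R\<^esub> i \<otimes>\<^bsub>K.R\<^esub> K.x [^]\<^bsub>K.R\<^esub> j"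
    by simp
qed

theorem dual_isomorphic:
  "hopf_isomorphic (hopf_dual (radford_hopf n q N \<nu>)) (radford_hopf m (\<omega> ^ \<nu>) N \<mu>)"
proof (rule hopf_dual_isomorphicI[OF radford_hopf_algebra K.radford_hopf_algebra])
  show "\<psi> \<in> algebra_homs (radford_hopf m (\<omega> ^ \<nu>) N \<mu>) D"
    by (simp add: \<psi>_hom)
  show "bij_betw \<psi> (carrier (radford_hopf m (\<omega> ^ \<nu>) N \<mu>)) (carrier D)"
    by (rule bij_betw_byWitness[where f' = \<rho>])
      (auto simp: \<psi>_\<rho> \<rho>_\<psi> \<rho>_closed algebra_hom_closed[OF \<psi>_hom])
  fix k assume "k \<in> carrier (radford_hopf m (\<omega> ^ \<nu>) N \<mu>)"
  then show "H.represents (tensor_map D D \<psi> \<psi> (comult (radford_hopf m (\<omega> ^ \<nu>) N \<mu>) k)) (\<psi> k)"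
    "\<psi> k \<one>\<^bsub>radford_hopf n q N \<nu>\<^esub> = counit (radford_hopf m (\<omega> ^ \<nu>) N \<mu>) k"
    by (simp_all add: K.structure_maps \<psi>_represents \<psi>_counit)
qed

end

theorem proposition2p6:
  fixes q \<omega> :: "'k::field" and n N \<nu> :: nat
  assumes "radford_params n q N \<nu>"
    and "generator_class q N \<nu> Gen_x \<noteq> \<zero>\<^bsub>radford_hopf n q N \<nu>\<^esub>"
    and "primitive_root_of_unity N \<omega>"
  shows "\<exists>\<mu>. 0 \<le> \<mu> \<and> \<mu> \<le> N - 1 \<and> q = \<omega> ^ \<mu> \<and>
    radford_params (N div gcd N \<nu>) (\<omega> ^ \<nu>) N \<mu> \<and>
    hopf_isomorphic (hopf_dual (radford_hopf n q N \<nu>))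
      (radford_hopf (N div gcd N \<nu>) (\<omega> ^ \<nu>) N \<mu>)"
proof -
  have N: "0 < N" and q_n: "q ^ n = 1" and n: "n dvd N"
    using assms(1) by (simp_all add: radford_params_def primitive_root_of_unity_def)
  then have q_N: "q ^ N = 1"
    by (metis dvd_def power_mult power_one)
  interpret radford_root q N \<nu>
    by unfold_locales (fact q_N, fact N)
  interpret R: assoc_algebra R
    by (rule assoc_algebra_R)
  \<comment> \<open>For \<open>r = 1\<close> the relation \<open>x^r = 0\<close> would read
    \<open>x = 0\<close>, against the assumption on \<open>x\<close>.\<close>
  have "r \<noteq> 1"
  proof
    assume "r = 1"
    then have "x = \<zero>\<^bsub>R\<^esub>"
      using x_pow_r by simp
    then show False
      using assms(2) by simp
  qed
  then have r: "1 < r"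
    using r_pos by simp
  \<comment> \<open>\<open>\<mu>\<close> is the discrete logarithm of \<open>q\<close> to the base
    \<open>\<omega>\<close>; it exists because \<open>q ^ N = 1\<close>.\<close>
  obtain \<mu> where \<mu>: "\<mu> < N" "q = \<omega> ^ \<mu>"
    using root_of_unity_power[OF assms(3) q_N] .
  interpret radford_dual q N \<nu> n \<mu> \<omega>
    by unfold_locales (use assms(3) \<mu> r in simp_all)
  \<comment> \<open>The parameters of the dual must satisfy \<open>1 \<le> \<mu>\<close>. If
    \<open>\<mu>\<close> were zero, then \<open>q = 1\<close>, and \<open>q ^ \<nu>\<close> could
    not be a primitive \<open>r\<close>th root of unity with \<open>r > 1\<close>.\<close>
  have "\<mu> \<noteq> 0"
  proof
    assume "\<mu> = 0"
    then have "q ^ \<nu> = 1"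
      using \<mu> by simp
    then show False
      using r primitive_rootD[OF primitive_r, of 1] by simp
  qed
  moreover have "N div gcd N \<nu> dvd N"
    by (metis dvd_div_mult_self dvd_triv_left gcd_dvd1)
  ultimately have "radford_params (N div gcd N \<nu>) (\<omega> ^ \<nu>) N \<mu>"
    using \<mu> N primitive_root_power_gcd[OF assms(3), of \<nu>]
    by (auto simp: radford_params_def primitive_root_of_unity_def)
  then show ?thesis
    using \<mu> dual_isomorphic by (intro exI[of _ \<mu>]) auto
qed

end
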